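(* Let $\mathsf{H}$ be a finite-dimensional real Hilbert space, let $\mathsf{f}\in\Gamma_0(\mathsf{H})$, let $\mu\in\,]0,+\infty[$, let $\mathsf{h}\colon\mathsf{H}\to\mathbb{R}$ be convex and differentiable with a $\mu^{-1}$-Lipschitz-continuous gradient, and let $q$ be a strictly positive integer. For every $k\in\{1,\ldots,q\}$, let $\mathsf{G}_k$ be a finite-dimensional real Hilbert space, let $\mathsf{g}_k\in\Gamma_0(\mathsf{G}_k)$, and let $\mathsf{L}_k\colon\mathsf{H}\to\mathsf{G}_k$ be linear. Let $\boldsymbol{\mathsf{G}}=\mathsf{G}_1\oplus\cdots\oplus\mathsf{G}_q$ be the direct Hilbert sum, and suppose that there exists $\overline{\mathsf{x}}\in\mathsf{H}$ such that $$0\in\partial\mathsf{f}(\overline{\mathsf{x}})+\sum_{k=1}^q\mathsf{L}_k^*\,\partial\mathsf{g}_k(\mathsf{L}_k\overline{\mathsf{x}})+\nabla\mathsf{h}(\overline{\mathsf{x}}).$$ Let $\mathsf{F}$ be the set of solutions to the primal problem $$\underset{\mathsf{x}\in\mathsf{H}}{\text{minimize}}\ \ \mathsf{f}(\mathsf{x})+\sum_{k=1}^q\mathsf{g}_k(\mathsf{L}_k\mathsf{x})+\mathsf{h}(\mathsf{x})$$ and let $\boldsymbol{\mathsf{F}}^*$ be the set of solutions to the dual problem $$\underset{\boldsymbol{\mathsf{v}}=(\mathsf{v}_1,\ldots,\mathsf{v}_q)\in\boldsymbol{\mathsf{G}}}{\text{minimize}}\ \ (\mathsf{f}^*\,\square\,\mathsf{h}^*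 )\Big(-\sum_{k=1}^q\mathsf{L}_k^*\mathsf{v}_k\Big)+\sum_{k=1}^q\mathsf{g}_k^*(\mathsf{v}_k).$$ Let $(\Omega,\mathcal{F},\mathsf{P})$ be a probability space, let $\rho\in\,]0,+\infty[$, let $(\mathsf{f}_n)_{n\in\mathbb{N}}$ be a sequence of functions in $\Gamma_0(\mathsf{H})$, let $(\lambda_n)_{n\in\mathbb{N}}$ be a sequence in $]0,1]$ such that $\sum_{n\in\mathbb{N}}\lambda_n=+\infty$, and, for every $k\in\{1,\ldots,q\}$, let $\sigma_k\in\,]0,+\infty[$. Let $x_0$, $(u_n)_{n\in\mathbb{N}}$, and $(b_n)_{n\in\mathbb{N}}$ be random variables in $L^2(\Omega,\mathcal{F},\mathsf{P};\mathsf{H})$, and let $\boldsymbol{v}_0=(v_{1,0},\ldots,v_{q,0})$ and $(\boldsymbol{c}_n)_{n\in\mathbb{N}}=(c_{1,n},\ldots,c_{q,n})_{n\in\mathbb{N}}$ be random variables in $L^2(\Omega,\mathcal{F},\mathsf{P};\boldsymbol{\mathsf{G}})$. Let $(x_n)_{n\in\mathbb{N}}$ and $(\boldsymbol{v}_n)_{n\in\mathbb{N}}=(v_{1,n},\ldots,v_{q,n})_{n\in\mathbb{N}}$ be generated, for $n=0,1,\ldots$, by $$\begin{aligned} y_n&=\operatorname{prox}_{\rho\mathsf{f}_n}\Big(x_n-\rho\Big(\sum_{k=1}^q\mathsf{L}_k^*v_{k,n}+u_n\Big)\Big)+b_n,\\ x_{n+1}&=x_n+\lambda_n(y_n-x_n),\\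 &\text{and, for } k=1,\ldots,q,\\ w_{k,n}&=\operatorname{prox}_{\sigma_k\mathsf{g}_k^*}\big(v_{k,n}+\sigma_k\mathsf{L}_k(2y_n-x_n)\big)+c_{k,n},\\ v_{k,n+1}&=v_{k,n}+\lambda_n(w_{k,n}-v_{k,n}). \end{aligned}$$ Let $\mathscr{X}=(\boldsymbol{\mathcal{X}}_n)_{n\in\mathbb{N}}$ be a sequence of sub-sigma-algebras of $\mathcal{F}$. Suppose that the following are satisfied: (a) For every $n\in\mathbb{N}$, $\sigma\big((x_{n'},\boldsymbol{v}_{n'})_{0\leq n'\leq n}\big)\subset\boldsymbol{\mathcal{X}}_n\subset\boldsymbol{\mathcal{X}}_{n+1}$. (b) $\sum_{n\in\mathbb{N}}\lambda_n\sqrt{\mathsf{E}(\|b_n\|^2\mid\boldsymbol{\mathcal{X}}_n)}<+\infty$ and $\sum_{n\in\mathbb{N}}\lambda_n\sqrt{\mathsf{E}(\|\boldsymbol{c}_n\|^2\mid\boldsymbol{\mathcal{X}}_n)}<+\infty$ $\mathsf{P}$-a.s. (c) $\sum_{n\in\mathbb{N}}\sqrt{\lambda_n}\,\|\mathsf{E}(u_n\mid\boldsymbol{\mathcal{X}}_n)-\nabla\mathsf{h}(x_n)\|<+\infty$ $\mathsf{P}$-a.s. (d) There exists a summable sequence $(\tau_n)_{n\in\mathbb{N}}$ in $[0,+\infty[$ such that, for every $\mathsf{x}\in\mathsf{F}$, there exists $(\zeta_n(\mathsf{x}))_{n\in\mathbb{N}}\in\ell_+^\infty(\mathscr{X})$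 such that $(\lambda_n\zeta_n(\mathsf{x}))_{n\in\mathbb{N}}\in\ell_+^{1/2}(\mathscr{X})$ and $$(\forall n\in\mathbb{N})\quad\mathsf{E}\big(\|u_n-\mathsf{E}(u_n\mid\boldsymbol{\mathcal{X}}_n)\|^2\mid\boldsymbol{\mathcal{X}}_n\big)\leq\tau_n\|\nabla\mathsf{h}(x_n)-\nabla\mathsf{h}(\mathsf{x})\|^2+\zeta_n(\mathsf{x}).$$ (e) There exist sequences $(\alpha_n)_{n\in\mathbb{N}}$ and $(\beta_n)_{n\in\mathbb{N}}$ in $[0,+\infty[$ such that $\sum_{n\in\mathbb{N}}\sqrt{\lambda_n}\,\alpha_n<+\infty$, $\sum_{n\in\mathbb{N}}\lambda_n\beta_n<+\infty$, and $$(\forall n\in\mathbb{N})(\forall\mathsf{x}\in\mathsf{H})\quad\|\operatorname{prox}_{\rho\mathsf{f}_n}\mathsf{x}-\operatorname{prox}_{\rho\mathsf{f}}\mathsf{x}\|\leq\alpha_n\|\mathsf{x}\|+\beta_n.$$ (f) $\big(\rho^{-1}-\sum_{k=1}^q\sigma_k\|\mathsf{L}_k\|^2\big)\mu>1/2$. Then, for some $\mathsf{F}$-valued random variable $x$ and some $\boldsymbol{\mathsf{F}}^*$-valued random variable $\boldsymbol{v}$, $(x_n)_{n\in\mathbb{N}}$ converges $\mathsf{P}$-almost surely to $x$ and $(\boldsymbol{v}_n)_{n\in\mathbb{N}}$ converges $\mathsf{P}$-almost surely to $\boldsymbol{v}$.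
   Context: $\Gamma_0(\mathsf{H})$ is the class of proper lower semicontinuous convex functions from $\mathsf{H}$ to $]-\infty,+\infty]$. For $\mathsf{f}\in\Gamma_0(\mathsf{H})$: the subdifferential is $\partial\mathsf{f}(\mathsf{x})=\{\mathsf{u}\in\mathsf{H}\mid(\forall\mathsf{y}\in\mathsf{H})\ \langle\mathsf{y}-\mathsf{x}\mid\mathsf{u}\rangle+\mathsf{f}(\mathsf{x})\leq\mathsf{f}(\mathsf{y})\}$; $\mathsf{f}^*$ is the Fenchel conjugate; for $\gamma\in\,]0,+\infty[$, the proximity operator is $\operatorname{prox}_{\gamma\mathsf{f}}\colon\mathsf{x}\mapsto\operatorname{argmin}_{\mathsf{y}\in\mathsf{H}}\big(\mathsf{f}(\mathsf{y})+\frac{1}{2\gamma}\|\mathsf{x}-\mathsf{y}\|^2\big)$. The symbol $\square$ denotes infimal convolution, $(\mathsf{f}_1\,\square\,\mathsf{f}_2)(\mathsf{x})=\inf_{\mathsf{y}}\big(\mathsf{f}_1(\mathsf{y})+\mathsf{f}_2(\mathsf{x}-\mathsf{y})\big)$. $\mathsf{L}_k^*$ is the adjoint of $\mathsf{L}_k$ and $\|\mathsf{L}_k\|$ its operator norm. $L^2(\Omega,\mathcal{F},\mathsf{P};\mathsf{H})$ is the space of $\mathsf{H}$-valued random variables $x$ with $\mathsf{E}\|x\|^2<+\infty$ (similarly for $\boldsymbol{\mathsf{G}}$). Given $\mathscr{X}=(\boldsymbol{\mathcal{X}}_n)_{n\in\mathbb{N}}$, $\ell_+(\mathscr{X})$ is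 the set of sequences $(\xi_n)_{n\in\mathbb{N}}$ of $[0,+\infty[$-valued random variables such that $\xi_n$ is $\boldsymbol{\mathcal{X}}_n$-measurable for every $n\in\mathbb{N}$; moreover $$\ell_+^{1/2}(\mathscr{X})=\Big\{(\xi_n)_{n\in\mathbb{N}}\in\ell_+(\mathscr{X})\;\Big|\;\sum_{n\in\mathbb{N}}\xi_n^{1/2}<+\infty\ \mathsf{P}\text{-a.s.}\Big\},\qquad \ell_+^{\infty}(\mathscr{X})=\Big\{(\xi_n)_{n\in\mathbb{N}}\in\ell_+(\mathscr{X})\;\Big|\;\sup_{n\in\mathbb{N}}\xi_n<+\infty\ \mathsf{P}\text{-a.s.}\Big\}.$$ Relations involving conditional expectations are understood $\mathsf{P}$-almost surely. *)

theory Defs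
  imports "HOL-Probability.Probability"
begin

text \<open>A finite-dimensional real Hilbert space is a type of class \<^class>\<open>euclidean_space\<close> or,
  when a family of possibly different spaces indexed by a finite type is needed, a linear subspace
  \<open>S\<close> of such a type with the induced inner product.  The notions of convex analysis below are
  therefore relative to a carrier \<open>S\<close>; the behaviour of functions outside \<open>S\<close> is irrelevant.\<close>

definition Gamma0 :: "'a::euclidean_space set \<Rightarrow> ('a \<Rightarrow> ereal) set" where
  "Gamma0 S = {f.
     (\<forall>x\<in>S. f x \<noteq> -\<infinity>) \<and> (\<exists>x\<in>S. f x \<noteq> \<infinity>) \<and>
     (\<forall>x\<in>S. f x \<le> Liminf (at x within S) f) \<and>
     (\<forall>x\<in>S. \<forall>y\<in>S. \<forall>t\<in>{0<..<1::real}.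
        f ((1 - t) *\<^sub>R x + t *\<^sub>R y) \<le> ereal (1 - t) * f x + ereal t * f y)}"

definition subdifferential :: "'a::euclidean_space set \<Rightarrow> ('a \<Rightarrow> ereal) \<Rightarrow> 'a \<Rightarrow> 'a set" where
  "subdifferential S f x = {u \<in> S. \<forall>y\<in>S. ereal ((y - x) \<bullet> u) + f x \<le> f y}"

definition fenchel_conjugate :: "'a::euclidean_space set \<Rightarrow> ('a \<Rightarrow> ereal) \<Rightarrow> 'a \<Rightarrow> ereal" where
  "fenchel_conjugate S f u = (SUP x\<in>S. ereal (x \<bullet> u) - f x)"

definition prox :: "'a::euclidean_space set \<Rightarrow> real \<Rightarrow> ('a \<Rightarrow> ereal) \<Rightarrow> 'a \<Rightarrow> 'a" where
  "prox S \<gamma> f x = arg_min_on (\<lambda>y. f y + ereal (1 / (2 * \<gamma>) * (norm (x - y))\<^sup>2)) S"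

definition inf_convolution ::
    "'a::euclidean_space set \<Rightarrow> ('a \<Rightarrow> ereal) \<Rightarrow> ('a \<Rightarrow> ereal) \<Rightarrow> 'a \<Rightarrow> ereal" where
  "inf_convolution S f1 f2 x = (INF y\<in>S. f1 y + f2 (x - y))"

text \<open>The direct Hilbert sum of the subspaces \<open>G k\<close>: the inner product of \<^typ>\<open>('g, 'q) vec\<close>
  is the sum of the inner products of the components.\<close>

definition hilbert_sum :: "('q::finite \<Rightarrow> 'g::euclidean_space set) \<Rightarrow> ('g ^ 'q) set" where
  "hilbert_sum G = {v. \<forall>k. v $ k \<in> G k}"

definition primal_solutions ::
    "('h::euclidean_space \<Rightarrow> ereal) \<Rightarrow> ('h \<Rightarrow> real) \<Rightarrow> ('q::finite \<Rightarrow> 'g::euclidean_space \<Rightarrow> ereal) \<Rightarrow>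
     ('q \<Rightarrow> 'h \<Rightarrow> 'g) \<Rightarrow> 'h set" where
  "primal_solutions f h g L =
     {x. is_arg_min (\<lambda>x. f x + (\<Sum>k\<in>UNIV. g k (L k x)) + ereal (h x)) (\<lambda>x. x \<in> UNIV) x}"

text \<open>Since \<open>L k\<close> takes its values in \<open>G k\<close>, the adjoint of \<open>L k\<close> as a map into \<open>G k\<close> is the
  restriction to \<open>G k\<close> of its adjoint as a map into the ambient space.\<close>

definition dual_solutions ::
    "('h::euclidean_space \<Rightarrow> ereal) \<Rightarrow> ('h \<Rightarrow> real) \<Rightarrow> ('q::finite \<Rightarrow> 'g::euclidean_space set) \<Rightarrow>
     ('q \<Rightarrow> 'g \<Rightarrow> ereal) \<Rightarrow> ('q \<Rightarrow> 'h \<Rightarrow> 'g) \<Rightarrow> ('g ^ 'q) set" where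
  "dual_solutions f h G g L =
     {v. is_arg_min
       (\<lambda>v. inf_convolution UNIV (fenchel_conjugate UNIV f) (fenchel_conjugate UNIV (\<lambda>x. ereal (h x)))
              (- (\<Sum>k\<in>UNIV. adjoint (L k) (v $ k)))
            + (\<Sum>k\<in>UNIV. fenchel_conjugate (G k) (g k) (v $ k)))
       (\<lambda>v. v \<in> hilbert_sum G) v}"

definition L2_rv :: "'w measure \<Rightarrow> 'a::euclidean_space set \<Rightarrow> ('w \<Rightarrow> 'a) set" where
  "L2_rv M S = {X \<in> borel_measurable M.
     (\<forall>\<omega>\<in>space M. X \<omega> \<in> S) \<and> integrable M (\<lambda>\<omega>. (norm (X \<omega>))\<^sup>2)}"

definition has_cond_exp :: "'w measure \<Rightarrow> 'w measure \<Rightarrow> ('w \<Rightarrow> 'a::euclidean_space) \<Rightarrow> ('w \<Rightarrow> 'a) \<Rightarrow> bool" where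
  "has_cond_exp M N X Y \<longleftrightarrow>
     integrable M X \<and> Y \<in> borel_measurable N \<and> integrable M Y \<and>
     (\<forall>A\<in>sets N. (LINT \<omega>:A|M. Y \<omega>) = (LINT \<omega>:A|M. X \<omega>))"

text \<open>Some version of the conditional expectation of an integrable random vector; the library only
  provides \<^const>\<open>real_cond_exp\<close>, for real random variables.\<close>

definition vec_cond_exp :: "'w measure \<Rightarrow> 'w measure \<Rightarrow> ('w \<Rightarrow> 'a::euclidean_space) \<Rightarrow> 'w \<Rightarrow> 'a" where
  "vec_cond_exp M N X = (SOME Y. has_cond_exp M N X Y)"

definition ell_plus :: "'w measure \<Rightarrow> (nat \<Rightarrow> 'w measure) \<Rightarrow> (nat \<Rightarrow> 'w \<Rightarrow> real) set" where
  "ell_plus M N = {\<xi>. \<forall>n. \<xi> n \<in> borel_measurable (N n) \<and> (\<forall>\<omega>\<in>space M. 0 \<le> \<xi> n \<omega>)}"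

definition ell_plus_half :: "'w measure \<Rightarrow> (nat \<Rightarrow> 'w measure) \<Rightarrow> (nat \<Rightarrow> 'w \<Rightarrow> real) set" where
  "ell_plus_half M N = {\<xi> \<in> ell_plus M N. AE \<omega> in M. summable (\<lambda>n. sqrt (\<xi> n \<omega>))}"

definition ell_plus_infty :: "'w measure \<Rightarrow> (nat \<Rightarrow> 'w measure) \<Rightarrow> (nat \<Rightarrow> 'w \<Rightarrow> real) set" where
  "ell_plus_infty M N = {\<xi> \<in> ell_plus M N. AE \<omega> in M. bdd_above (range (\<lambda>n. \<xi> n \<omega>))}"

end

theory Submission
  imports Defs
begin

text \<open>In the space renormed by the quadratic form \<open>Q(x, v) = |x|^2 / \<rho> - 2 (\<Sum>k. <L_k x, v_k>) + (\<Sum>k. |v_k|^2 / \<sigma>_k)\<close>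
  the exact algorithm is a relaxed forward-backward iteration.  Its operator \<open>T\<close> is continuous and its fixed
  points are primal-dual solutions.  By the Baillon--Haddad theorem the forward part is cocoercive, and the step
  size condition makes \<open>Q(z - p) - Q(T z - p)\<close> at least a multiple of \<open>Q(z - T z)\<close> for every fixed point \<open>p\<close>.
  The random errors turn this into a recursion
  \<open>E(Q(z' - p) | X_n) \<le> Q(z - p) + \<eta>_n (1 + Q(z - p)) - \<theta>/2 \<lambda>_n Q(z - T z)\<close> with \<open>\<eta>_n\<close> almost surely summable.
  The Robbins--Siegmund theorem then gives, almost surely, convergence of \<open>Q(z_n - p)\<close> for \<open>p\<close> in a countable
  dense set of fixed points and \<open>(\<Sum>n. \<lambda>_n Q(z_n - T z_n)) < \<infinity>\<close>.  As \<open>(\<Sum>n. \<lambda>_n) = \<infinity>\<close>, some subsequence has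
  \<open>Q(z_n - T z_n) \<rightarrow> 0\<close>, and in finite dimension it has a cluster point, which is fixed and attracts
  the whole sequence.\<close>

section \<open>Convex analysis and proximity operators\<close>

text \<open>The gradient estimate \<open>u\<close> carries noise that is controlled only in
  conditional mean square, so the noise must not survive to first order. Hence the cross term is
  taken against \<open>fst (T z) - fst p\<close>, built from the exact step and therefore a function
  of the past: conditioning turns \<open>u\<close> into its conditional mean, and the rest of the
  noise enters quadratically. The errors \<open>b\<close> and \<open>c\<close> are summable only
  through square roots of conditional second moments, whereas \<open>Q\<close> is quadratic. A Young
  inequality with parameter \<delta> reconciles the two: it costs a factor 1 + \<delta> on
  \<open>Q\<close> and a term of the form error / \<delta>, so \<delta> is chosen random, known from
  the past, and of the size of the square root of the error. The weights \<open>sqrt l\<close> in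
  the hypotheses make this \<delta> summable. The threshold 1/2 in the step condition is the point
  where the loss 1 / (2 \<mu> \<kappa>) caused by the gradient falls below the gain 1 of the
  backward step. Finally, the functions are constrained only on the subspaces \<open>G k\<close>, so
  continuity and fixed points are always read on the closed set \<open>feasible\<close>.\<close>

lemma Gamma0_not_MInf: "f \<in> Gamma0 S \<Longrightarrow> x \<in> S \<Longrightarrow> f x \<noteq> -\<infinity>"
  by (auto simp: Gamma0_def)

lemma Gamma0_proper:
  assumes "f \<in> Gamma0 S"
  obtains x where "x \<in> S" "\<bar>f x\<bar> \<noteq> \<infinity>"
  using assms by (fastforce simp: Gamma0_def)

lemma Gamma0_convex:
  assumes "f \<in> Gamma0 S" "x \<in> S" "y \<in> S" "0 < t" "t < 1"
  shows "f ((1 - t) *\<^sub>R x + t *\<^sub>R y) \<le> ereal (1 - t) * f x + ereal t * f y"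
  using assms by (auto simp: Gamma0_def)

text \<open>The \<open>Liminf\<close> in \<open>Gamma0\<close> runs along
  \<open>at x within S\<close>, which leaves out \<open>x\<close> itself; terms of the sequence
  equal to \<open>x\<close> are settled separately, by \<open>c < f x\<close>.\<close>

lemma Gamma0_lsc_sequentially:
  assumes f: "f \<in> Gamma0 S" and X: "\<And>n. X n \<in> S" "X \<longlonglongrightarrow> x" and x: "x \<in> S" and c: "c < f x"
  shows "\<forall>\<^sub>F n in sequentially. c < f (X n)"
proof -
  have "f x \<le> Liminf (at x within S) f"
    using f x by (auto simp: Gamma0_def)
  with c have "\<forall>\<^sub>F y in at x within S. c < f y"
    by (auto simp: le_Liminf_iff)
  then have "\<forall>\<^sub>F y in nhds x. y \<noteq> x \<longrightarrow> y \<in> S \<longrightarrow> c < f y"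
    by (simp add: eventually_at_filter)
  then have "\<forall>\<^sub>F n in sequentially. X n \<noteq> x \<longrightarrow> X n \<in> S \<longrightarrow> c < f (X n)"
    using X(2) by (rule eventually_compose_filterlim)
  then show ?thesis
    by eventually_elim (use c X in auto)
qed

text \<open>The direct method on a compact set. The continuous summand \<open>q\<close> is carried
  along so that one lemma serves both \<open>f\<close> alone and the proximal objective.\<close>

lemma Gamma0_attains_inf:
  fixes f :: "'a::euclidean_space \<Rightarrow> ereal"
  assumes f: "f \<in> Gamma0 S" and K: "compact K" "K \<subseteq> S" "K \<noteq> {}"
    and q: "continuous_on UNIV q"
  shows "\<exists>p\<in>K. \<forall>y\<in>K. f p + ereal (q p) \<le> f y + ereal (q y)"
proof -
  let ?F = "\<lambda>y. f y + ereal (q y)"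
  obtain s where s: "\<And>n. s n \<in> ?F ` K" "s \<longlonglongrightarrow> Inf (?F ` K)"
    using Inf_as_limit[of "?F ` K"] K by auto
  then have "\<forall>n. \<exists>x. x \<in> K \<and> s n = ?F x" by blast
  then obtain X where X: "\<And>n. X n \<in> K" "\<And>n. s n = ?F (X n)"
    by (auto dest!: choice)
  obtain p r where p: "p \<in> K" "strict_mono r" "(X \<circ> r) \<longlonglongrightarrow> p"
    using K(1) X(1) unfolding compact_def by metis
  have "?F p \<le> Inf (?F ` K)"
  proof (rule ccontr)
    assume "\<not> ?thesis"
    then obtain c where c: "Inf (?F ` K) < ereal c" "ereal c < ?F p"
      by (meson ereal_dense2 not_le)
    have "ereal (c - q p) < f p"
      using c(2) by (cases "f p") auto
    then obtain c' where c': "ereal (c - q p) < ereal c'" "ereal c' < f p"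
      by (meson ereal_dense2)
    have "\<forall>\<^sub>F n in sequentially. ereal c' < f ((X \<circ> r) n)"
      using Gamma0_lsc_sequentially[OF f, of "X \<circ> r" p] p X K(2) c' by auto
    moreover have "(\<lambda>n. q ((X \<circ> r) n)) \<longlonglongrightarrow> q p"
      using continuous_on_tendsto_compose[OF q p(3)] by (simp add: o_def)
    then have "\<forall>\<^sub>F n in sequentially. c - c' < q ((X \<circ> r) n)"
      using c'(1) by (intro order_tendstoD) auto
    ultimately have "\<forall>\<^sub>F n in sequentially. ereal c \<le> (s \<circ> r) n"
    proof eventually_elim
      case (elim n)
      then show ?case using X(2)[of "r n"] by (cases "f (X (r n))") auto
    qed
    moreover have "(s \<circ> r) \<longlonglongrightarrow> Inf (?F ` K)"
      using s(2) p(2) by (rule LIMSEQ_subseq_LIMSEQ)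
    ultimately have "ereal c \<le> Inf (?F ` K)"
      using tendsto_lowerbound trivial_limit_sequentially by blast
    with c(1) show False by auto
  qed
  then show ?thesis
    using p(1) by (metis INF_lower order_trans)
qed

text \<open>A minorant obtained without separation theorems. Let \<open>m\<close> be the minimum of
  \<open>f\<close> on the unit ball of \<open>S\<close> around a point \<open>a\<close> of the
  domain. For \<open>y\<close> at distance \<open>s\<close> > 1 from \<open>a\<close>, convexity on
  the segment from \<open>a\<close> to \<open>y\<close> gives \<open>f y\<close> \<ge>
  \<open>fa - s * (fa - m)\<close>, hence the slope \<open>B = fa - m\<close>.\<close>

lemma Gamma0_linear_lower_bound:
  fixes f :: "'a::euclidean_space \<Rightarrow> ereal"
  assumes f: "f \<in> Gamma0 S" and S: "subspace S"
  shows "\<exists>A B. \<forall>y\<in>S. ereal (A - B * norm y) \<le> f y \<and> B \<ge> 0"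
proof -
  obtain a where a: "a \<in> S" "\<bar>f a\<bar> \<noteq> \<infinity>"
    using Gamma0_proper[OF f] by blast
  then obtain fa where fa: "f a = ereal fa" by auto
  let ?K = "S \<inter> cball a 1"
  have "compact ?K"
    by (intro closed_Int_compact closed_subspace S compact_cball)
  moreover have "?K \<noteq> {}" using a by auto
  ultimately have "\<exists>p\<in>?K. \<forall>y\<in>?K. f p \<le> f y"
    using Gamma0_attains_inf[OF f, of ?K "\<lambda>_. 0"] by (simp flip: zero_ereal_def)
  then obtain p where p: "p \<in> ?K" "\<And>y. y \<in> ?K \<Longrightarrow> f p \<le> f y"
    by blast
  have "f p \<noteq> -\<infinity>" using Gamma0_not_MInf[OF f] p by auto
  moreover have "f p \<le> ereal fa" using p(2)[of a] a fa by auto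
  ultimately obtain m where m: "f p = ereal m" by (cases "f p") auto
  define B where "B = fa - m"
  have B: "B \<ge> 0" using m \<open>f p \<le> ereal fa\<close> by (simp add: B_def)
  have "ereal (m - B * (1 + norm a) - B * norm y) \<le> f y" if y: "y \<in> S" for y
  proof -
    have tri: "norm (y - a) \<le> norm y + norm a" by (rule norm_triangle_ineq4)
    show ?thesis
    proof (cases "norm (y - a) \<le> 1")
      case True
      then have "ereal m \<le> f y"
        using p(2)[of y] y m by (auto simp: dist_norm norm_minus_commute)
      moreover have "m - B * (1 + norm a) - B * norm y \<le> m"
        using mult_nonneg_nonneg[OF B, of "1 + norm a"] mult_nonneg_nonneg[OF B norm_ge_zero[of y]]
          norm_ge_zero[of a] by linarith
      ultimately show ?thesis by (metis ereal_less_eq(3) order_trans)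
    next
      case False
      define s where "s = norm (y - a)"
      have s: "s > 1" using False by (simp add: s_def)
      let ?z = "(1 - 1/s) *\<^sub>R a + (1/s) *\<^sub>R y"
      have zS: "?z \<in> S"
        using a y S by (simp add: subspace_add subspace_scale)
      have "?z - a = (1/s) *\<^sub>R (y - a)" by (simp add: algebra_simps)
      then have "norm (?z - a) = 1" using s by (auto simp: s_def)
      then have "ereal m \<le> f ?z"
        using p(2)[of ?z] zS m by (auto simp: dist_norm norm_minus_commute)
      also have "\<dots> \<le> ereal (1 - 1/s) * f a + ereal (1/s) * f y"
        using Gamma0_convex[OF f a(1) y, of "1/s"] s by simp
      finally have *: "ereal m \<le> ereal ((1 - 1/s) * fa) + ereal (1/s) * f y"
        using fa by simp
      show ?thesis
      proof (cases "f y")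
        case (real r)
        with * have "m \<le> (1 - 1/s) * fa + (1/s) * r" by simp
        then have "m * s \<le> (s - 1) * fa + r" using s by (simp add: field_simps)
        then have "r \<ge> fa - s * B" by (simp add: B_def algebra_simps)
        moreover have "B * s \<le> B * (norm y + norm a)"
          using tri B by (intro mult_left_mono) (auto simp: s_def)
        moreover have "fa = m + B" by (simp add: B_def)
        ultimately show ?thesis using real B by (simp add: algebra_simps)
      qed (use y Gamma0_not_MInf[OF f] in auto)
    qed
  qed
  then show ?thesis using B by blast
qed

section \<open>Subgradients and the proximity operator\<close>

lemma subdifferential_finite:
  assumes f: "f \<in> Gamma0 S" and "x \<in> S" "u \<in> subdifferential S f x"
  shows "\<bar>f x\<bar> \<noteq> \<infinity>"
proof -
  obtain a where a: "a \<in> S" "\<bar>f a\<bar> \<noteq> \<infinity>"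
    using Gamma0_proper[OF f] by blast
  then have "ereal ((a - x) \<bullet> u) + f x \<le> f a"
    using assms by (auto simp: subdifferential_def)
  with a Gamma0_not_MInf[OF f \<open>x \<in> S\<close>] show ?thesis by (cases "f x"; cases "f a") auto
qed

lemma subdifferential_monotone:
  assumes f: "f \<in> Gamma0 S" and "x \<in> S" "y \<in> S"
    and u: "u \<in> subdifferential S f x" and v: "v \<in> subdifferential S f y"
  shows "(x - y) \<bullet> (u - v) \<ge> 0"
proof -
  obtain a b where ab: "f x = ereal a" "f y = ereal b"
    using subdifferential_finite[OF f] assms by (metis ereal_infinity_cases abs_ereal.simps(3) abs_ereal.elims)
  have "ereal ((y - x) \<bullet> u) + f x \<le> f y" "ereal ((x - y) \<bullet> v) + f y \<le> f x"
    using assms by (auto simp: subdifferential_def)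
  then have "(y - x) \<bullet> u + (x - y) \<bullet> v \<le> 0" by (simp add: ab)
  then show ?thesis by (simp add: algebra_simps)
qed

abbreviation moreau :: "('a::euclidean_space \<Rightarrow> ereal) \<Rightarrow> real \<Rightarrow> 'a \<Rightarrow> 'a \<Rightarrow> ereal" where
  "moreau f \<gamma> x y \<equiv> f y + ereal (1 / (2 * \<gamma>) * (norm (x - y))^2)"

text \<open>Fermat's rule. Comparing \<open>p\<close> with the point at parameter \<open>t\<close>
  on the segment from \<open>p\<close> to \<open>y\<close> and dividing by \<open>t\<close> leaves
  from the square a remainder of order \<open>t\<close>, which vanishes as \<open>t\<close>
  decreases to 0.\<close>

lemma minimizer_imp_subdifferential:
  fixes f :: "'a::euclidean_space \<Rightarrow> ereal"
  assumes f: "f \<in> Gamma0 S" and S: "subspace S" and \<gamma>: "0 < \<gamma>"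
    and x: "x \<in> S" and p: "p \<in> S"
    and min: "\<And>y. y \<in> S \<Longrightarrow> moreau f \<gamma> x p
                        \<le> moreau f \<gamma> x y"
  shows "(1 / \<gamma>) *\<^sub>R (x - p) \<in> subdifferential S f p"
proof -
  obtain a where a: "a \<in> S" "\<bar>f a\<bar> \<noteq> \<infinity>"
    using Gamma0_proper[OF f] by blast
  obtain fp where fp: "f p = ereal fp"
    using min[OF a(1)] a(2) Gamma0_not_MInf[OF f p] by (cases "f p"; cases "f a") auto
  have "ereal ((y - p) \<bullet> ((1 / \<gamma>) *\<^sub>R (x - p))) + f p \<le> f y" if y: "y \<in> S" for y
  proof (cases "f y")
    case (real fy)
    define d where "d = y - p"
    define e where "e = x - p"
    have *: "d \<bullet> e / \<gamma> + fp \<le> fy + t * ((norm d)^2 / (2 * \<gamma>))" if t: "0 < t" "t < 1" for t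
    proof -
      have "f p + ereal (1 / (2 * \<gamma>) * (norm e)^2)
        \<le> f ((1 - t) *\<^sub>R p + t *\<^sub>R y) + ereal (1 / (2 * \<gamma>) * (norm (e - t *\<^sub>R d))^2)"
      proof -
        have "x - ((1 - t) *\<^sub>R p + t *\<^sub>R y) = e - t *\<^sub>R d"
          by (simp add: d_def e_def algebra_simps)
        moreover have "(1 - t) *\<^sub>R p + t *\<^sub>R y \<in> S"
          using p y S by (simp add: subspace_add subspace_scale)
        ultimately show ?thesis
          using min[of "(1 - t) *\<^sub>R p + t *\<^sub>R y"] by (simp only: e_def)
      qed
      also have "\<dots> \<le> (ereal (1 - t) * f p + ereal t * f y) + ereal (1 / (2 * \<gamma>) * (norm (e - t *\<^sub>R d))^2)"
        by (intro add_right_mono Gamma0_convex[OF f p y] t)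
      finally have "fp + 1 / (2 * \<gamma>) * (norm e)^2
           \<le> (1 - t) * fp + t * fy + 1 / (2 * \<gamma>) * (norm (e - t *\<^sub>R d))^2"
        using fp real by simp
      also have "(norm (e - t *\<^sub>R d))^2 = (norm e)^2 - 2 * t * (d \<bullet> e) + t^2 * (norm d)^2"
        unfolding power2_norm_eq_inner by (simp add: algebra_simps power2_eq_square inner_commute)
      finally have "t * (fp + d \<bullet> e / \<gamma>) \<le> t * (fy + t * ((norm d)^2 / (2 * \<gamma>)))"
        using \<gamma> by (simp add: field_simps power2_eq_square)
      then show ?thesis using t by simp
    qed
    have "((\<lambda>t. fy + t * ((norm d)^2 / (2 * \<gamma>))) \<longlongrightarrow> fy + 0 * ((norm d)^2 / (2 * \<gamma>))) (at_right 0)"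
      by (intro tendsto_intros)
    moreover have "\<forall>\<^sub>F t in at_right (0::real). t \<in> {0<..<1}"
      by (rule eventually_at_right_real) simp
    then have "\<forall>\<^sub>F t in at_right 0. d \<bullet> e / \<gamma> + fp \<le> fy + t * ((norm d)^2 / (2 * \<gamma>))"
      by eventually_elim (use * in auto)
    ultimately have "d \<bullet> e / \<gamma> + fp \<le> fy + 0 * ((norm d)^2 / (2 * \<gamma>))"
      by (intro tendsto_lowerbound) auto
    then show ?thesis using real fp by (simp add: d_def e_def)
  qed (use y Gamma0_not_MInf[OF f] in auto)
  moreover have "(1 / \<gamma>) *\<^sub>R (x - p) \<in> S"
    using S x p by (simp add: subspace_diff subspace_scale)
  ultimately show ?thesis by (auto simp: subdifferential_def)
qed

lemma exists_prox_point:
  fixes f :: "'a::euclidean_space \<Rightarrow> ereal"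
  assumes f: "f \<in> Gamma0 S" and S: "subspace S" and \<gamma>: "0 < \<gamma>" and x: "x \<in> S"
  shows "\<exists>p\<in>S. \<forall>y\<in>S. moreau f \<gamma> x p
                    \<le> moreau f \<gamma> x y"
proof -
  let ?q = "\<lambda>y. 1 / (2 * \<gamma>) * (norm (x - y))^2"
  obtain A B where AB: "\<And>y. y \<in> S \<Longrightarrow> ereal (A - B * norm y) \<le> f y" "B \<ge> 0"
    using Gamma0_linear_lower_bound[OF f S] x by blast
  obtain a where a: "a \<in> S" "\<bar>f a\<bar> \<noteq> \<infinity>"
    using Gamma0_proper[OF f] by blast
  then obtain fa where fa: "f a = ereal fa" by auto
  define T where "T = \<bar>fa + ?q a - (A - B * norm x)\<bar>"
  \<comment> \<open>Beyond this radius the square \<open>s^2 / (2 * \<gamma>)\<close> exceeds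
    \<open>(B + T) * s\<close>. The part \<open>B * s\<close> pays for the decrease of the linear
    minorant away from \<open>x\<close>, and \<open>T * s\<close> \<ge> \<open>T\<close> pays for
    the gap between the objective at \<open>a\<close> and the minorant at \<open>x\<close>. The
    summand \<open>norm (x - a)\<close> keeps \<open>a\<close> inside the ball, and the final 1
    ensures \<open>s\<close> > 1.\<close>
  define R where "R = norm (x - a) + 2 * \<gamma> * (B + T) + 1"
  have TB: "T \<ge> 0" "B + T \<ge> 0" using AB by (auto simp: T_def)
  have far: "f a + ereal (?q a) \<le> f y + ereal (?q y)" if y: "y \<in> S" and d: "norm (x - y) > R" for y
  proof -
    define s where "s = norm (x - y)"
    have s: "s > 1" "s > 2 * \<gamma> * (B + T)"
      using d TB \<gamma> by (auto simp: R_def s_def) (smt (verit, best) mult_nonneg_nonneg norm_ge_zero)+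
    have "norm y \<le> norm x + s"
      using norm_triangle_ineq4[of x "x - y"] by (simp add: s_def)
    then have "B * norm y \<le> B * norm x + B * s"
      using AB(2) by (metis distrib_left mult_left_mono)
    moreover have "(B + T) * s \<le> 1 / (2 * \<gamma>) * s^2"
    proof -
      have "2 * \<gamma> * (B + T) * s \<le> s * s" using s by (intro mult_right_mono) auto
      then show ?thesis using \<gamma> by (simp add: field_simps power2_eq_square)
    qed
    moreover have "T \<le> T * s" using s TB(1) by (simp add: mult_le_cancel_left1)
    ultimately have "fa + ?q a \<le> A - B * norm y + ?q y"
      unfolding s_def[symmetric] by (auto simp: T_def algebra_simps)
    then have "ereal (fa + ?q a) \<le> ereal (A - B * norm y) + ereal (?q y)" by simp
    also have "\<dots> \<le> f y + ereal (?q y)" by (intro add_right_mono AB y)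
    finally show ?thesis using fa by simp
  qed
  let ?K = "S \<inter> cball x R"
  have aK: "a \<in> ?K"
    using a TB \<gamma> by (auto simp: R_def dist_norm)
  have "compact ?K"
    by (intro closed_Int_compact closed_subspace S compact_cball)
  moreover have "continuous_on UNIV ?q" using \<gamma> by (intro continuous_intros) auto
  ultimately have "\<exists>p\<in>?K. \<forall>y\<in>?K. f p + ereal (?q p) \<le> f y + ereal (?q y)"
    using aK by (intro Gamma0_attains_inf[OF f]) auto
  then obtain p where p: "p \<in> ?K" "\<And>y. y \<in> ?K \<Longrightarrow> f p + ereal (?q p) \<le> f y + ereal (?q y)"
    by blast
  have "f p + ereal (?q p) \<le> f y + ereal (?q y)" if "y \<in> S" for y
  proof (cases "norm (x - y) > R")
    case True
    then show ?thesis using far[OF that True] p(2)[OF aK] by (meson order_trans)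
  next
    case False
    then show ?thesis using p(2)[of y] that by (auto simp: dist_norm)
  qed
  then show ?thesis using p(1) by auto
qed

text \<open>\<open>prox\<close> is a Hilbert choice among minimisers, so existence has to come
  first. From here on \<open>prox\<close> is known only through these two facts.\<close>

lemma
  fixes f :: "'a::euclidean_space \<Rightarrow> ereal"
  assumes f: "f \<in> Gamma0 S" and S: "subspace S" and \<gamma>: "0 < \<gamma>" and x: "x \<in> S"
  shows prox_in_space: "prox S \<gamma> f x \<in> S"
    and prox_subdifferential: "(1 / \<gamma>) *\<^sub>R (x - prox S \<gamma> f x) \<in> subdifferential S f (prox S \<gamma> f x)"
proof -
  let ?F = "\<lambda>y. moreau f \<gamma> x y"
  have "is_arg_min ?F (\<lambda>y. y \<in> S) (prox S \<gamma> f x)"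
    unfolding prox_def arg_min_on_def arg_min_def
  proof (rule someI_ex)
    show "\<exists>p. is_arg_min ?F (\<lambda>y. y \<in> S) p"
      using exists_prox_point[OF assms] unfolding is_arg_min_linorder by blast
  qed
  then show p: "prox S \<gamma> f x \<in> S"
    and "(1 / \<gamma>) *\<^sub>R (x - prox S \<gamma> f x) \<in> subdifferential S f (prox S \<gamma> f x)"
    using minimizer_imp_subdifferential[OF f S \<gamma> x] by (auto simp: is_arg_min_linorder)
qed

text \<open>Stated for any solutions of the two inclusions instead of values of \<open>prox\<close>:
  with \<open>x = x'\<close> it also yields uniqueness, which is how \<open>prox_eqI\<close> uses
  it.\<close>

lemma prox_firmly_nonexpansive_subdifferential:
  fixes f :: "'a::euclidean_space \<Rightarrow> ereal"
  assumes f: "f \<in> Gamma0 S" and \<gamma>: "0 < \<gamma>" and "p \<in> S" "p' \<in> S"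
    and "(1 / \<gamma>) *\<^sub>R (x - p) \<in> subdifferential S f p"
    and "(1 / \<gamma>) *\<^sub>R (x' - p') \<in> subdifferential S f p'"
  shows "(norm (p - p'))^2 \<le> (p - p') \<bullet> (x - x')"
proof -
  have "(p - p') \<bullet> ((1 / \<gamma>) *\<^sub>R (x - p) - (1 / \<gamma>) *\<^sub>R (x' - p')) \<ge> 0"
    using assms by (intro subdifferential_monotone[OF f]) auto
  also have "(1 / \<gamma>) *\<^sub>R (x - p) - (1 / \<gamma>) *\<^sub>R (x' - p') = (1 / \<gamma>) *\<^sub>R ((x - x') - (p - p'))"
    by (simp add: algebra_simps)
  finally have "(p - p') \<bullet> ((x - x') - (p - p')) \<ge> 0"
    using \<gamma> by (simp add: zero_le_mult_iff zero_le_divide_iff)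
  then show ?thesis by (simp add: inner_diff_right power2_norm_eq_inner)
qed

lemma prox_eqI:
  fixes f :: "'a::euclidean_space \<Rightarrow> ereal"
  assumes f: "f \<in> Gamma0 S" and S: "subspace S" and \<gamma>: "0 < \<gamma>" and x: "x \<in> S" and p: "p \<in> S"
    and sub: "(1 / \<gamma>) *\<^sub>R (x - p) \<in> subdifferential S f p"
  shows "prox S \<gamma> f x = p"
  using prox_firmly_nonexpansive_subdifferential[OF f \<gamma> prox_in_space[OF f S \<gamma> x] p prox_subdifferential[OF f S \<gamma> x] sub]
  by simp

lemma prox_nonexpansive:
  fixes f :: "'a::euclidean_space \<Rightarrow> ereal"
  assumes f: "f \<in> Gamma0 S" and S: "subspace S" and \<gamma>: "0 < \<gamma>" and x: "x \<in> S" "y \<in> S"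
  shows "norm (prox S \<gamma> f x - prox S \<gamma> f y) \<le> norm (x - y)"
proof -
  let ?d = "prox S \<gamma> f x - prox S \<gamma> f y"
  have "(norm ?d)^2 \<le> ?d \<bullet> (x - y)"
    using prox_in_space[OF f S \<gamma>] prox_subdifferential[OF f S \<gamma>] x
    by (intro prox_firmly_nonexpansive_subdifferential[OF f \<gamma>]) auto
  also have "\<dots> \<le> norm ?d * norm (x - y)"
    by (rule norm_cauchy_schwarz)
  finally have "norm ?d * norm ?d \<le> norm ?d * norm (x - y)" by (simp add: power2_eq_square)
  then show ?thesis by (cases "norm ?d = 0") auto
qed

lemma continuous_on_prox:
  fixes f :: "'a::euclidean_space \<Rightarrow> ereal"
  assumes "f \<in> Gamma0 S" "subspace S" "0 < \<gamma>"
  shows "continuous_on S (prox S \<gamma> f)"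
proof (rule lipschitz_on_continuous_on[of 1])
  show "1-lipschitz_on S (prox S \<gamma> f)"
    using prox_nonexpansive[OF assms] by (auto simp: lipschitz_on_def dist_norm)
qed

section \<open>Fenchel conjugates and their subgradients\<close>

lemma Fenchel_Young:
  assumes "x \<in> S"
  shows "ereal (x \<bullet> u) - f x \<le> fenchel_conjugate S f u"
  using assms by (auto simp: fenchel_conjugate_def intro: SUP_upper)

lemma fenchel_conjugate_subgradient:
  assumes x: "x \<in> S" and u: "u \<in> subdifferential S f x" and fin: "\<bar>f x\<bar> \<noteq> \<infinity>"
  shows "fenchel_conjugate S f u = ereal (x \<bullet> u) - f x"
proof (rule antisym)
  show "fenchel_conjugate S f u \<le> ereal (x \<bullet> u) - f x"
    unfolding fenchel_conjugate_def
  proof (rule SUP_least)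
    fix y assume "y \<in> S"
    then have "ereal ((y - x) \<bullet> u) + f x \<le> f y" using u by (auto simp: subdifferential_def)
    then show "ereal (y \<bullet> u) - f y \<le> ereal (x \<bullet> u) - f x"
      using fin by (cases "f x"; cases "f y") (auto simp: algebra_simps)
  qed
qed (rule Fenchel_Young[OF x])

text \<open>As a supremum of affine functions the conjugate is convex and lower semicontinuous. Its
  properness is read off from the subgradient \<open>w\<close>, at which the conjugate has the
  finite value \<open>a \<bullet> w - f a\<close>; in the application this subgradient comes from
  the assumed inclusion.\<close>

lemma fenchel_conjugate_Gamma0:
  assumes f: "f \<in> Gamma0 S" and a: "a \<in> S" "w \<in> subdifferential S f a"
  shows "fenchel_conjugate S f \<in> Gamma0 S"
proof -
  let ?c = "fenchel_conjugate S f"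
  have fa: "\<bar>f a\<bar> \<noteq> \<infinity>" using subdifferential_finite[OF f a] .
  have "?c u \<noteq> -\<infinity>" for u
    using Fenchel_Young[OF a(1), of u f] fa by (cases "f a") auto
  moreover have "?c w \<noteq> \<infinity>" "w \<in> S"
    using fenchel_conjugate_subgradient[OF a fa] fa a(2) by (auto simp: subdifferential_def)
  moreover have "?c u \<le> Liminf (at u within S) ?c" for u
    unfolding le_Liminf_iff
  proof safe
    fix c assume "c < ?c u"
    then obtain x where x: "x \<in> S" "c < ereal (x \<bullet> u) - f x"
      by (auto simp: fenchel_conjugate_def less_SUP_iff)
    have "((\<lambda>u. ereal (x \<bullet> u) - f x) \<longlongrightarrow> ereal (x \<bullet> u) - f x) (at u within S)"
    proof (cases "f x")
      case (real r)
      have "((\<lambda>u. ereal (x \<bullet> u - r)) \<longlongrightarrow> ereal (x \<bullet> u - r)) (at u within S)"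
        by (intro tendsto_intros)
      then show ?thesis by (simp add: real)
    qed auto
    then have "\<forall>\<^sub>F u in at u within S. c < ereal (x \<bullet> u) - f x"
      using x(2) by (rule order_tendstoD)
    then show "\<forall>\<^sub>F u in at u within S. c < ?c u"
      by eventually_elim (use Fenchel_Young[OF x(1)] less_le_trans in blast)
  qed
  moreover have "?c ((1 - t) *\<^sub>R u + t *\<^sub>R v) \<le> ereal (1 - t) * ?c u + ereal t * ?c v"
    if t: "0 < t" "t < 1" for u v t
    unfolding fenchel_conjugate_def[of S f "(1 - t) *\<^sub>R u + t *\<^sub>R v"]
  proof (rule SUP_least)
    fix x assume x: "x \<in> S"
    have "ereal (x \<bullet> ((1 - t) *\<^sub>R u + t *\<^sub>R v)) - f x
        = ereal (1 - t) * (ereal (x \<bullet> u) - f x) + ereal t * (ereal (x \<bullet> v) - f x)"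
      using Gamma0_not_MInf[OF f x] t by (cases "f x") (auto simp: algebra_simps)
    also have "\<dots> \<le> ereal (1 - t) * ?c u + ereal t * ?c v"
      using t by (intro add_mono ereal_mult_left_mono Fenchel_Young x) auto
    finally show "ereal (x \<bullet> ((1 - t) *\<^sub>R u + t *\<^sub>R v)) - f x \<le> ereal (1 - t) * ?c u + ereal t * ?c v" .
  qed
  ultimately show ?thesis by (auto simp: Gamma0_def)
qed

text \<open>Equality in Fenchel-Young at \<open>u\<close>, minus the inequality at \<open>w\<close>,
  is the subgradient inequality of the conjugate.\<close>

lemma subdifferential_conjugate:
  assumes f: "f \<in> Gamma0 S" and x: "x \<in> S" and u: "u \<in> subdifferential S f x"
  shows "x \<in> subdifferential S (fenchel_conjugate S f) u"
proof -
  have fx: "\<bar>f x\<bar> \<noteq> \<infinity>" using subdifferential_finite[OF f x u] .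
  have "ereal ((w - u) \<bullet> x) + fenchel_conjugate S f u \<le> fenchel_conjugate S f w" for w
    using Fenchel_Young[OF x, of w f] fenchel_conjugate_subgradient[OF x u fx] fx
    by (cases "f x") (auto simp: algebra_simps inner_commute)
  then show ?thesis using x by (simp add: subdifferential_def)
qed

text \<open>This replaces the Fenchel--Moreau theorem: with \<open>p = prox f (x + u)\<close>, both \<open>x\<close> and \<open>p\<close>
  solve the same strictly monotone inclusion for the conjugate, so \<open>p = x\<close>.\<close>

lemma subdifferential_of_conjugate:
  assumes f: "f \<in> Gamma0 S" and S: "subspace S" and c: "fenchel_conjugate S f \<in> Gamma0 S"
    and u: "u \<in> S" and x: "x \<in> subdifferential S (fenchel_conjugate S f) u"
  shows "u \<in> subdifferential S f x"
proof -
  have xS: "x \<in> S" using x by (simp add: subdifferential_def)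
  have sS: "x + u \<in> S" using S xS u by (simp add: subspace_add)
  define p where "p = prox S 1 f (x + u)"
  have p: "p \<in> S" "x + u - p \<in> subdifferential S f p"
    using prox_in_space[OF f S _ sS, of 1] prox_subdifferential[OF f S _ sS, of 1] by (auto simp: p_def)
  have "p \<in> subdifferential S (fenchel_conjugate S f) (x + u - p)"
    by (rule subdifferential_conjugate[OF f p])
  then have "(u - (x + u - p)) \<bullet> (x - p) \<ge> 0"
    using sS p S u x by (intro subdifferential_monotone[OF c]) (auto intro: subspace_diff)
  moreover have "(u - (x + u - p)) \<bullet> (x - p) = - ((x - p) \<bullet> (x - p))"
    by (simp add: algebra_simps)
  ultimately have "x = p"
    by (metis eq_iff_diff_eq_0 inner_eq_zero_iff inner_ge_zero neg_0_le_iff_le order_antisym)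
  then show ?thesis using p(2) by simp
qed

section \<open>Convex functions with a Lipschitz gradient\<close>

lemma GDERIV_along_line:
  assumes "\<And>z. GDERIV h z :> grad_h z"
  shows "((\<lambda>t. h (x + t *\<^sub>R d)) has_field_derivative grad_h (x + t *\<^sub>R d) \<bullet> d) (at t within A)"
proof -
  have "((\<lambda>t. x + t *\<^sub>R d) has_derivative (\<lambda>s. s *\<^sub>R d)) (at t within A)"
    by (auto intro!: derivative_eq_intros)
  then have "((\<lambda>t. h (x + t *\<^sub>R d)) has_derivative (\<lambda>s. (s *\<^sub>R d) \<bullet> grad_h (x + t *\<^sub>R d))) (at t within A)"
    using assms[unfolded gderiv_def] by (rule has_derivative_compose)
  then show ?thesis
    by (simp add: has_field_derivative_def inner_commute mult_commute_abs)
qed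

lemma convex_gradient_inequality:
  fixes h :: "'a::euclidean_space \<Rightarrow> real"
  assumes "convex_on UNIV h" and grad: "\<And>z. GDERIV h z :> grad_h z"
  shows "h x + grad_h x \<bullet> (y - x) \<le> h y"
proof -
  let ?\<phi> = "\<lambda>t. h (x + t *\<^sub>R (y - x))"
  have "convex_on UNIV ?\<phi>"
  proof (rule convex_onI)
    fix t s r :: real assume t: "0 < t" "t < 1"
    have "x + ((1 - t) *\<^sub>R s + t *\<^sub>R r) *\<^sub>R (y - x)
        = (1 - t) *\<^sub>R (x + s *\<^sub>R (y - x)) + t *\<^sub>R (x + r *\<^sub>R (y - x))"
      by (simp add: algebra_simps)
    then have "h (x + ((1 - t) *\<^sub>R s + t *\<^sub>R r) *\<^sub>R (y - x))
        \<le> (1 - t) * h (x + s *\<^sub>R (y - x)) + t * h (x + r *\<^sub>R (y - x))"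
      using convex_onD[OF assms(1), of t "x + s *\<^sub>R (y - x)" "x + r *\<^sub>R (y - x)"] t by (simp only:) auto
    then show "h (x + ((1 - t) *\<^sub>R s + t *\<^sub>R r) *\<^sub>R (y - x))
        \<le> (1 - t) * h (x + s *\<^sub>R (y - x)) + t * h (x + r *\<^sub>R (y - x))" .
  qed auto
  then have "?\<phi> 1 - ?\<phi> 0 \<ge> (grad_h (x + 0 *\<^sub>R (y - x)) \<bullet> (y - x)) * (1 - 0)"
    by (intro convex_on_imp_above_tangent[where A = UNIV] GDERIV_along_line grad) auto
  then show ?thesis by simp
qed

text \<open>No integration is involved: \<open>?\<psi>\<close> is \<open>h\<close> along the segment
  minus its quadratic upper model, and the Lipschitz bound makes its derivative nonpositive.\<close>

lemma descent_lemma: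
  fixes h :: "'a::euclidean_space \<Rightarrow> real"
  assumes grad: "\<And>z. GDERIV h z :> grad_h z" and lip: "K-lipschitz_on UNIV grad_h"
  shows "h (x + d) \<le> h x + grad_h x \<bullet> d + K / 2 * (norm d)^2"
proof -
  let ?\<psi> = "\<lambda>t. h (x + t *\<^sub>R d) - t * (grad_h x \<bullet> d) - t^2 * (K / 2 * (norm d)^2)"
  have "?\<psi> 1 \<le> ?\<psi> 0"
  proof (rule DERIV_nonpos_imp_nonincreasing[where f = ?\<psi> and a = 0 and b = 1])
    fix t :: real assume t: "0 \<le> t" "t \<le> 1"
    let ?D = "grad_h (x + t *\<^sub>R d) \<bullet> d - grad_h x \<bullet> d - t * K * (norm d)^2"
    have "(?\<psi> has_field_derivative ?D) (at t)"
      using DERIV_diff[OF DERIV_diff[OF GDERIV_along_line[OF grad, of x d t UNIV]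
            DERIV_cmult_right[OF DERIV_ident, of "grad_h x \<bullet> d"]]
          DERIV_cmult_right[OF DERIV_power[OF DERIV_ident, of 2], of "K / 2 * (norm d)^2"]]
      by (simp add: algebra_simps)
    moreover have "grad_h (x + t *\<^sub>R d) \<bullet> d - grad_h x \<bullet> d \<le> t * K * (norm d)^2"
    proof -
      have "(grad_h (x + t *\<^sub>R d) - grad_h x) \<bullet> d \<le> norm (grad_h (x + t *\<^sub>R d) - grad_h x) * norm d"
        by (rule norm_cauchy_schwarz)
      also have "\<dots> \<le> (K * norm (t *\<^sub>R d)) * norm d"
        using lipschitz_onD[OF lip, of "x + t *\<^sub>R d" x] by (intro mult_right_mono) (auto simp: dist_norm)
      finally show ?thesis using t by (simp add: inner_diff_left power2_eq_square mult_ac)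
    qed
    ultimately show "\<exists>y. ((\<lambda>t. h (x + t *\<^sub>R d) - t * (grad_h x \<bullet> d) - t^2 * (K / 2 * (norm d)^2))
        has_real_derivative y) (at t) \<and> y \<le> 0"
      by (intro exI[of _ ?D]) auto
  qed simp
  then show ?thesis by simp
qed

theorem Baillon_Haddad:
  fixes h :: "'a::euclidean_space \<Rightarrow> real"
  assumes h: "convex_on UNIV h" and grad: "\<And>z. GDERIV h z :> grad_h z"
    and \<mu>: "0 < \<mu>" and lip: "(1 / \<mu>)-lipschitz_on UNIV grad_h"
  shows "\<mu> * (norm (grad_h x - grad_h y))^2 \<le> (x - y) \<bullet> (grad_h x - grad_h y)"
proof -
  have *: "h x + grad_h x \<bullet> (y - x) + \<mu> / 2 * (norm (grad_h y - grad_h x))^2 \<le> h y" for x y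
  proof -
    define d where "d = grad_h y - grad_h x"
    \<comment> \<open>The point \<open>y - \<mu> d\<close> is one gradient step of length \<mu> from
      \<open>y\<close> for the function \<open>h\<close> minus its linear part at \<open>x\<close>,
      which is minimised at \<open>x\<close>. Bounding \<open>h\<close> there from below by the
      tangent at \<open>x\<close> and from above by the descent lemma at \<open>y\<close> gives the
      claim; adding it to its copy with \<open>x\<close> and \<open>y\<close> exchanged cancels the
      values of \<open>h\<close>.\<close>
    have "h x + grad_h x \<bullet> ((y + (- \<mu>) *\<^sub>R d) - x) \<le> h (y + (- \<mu>) *\<^sub>R d)"
      by (rule convex_gradient_inequality[OF h grad])
    also have "\<dots> \<le> h y + grad_h y \<bullet> ((- \<mu>) *\<^sub>R d) + (1 / \<mu>) / 2 * (norm ((- \<mu>) *\<^sub>R d))^2"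
      by (rule descent_lemma[OF grad lip])
    also have "(1 / \<mu>) / 2 * (norm ((- \<mu>) *\<^sub>R d))^2 = \<mu> / 2 * (norm d)^2"
      using \<mu> by (simp add: power_mult_distrib field_simps power2_eq_square)
    finally have "h x + grad_h x \<bullet> (y - x) + \<mu> * ((grad_h y - grad_h x) \<bullet> d) \<le> h y + \<mu> / 2 * (norm d)^2"
      by (simp add: algebra_simps)
    then show ?thesis by (simp add: d_def[symmetric] power2_norm_eq_inner)
  qed
  show ?thesis
    using *[of x y] *[of y x] by (simp add: algebra_simps inner_commute norm_minus_commute[of "grad_h x" "grad_h y"])
qed

section \<open>Almost supermartingales\<close>

text \<open>Doob's trading rule: buy below \<open>a\<close>, sell above \<open>b\<close>.
  \<open>holding a b y n\<close> says whether the asset is held from time \<open>n\<close> to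
  \<open>n + 1\<close>; it depends on values up to time \<open>n\<close> only, so it is an
  admissible integrand.\<close>

primrec holding :: "real \<Rightarrow> real \<Rightarrow> (nat \<Rightarrow> real) \<Rightarrow> nat \<Rightarrow> bool" where
  "holding a b y 0 \<longleftrightarrow> y 0 < a"
| "holding a b y (Suc n) \<longleftrightarrow> (if holding a b y n then y (Suc n) \<le> b else y (Suc n) < a)"

text \<open>Every sale realises more than \<open>b - a\<close>. The second summand values a position
  still open: bought below \<open>a\<close>, it is worth at least \<open>y n - a\<close>. Without it
  the induction would not go through.\<close>

lemma upcrossing_gain:
  assumes "a \<le> b"
  shows "(b - a) * (\<Sum>i<n. of_bool (holding a b y i \<and> \<not> holding a b y (Suc i)))
           + (if holding a b y n then y n - a else 0)
         \<le> (\<Sum>i<n. of_bool (holding a b y i) * (y (Suc i) - y i))"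
proof (induction n)
  case (Suc n)
  then show ?case by (cases "holding a b y n") (auto simp: algebra_simps)
qed auto

text \<open>If sales stop, the rule eventually holds forever, which forces values at most
  \<open>b\<close>, or never buys again, which forces values at least \<open>a\<close>.\<close>

lemma eventually_outside_interval:
  assumes "\<forall>\<^sub>F n in sequentially. \<not> (holding a b y n \<and> \<not> holding a b y (Suc n))"
  shows "(\<forall>\<^sub>F n in sequentially. y n \<le> b) \<or> (\<forall>\<^sub>F n in sequentially. a \<le> y n)"
proof -
  obtain N where N: "\<And>n. n \<ge> N \<Longrightarrow> holding a b y n \<Longrightarrow> holding a b y (Suc n)"
    using assms by (auto simp: eventually_sequentially)
  show ?thesis
  proof (cases "\<exists>m\<ge>N. holding a b y m")
    case True
    then obtain m where m: "m \<ge> N" "holding a b y m" by blast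
    have hold: "holding a b y n" if "n \<ge> m" for n
      using that by (induction n rule: dec_induct) (use m N in auto)
    have "y n \<le> b" if n: "n \<ge> Suc m" for n
    proof -
      obtain k where k: "n = Suc k" "k \<ge> m" using Suc_le_D[OF n] n by auto
      show ?thesis using hold[of k] hold[of n] k by auto
    qed
    then show ?thesis by (auto simp: eventually_sequentially)
  next
    case False
    have "a \<le> y n" if n: "n \<ge> Suc N" for n
    proof -
      obtain k where k: "n = Suc k" "k \<ge> N" using Suc_le_D[OF n] n by auto
      have "\<not> holding a b y k" "\<not> holding a b y n" using False n k(2) by (auto dest: Suc_leD)
      then show ?thesis using k by auto
    qed
    then show ?thesis by (auto simp: eventually_sequentially)
  qed
qed

text \<open>A gap between lower and upper limit would contain two rationals crossed infinitely
  often. Finiteness of the lower limit is asked in \<open>ennreal\<close>, the form in which Fatou's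
  lemma delivers it.\<close>

lemma convergent_of_no_crossings:
  fixes y :: "nat \<Rightarrow> real"
  assumes nonneg: "\<And>n. 0 \<le> y n"
    and cross: "\<And>a b. a \<in> \<rat> \<Longrightarrow> b \<in> \<rat> \<Longrightarrow> a < b \<Longrightarrow>
       (\<forall>\<^sub>F n in sequentially. y n \<le> b) \<or> (\<forall>\<^sub>F n in sequentially. a \<le> y n)"
    and fin: "liminf (\<lambda>n. ennreal (y n)) \<noteq> \<infinity>"
  shows "convergent y"
proof -
  let ?l = "liminf (\<lambda>n. ereal (y n))" and ?u = "limsup (\<lambda>n. ereal (y n))"
  have "?u \<le> ?l"
  proof (rule ccontr)
    assume "\<not> ?u \<le> ?l"
    then obtain r where r: "?l < ereal r" "ereal r < ?u"
      using ereal_dense2 by (metis not_le)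
    then obtain s where s: "ereal r < ereal s" "ereal s < ?u"
      using ereal_dense2 by blast
    obtain a where a: "a \<in> \<rat>" "r < a" "a < s" using s Rats_dense_in_real by auto
    obtain b where b: "b \<in> \<rat>" "a < b" "b < s" using a Rats_dense_in_real by auto
    from cross[OF a(1) b(1,2)] show False
    proof
      assume "\<forall>\<^sub>F n in sequentially. y n \<le> b"
      then have "?u \<le> ereal b" by (intro Limsup_bounded) auto
      with b s show False by (metis ereal_less(2) less_ereal.simps(1) not_le order_less_trans)
    next
      assume "\<forall>\<^sub>F n in sequentially. a \<le> y n"
      then have "ereal a \<le> ?l" by (intro Liminf_bounded) auto
      with a r show False by (metis less_ereal.simps(1) not_le order_less_trans)
    qed
  qed
  then have eq: "?u = ?l" by (intro order_antisym Liminf_le_Limsup) auto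
  then have lim: "(\<lambda>n. ereal (y n)) \<longlonglongrightarrow> ?l"
    by (simp add: tendsto_iff_Liminf_eq_Limsup)
  have "0 \<le> ?l" using nonneg by (intro Liminf_bounded) auto
  moreover have "?l \<noteq> \<infinity>"
  proof
    assume "?l = \<infinity>"
    with lim have "(\<lambda>n. ereal (y n)) \<longlonglongrightarrow> \<infinity>" by simp
    then have "(\<lambda>n. e2ennreal (ereal (y n))) \<longlonglongrightarrow> e2ennreal \<infinity>"
      by (rule tendsto_e2ennrealI)
    then have "(\<lambda>n. ennreal (y n)) \<longlonglongrightarrow> \<infinity>"
      by (simp add: e2ennreal_ereal e2ennreal_infty)
    then have "liminf (\<lambda>n. ennreal (y n)) = \<infinity>"
      by (intro lim_imp_Liminf) auto
    with fin show False by simp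
  qed
  ultimately obtain c where "?l = ereal c" by (cases ?l) auto
  with lim have "y \<longlonglongrightarrow> c" by simp
  then show ?thesis by (rule convergentI)
qed

section \<open>Nonnegative supermartingales on a filtered probability space\<close>

locale filtered_prob_space = prob_space M for M :: "'w measure" +
  fixes F :: "nat \<Rightarrow> 'w measure"
  assumes subalg: "\<And>n. subalgebra M (F n)"
    and filtration: "\<And>n. sets (F n) \<subseteq> sets (F (Suc n))"
begin

lemma sigma_finite_subalg: "sigma_finite_subalgebra M (F n)"
proof (rule finite_measure_subalgebra_is_sigma_finite)
  show "finite_measure_subalgebra M (F n)"
    by unfold_locales (rule subalg)
qed

abbreviation CE :: "nat \<Rightarrow> ('w \<Rightarrow> real) \<Rightarrow> 'w \<Rightarrow> real" where
  "CE n \<equiv> real_cond_exp M (F n)"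

abbreviation CE2 :: "nat \<Rightarrow> ('w \<Rightarrow> 'b::euclidean_space) \<Rightarrow> 'w \<Rightarrow> real" where
  "CE2 n X \<equiv> CE n (\<lambda>w. (norm (X w))^2)"

lemma space_F [simp]: "space (F n) = space M"
  using subalg by (simp add: subalgebra_def)

lemma sets_F_mono: "m \<le> n \<Longrightarrow> sets (F m) \<subseteq> sets (F n)"
  by (rule lift_Suc_mono_le[of "\<lambda>n. sets (F n)"]) (rule filtration)

lemma measurable_F_mono: "m \<le> n \<Longrightarrow> f \<in> measurable (F m) N \<Longrightarrow> f \<in> measurable (F n) N"
  by (rule measurable_from_subalg) (auto simp: subalgebra_def sets_F_mono)

lemma measurable_F_M: "f \<in> measurable (F m) N \<Longrightarrow> f \<in> measurable M N"
  by (rule measurable_from_subalg[OF subalg])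

lemma pred_holding:
  assumes "\<And>n. Y n \<in> borel_measurable (F n)"
  shows "Measurable.pred (F n) (\<lambda>w. holding a b (\<lambda>m. Y m w) n)"
proof (induction n)
  case 0
  have [measurable]: "Y 0 \<in> borel_measurable (F 0)" by (rule assms)
  show ?case by simp
next
  case (Suc n)
  have [measurable]: "Y (Suc n) \<in> borel_measurable (F (Suc n))" by (rule assms)
  have [measurable]: "Measurable.pred (F (Suc n)) (\<lambda>w. holding a b (\<lambda>m. Y m w) n)"
    by (rule measurable_F_mono[OF _ Suc]) simp
  show ?case by simp
qed

context
  fixes Y :: "nat \<Rightarrow> 'w \<Rightarrow> real"
  assumes meas: "\<And>n. Y n \<in> borel_measurable (F n)"
    and nonneg: "\<And>n w. w \<in> space M \<Longrightarrow> 0 \<le> Y n w"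
    and int: "\<And>n. integrable M (Y n)"
    and super: "\<And>n. AE w in M. CE n (Y (Suc n)) w \<le> Y n w"
begin

text \<open>The decision \<open>P\<close> is known at time \<open>n\<close>, so it can be moved
  inside the conditional expectation. With \<open>P\<close> constantly true this says that the means
  decrease.\<close>

lemma supermartingale_transform_nonpos:
  assumes P: "Measurable.pred (F n) P"
  shows "integrable M (\<lambda>w. of_bool (P w) * (Y (Suc n) w - Y n w))"
    and "(\<integral>w. of_bool (P w) * (Y (Suc n) w - Y n w) \<partial>M) \<le> 0"
proof -
  interpret F: sigma_finite_subalgebra M "F n" by (rule sigma_finite_subalg)
  have [measurable]: "Measurable.pred M P" by (rule measurable_F_M[OF P])
  have PF: "(\<lambda>w. of_bool (P w) :: real) \<in> borel_measurable (F n)" using P by measurable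
  have b: "integrable M (\<lambda>w. of_bool (P w) * g w)" if "integrable M g" for g :: "'w \<Rightarrow> real"
    using that by (rule Bochner_Integration.integrable_bound) (use that in auto)
  have i: "integrable M (\<lambda>w. of_bool (P w) * Y (Suc n) w)" "integrable M (\<lambda>w. of_bool (P w) * Y n w)"
    using int by (auto intro: b)
  show "integrable M (\<lambda>w. of_bool (P w) * (Y (Suc n) w - Y n w))"
    using int by (auto intro!: b)
  have "(\<integral>w. of_bool (P w) * Y (Suc n) w \<partial>M) = (\<integral>w. of_bool (P w) * CE n (Y (Suc n)) w \<partial>M)"
    using F.real_cond_exp_intg(2)[OF i(1) PF] int by simp
  also have "\<dots> \<le> (\<integral>w. of_bool (P w) * Y n w \<partial>M)"
  proof (intro integral_mono_AE)
    show "AE w in M. of_bool (P w) * CE n (Y (Suc n)) w \<le> of_bool (P w) * Y n w"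
      using super[of n] by eventually_elim (auto intro: mult_left_mono)
  qed (use F.real_cond_exp_intg(1)[OF i(1) PF] int i in auto)
  finally show "(\<integral>w. of_bool (P w) * (Y (Suc n) w - Y n w) \<partial>M) \<le> 0"
    using i by (simp add: right_diff_distrib)
qed

text \<open>\<open>A n\<close> is the event of a sale at time \<open>n + 1\<close>. The expected
  gain is nonpositive and an open position of a nonnegative process loses at most
  \<open>\<bar>a\<bar>\<close>, so the expected number of sales is at most
  \<open>\<bar>a\<bar> / (b - a)\<close>, and Borel-Cantelli applies.\<close>

lemma finitely_many_upcrossings:
  assumes ab: "a < b"
  shows "AE w in M. \<forall>\<^sub>F n in sequentially.
    \<not> (holding a b (\<lambda>m. Y m w) n \<and> \<not> holding a b (\<lambda>m. Y m w) (Suc n))"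
proof -
  let ?H = "\<lambda>n w. holding a b (\<lambda>m. Y m w) n"
  have [measurable]: "Measurable.pred M (?H n)" for n
    by (rule measurable_F_M[OF pred_holding[OF meas]])
  define A where "A n = {w\<in>space M. ?H n w \<and> \<not> ?H (Suc n) w}" for n
  have A[measurable]: "A n \<in> sets M" for n
    unfolding A_def by measurable
  have tr: "integrable M (\<lambda>w. of_bool (?H i w) * (Y (Suc i) w - Y i w))"
     "(\<integral>w. of_bool (?H i w) * (Y (Suc i) w - Y i w) \<partial>M) \<le> 0" for i
    using supermartingale_transform_nonpos[OF pred_holding[OF meas]] by auto
  have "(\<Sum>i<n. measure M (A i)) \<le> \<bar>a\<bar> / (b - a)" for n
  proof -
    have iA: "integrable M (\<lambda>w. indicat_real (A i) w)" for i
      by (rule integrable_real_indicator) (auto simp: less_top[symmetric])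
    have "(b - a) * (\<Sum>i<n. measure M (A i)) - \<bar>a\<bar> = (\<integral>w. (b - a) * (\<Sum>i<n. indicat_real (A i) w) - \<bar>a\<bar> \<partial>M)"
      using iA by (simp add: Bochner_Integration.integral_sum prob_space)
    also have "\<dots> \<le> (\<integral>w. (\<Sum>i<n. of_bool (?H i w) * (Y (Suc i) w - Y i w)) \<partial>M)"
    proof (intro integral_mono Bochner_Integration.integrable_diff integrable_mult_right Bochner_Integration.integrable_sum iA tr)
      fix w assume w: "w \<in> space M"
      have "(\<Sum>i<n. indicat_real (A i) w) = (\<Sum>i<n. of_bool (?H i w \<and> \<not> ?H (Suc i) w))"
        using w by (intro sum.cong) (auto simp: A_def indicator_def)
      then show "(b - a) * (\<Sum>i<n. indicat_real (A i) w) - \<bar>a\<bar>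
          \<le> (\<Sum>i<n. of_bool (?H i w) * (Y (Suc i) w - Y i w))"
        using upcrossing_gain[OF less_imp_le[OF ab], of "\<lambda>m. Y m w" n] nonneg[OF w, of n]
        by (cases "?H n w"; simp only: if_True if_False; linarith)
    qed auto
    also have "\<dots> \<le> 0"
      by (subst Bochner_Integration.integral_sum) (use tr in \<open>auto intro: sum_nonpos simp del: sum_mult_of_bool_eq sum_of_bool_mult_eq\<close>)
    finally show ?thesis using ab by (simp add: field_simps)
  qed
  then have "summable (\<lambda>n. measure M (A n))"
    by (intro summableI_nonneg_bounded) auto
  then have "AE w in M. \<forall>\<^sub>F n in sequentially. w \<in> space M - A n"
    by (intro borel_cantelli_AE1) (auto simp: less_top[symmetric])
  then show ?thesis
    by (auto simp: A_def elim!: eventually_mono)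
qed

text \<open>Fatou's lemma together with the decrease of the means.\<close>

lemma nonneg_supermartingale_liminf_finite:
  "AE w in M. liminf (\<lambda>n. ennreal (Y n w)) \<noteq> \<infinity>"
proof (rule nn_integral_PInf_AE)
  have [measurable]: "Y n \<in> borel_measurable M" for n using int by auto
  show "(\<lambda>w. liminf (\<lambda>n. ennreal (Y n w))) \<in> borel_measurable M" by measurable
  have le: "(\<integral>w. Y n w \<partial>M) \<le> (\<integral>w. Y 0 w \<partial>M)" for n
  proof (induction n)
    case (Suc n)
    have "(\<integral>w. Y (Suc n) w - Y n w \<partial>M) \<le> 0"
      using supermartingale_transform_nonpos(2)[of "\<lambda>_. True" n] by simp
    then show ?case using Suc int by simp
  qed simp
  have "(\<integral>\<^sup>+w. liminf (\<lambda>n. ennreal (Y n w)) \<partial>M) \<le> liminf (\<lambda>n. \<integral>\<^sup>+w. ennreal (Y n w) \<partial>M)"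
    by (intro nn_integral_liminf) auto
  also have "\<dots> \<le> limsup (\<lambda>n. \<integral>\<^sup>+w. ennreal (Y n w) \<partial>M)"
    by (intro Liminf_le_Limsup) auto
  also have "\<dots> \<le> ennreal (\<integral>w. Y 0 w \<partial>M)"
  proof (intro Limsup_bounded always_eventually allI)
    fix n
    have "(\<integral>\<^sup>+w. ennreal (Y n w) \<partial>M) = ennreal (\<integral>w. Y n w \<partial>M)"
      using int nonneg by (intro nn_integral_eq_integral) auto
    then show "(\<integral>\<^sup>+w. ennreal (Y n w) \<partial>M) \<le> ennreal (\<integral>w. Y 0 w \<partial>M)"
      using le by (simp add: ennreal_leI)
  qed
  finally show "(\<integral>\<^sup>+w. liminf (\<lambda>n. ennreal (Y n w)) \<partial>M) \<noteq> \<infinity>"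
    by (auto simp: top_unique)
qed

text \<open>Restricting to rational endpoints leaves only countably many null sets.\<close>

theorem nonneg_supermartingale_convergent: "AE w in M. convergent (\<lambda>n. Y n w)"
proof -
  let ?c = "\<lambda>w a b. (\<forall>\<^sub>F n in sequentially. Y n w \<le> b) \<or> (\<forall>\<^sub>F n in sequentially. a \<le> Y n w)"
  have "AE w in M. ?c w a b" if "a < b" for a b
    using finitely_many_upcrossings[OF that] by eventually_elim (rule eventually_outside_interval)
  then have "AE w in M. a < b \<longrightarrow> ?c w a b" for a b
    by (cases "a < b") auto
  then have "AE w in M. \<forall>a\<in>\<rat>. \<forall>b\<in>\<rat>. a < b \<longrightarrow> ?c w a b"
    by (simp add: AE_ball_countable countable_rat)
  with nonneg_supermartingale_liminf_finite AE_space show ?thesis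
    by eventually_elim (rule convergent_of_no_crossings, use nonneg in auto)
qed

end

text \<open>The recursion is normalised by \<open>A n = (\<Prod>i<n. 1 + X i)\<close> and then switched off by the
  predictable indicators \<open>J K n\<close> as soon as the normalised perturbations add up to more than \<open>K\<close>.
  This leaves a nonnegative supermartingale for every \<open>K\<close>.\<close>

theorem Robbins_Siegmund:
  fixes V X \<eta> \<xi> :: "nat \<Rightarrow> 'w \<Rightarrow> real"
  assumes meas [measurable]: "\<And>n. V n \<in> borel_measurable (F n)" "\<And>n. X n \<in> borel_measurable (F n)"
      "\<And>n. \<eta> n \<in> borel_measurable (F n)" "\<And>n. \<xi> n \<in> borel_measurable (F n)"
    and nonneg: "\<And>n w. w \<in> space M \<Longrightarrow> 0 \<le> V n w" "\<And>n w. w \<in> space M \<Longrightarrow> 0 \<le> X n w"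
      "\<And>n w. w \<in> space M \<Longrightarrow> 0 \<le> \<eta> n w" "\<And>n w. w \<in> space M \<Longrightarrow> 0 \<le> \<xi> n w"
    and int: "\<And>n. integrable M (V n)"
    and summ: "AE w in M. summable (\<lambda>n. X n w)" "AE w in M. summable (\<lambda>n. \<eta> n w)"
    and rec: "\<And>n. AE w in M. CE n (V (Suc n)) w
                \<le> (1 + X n w) * V n w + \<eta> n w - \<xi> n w"
  shows "AE w in M. convergent (\<lambda>n. V n w) \<and> summable (\<lambda>n. \<xi> n w)"
proof -
  define A where "A n w = (\<Prod>i<n. 1 + X i w)" for n w
  define e where "e n w = \<eta> n w / A (Suc n) w" for n w
  define r where "r n w = \<xi> n w / A (Suc n) w" for n w
  \<comment> \<open>\<open>J K n\<close> involves \<open>e\<close> up to index \<open>n - 1\<close>,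
    so \<open>J K (Suc n)\<close> is measurable with respect to \<open>F n\<close> and factors out
    of the conditional expectation given \<open>F n\<close>.\<close>
  define J :: "nat \<Rightarrow> nat \<Rightarrow> 'w \<Rightarrow> real" where "J K n w = of_bool ((\<Sum>i<n. e i w) \<le> real K)" for K n w
  \<comment> \<open>The constant \<open>real K\<close> is a credit from which the additive
    perturbations are drawn; the switch keeps it nonnegative (\<open>eJ\<close>). Adding the
    accumulated decrease \<open>r\<close> makes a bound on \<open>Y\<close> also a bound on the sum
    of \<open>r\<close>.\<close>
  define Y where "Y K n w = V n w / A n w * J K n w + (real K - (\<Sum>i<n. e i w * J K (Suc i) w))
       + (\<Sum>i<n. r i w * J K (Suc i) w)" for K n w
  have measF: "\<And>n i. i \<le> n \<Longrightarrow> V i \<in> borel_measurable (F n)" "\<And>n i. i \<le> n \<Longrightarrow> X i \<in> borel_measurable (F n)"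
      "\<And>n i. i \<le> n \<Longrightarrow> \<eta> i \<in> borel_measurable (F n)" "\<And>n i. i \<le> n \<Longrightarrow> \<xi> i \<in> borel_measurable (F n)"
    using meas by (auto intro: measurable_F_mono)
  have AF: "A i \<in> borel_measurable (F n)" if "i \<le> Suc n" for i n
    unfolding A_def using measF(2) that by (intro borel_measurable_prod borel_measurable_add) auto
  have eF: "e i \<in> borel_measurable (F n)" if "i \<le> n" for i n
    unfolding e_def using measF(3) AF that by (intro borel_measurable_divide) auto
  have rF: "r i \<in> borel_measurable (F n)" if "i \<le> n" for i n
    unfolding r_def using measF(4) AF that by (intro borel_measurable_divide) auto
  have JF: "J K i \<in> borel_measurable (F n)" if "i \<le> Suc n" for K i n
  proof -
    have [measurable]: "(\<lambda>w. \<Sum>j<i. e j w) \<in> borel_measurable (F n)"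
      using that by (intro borel_measurable_sum eF) auto
    show ?thesis unfolding J_def by measurable
  qed
  have A1: "1 \<le> A n w" if "w \<in> space M" for n w
    unfolding A_def using nonneg(2)[OF that] by (intro prod_ge_1) auto
  have A0: "0 < A n w" if "w \<in> space M" for n w
    using A1[OF that, of n] by simp
  have e0: "0 \<le> e n w" "e n w \<le> \<eta> n w" and r0: "0 \<le> r n w" if "w \<in> space M" for n w
    using nonneg(3,4)[OF that, of n] A1[OF that, of "Suc n"] A0[OF that, of "Suc n"]
    by (auto simp: e_def r_def divide_le_eq mult_le_cancel_left1 simp del: of_nat_Suc)
  have J01: "0 \<le> J K n w" "J K n w \<le> 1" for K n w
    by (auto simp: J_def)
  have Jdec: "J K (Suc n) w \<le> J K n w" if "w \<in> space M" for K n w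
    using e0[OF that, of n] by (auto simp: J_def)
  have eJ: "(\<Sum>i<n. e i w * J K (Suc i) w) \<le> real K" if w: "w \<in> space M" for K n w
  proof (induction n)
    case (Suc n)
    show ?case
    proof (cases "(\<Sum>i<Suc n. e i w) \<le> real K")
      case True
      have "(\<Sum>i<Suc n. e i w * J K (Suc i) w) \<le> (\<Sum>i<Suc n. e i w)"
        using e0[OF w] J01 by (intro sum_mono) (auto simp: mult_le_cancel_left1 mult_left_le)
      with True show ?thesis by linarith
    next
      case False
      then have "J K (Suc n) w = 0" by (simp add: J_def)
      with Suc show ?thesis by simp
    qed
  qed simp
  have eJ1: "e i w * J K (Suc i) w \<le> real K" if w: "w \<in> space M" for K i w
  proof -
    have "(\<Sum>j\<in>{i}. e j w * J K (Suc j) w) \<le> (\<Sum>j<Suc i. e j w * J K (Suc j) w)"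
      using e0[OF w] J01 by (intro sum_mono2) auto
    then show ?thesis using eJ[OF w, of K "Suc i"] by simp
  qed
  have VA: "V n w / A n w \<le> V n w" "0 \<le> V n w / A n w" if w: "w \<in> space M" for n w
    using nonneg(1)[OF w, of n] A1[OF w, of n] A0[OF w, of n] by (simp_all add: divide_le_eq mult_le_cancel_left1)
  have conv: "AE w in M. convergent (\<lambda>n. Y K n w)" for K
  proof (rule nonneg_supermartingale_convergent)
    show YF: "Y K n \<in> borel_measurable (F n)" for n
      unfolding Y_def using measF(1) AF JF eF rF
      by (intro borel_measurable_add borel_measurable_diff borel_measurable_times borel_measurable_divide
          borel_measurable_sum borel_measurable_const) auto
    show "0 \<le> Y K n w" if w: "w \<in> space M" for n w
      unfolding Y_def using nonneg(1)[OF w, of n] A0[OF w, of n] J01 r0[OF w] eJ[OF w, of K n]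
      by (intro add_nonneg_nonneg mult_nonneg_nonneg sum_nonneg) auto
    note AM = measurable_F_M[OF AF[OF order_refl]] and JM = measurable_F_M[OF JF[OF order_refl]]
    have iV: "integrable M (\<lambda>w. V n w / A n w * J K n w)" for n
    proof (rule Bochner_Integration.integrable_bound[OF int[of n]])
      show "(\<lambda>w. V n w / A n w * J K n w) \<in> borel_measurable M"
        using measurable_F_M[OF meas(1)] measurable_F_M[OF AF[of n n]] measurable_F_M[OF JF[of n n]] by simp
      have "V n w / A n w * J K n w \<le> V n w * 1" "0 \<le> V n w / A n w * J K n w" if w: "w \<in> space M" for w
        by (rule mult_mono[OF VA(1)[OF w] J01(2) nonneg(1)[OF w] J01(1)],
            rule mult_nonneg_nonneg[OF VA(2)[OF w] J01(1)])
      then show "AE w in M. norm (V n w / A n w * J K n w) \<le> norm (V n w)"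
        using nonneg(1) by (intro AE_I2) (metis abs_of_nonneg mult.right_neutral real_norm_def)
    qed
    have ie: "integrable M (\<lambda>w. e i w * J K (Suc i) w)" for i
    proof (rule integrable_const_bound[where B = "real K"])
      show "(\<lambda>w. e i w * J K (Suc i) w) \<in> borel_measurable M"
        using measurable_F_M[OF eF[of i i]] measurable_F_M[OF JF[of "Suc i" i]] by simp
      show "AE w in M. norm (e i w * J K (Suc i) w) \<le> real K"
        using eJ1 e0 J01 by (intro AE_I2) simp
    qed
    \<comment> \<open>The lower bound 0 is recorded as well because \<xi> comes without
      integrability: together the two bounds give \<open>r n w * J K (Suc n) w\<close> \<le>
      \<open>V n w + K\<close>, from which \<open>ir\<close> is deduced.\<close>
    have step: "AE w in M. CE n (\<lambda>w. V (Suc n) w / A (Suc n) w * J K (Suc n) w) w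
        \<le> J K (Suc n) w * (V n w / A n w + e n w - r n w)
        \<and> 0 \<le> CE n (\<lambda>w. V (Suc n) w / A (Suc n) w * J K (Suc n) w) w" for n
    proof -
      interpret F: sigma_finite_subalgebra M "F n" by (rule sigma_finite_subalg)
      have [measurable]: "J K (Suc n) \<in> borel_measurable (F n)" "A (Suc n) \<in> borel_measurable (F n)"
        "V (Suc n) \<in> borel_measurable M"
        using JF AF int by auto
      have eq: "(\<lambda>w. V (Suc n) w / A (Suc n) w * J K (Suc n) w)
          = (\<lambda>w. (J K (Suc n) w / A (Suc n) w) * V (Suc n) w)" by auto
      have "AE w in M. CE n (\<lambda>w. (J K (Suc n) w / A (Suc n) w) * V (Suc n) w) w
         = (J K (Suc n) w / A (Suc n) w) * CE n (V (Suc n)) w"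
        using iV[of "Suc n"] unfolding eq by (intro F.real_cond_exp_mult) auto
      moreover have "AE w in M. 0 \<le> CE n (V (Suc n)) w"
        using nonneg(1) by (intro F.real_cond_exp_pos) auto
      ultimately show ?thesis
        unfolding eq using rec[of n] AE_space
      proof eventually_elim
        case (elim w)
        note w = \<open>w \<in> space M\<close>
        have s: "A (Suc n) w = A n w * (1 + X n w)" by (simp add: A_def)
        have "J K (Suc n) w / A (Suc n) w * CE n (V (Suc n)) w
          \<le> J K (Suc n) w / A (Suc n) w * ((1 + X n w) * V n w + \<eta> n w - \<xi> n w)"
          using elim J01 A0[OF w, of "Suc n"] by (intro mult_left_mono) auto
        also have "\<dots> = J K (Suc n) w * (V n w / A n w + e n w - r n w)"
        proof -
          have "j / (a * d) * (d * x + y - z) = j * (x / a + y / (a * d) - z / (a * d))"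
            if "0 < a" "0 < d" for j a d x y z :: real
            using that by (simp add: add_divide_distrib diff_divide_distrib algebra_simps)
          then show ?thesis
            unfolding e_def r_def s using A0[OF w, of n] nonneg(2)[OF w, of n] by simp
        qed
        finally show ?case
          using elim J01 A0[OF w, of "Suc n"] by auto
      qed
    qed
    have ir: "integrable M (\<lambda>w. r i w * J K (Suc i) w)" for i
    proof (rule Bochner_Integration.integrable_bound[OF Bochner_Integration.integrable_add[OF int[of i] integrable_const[of "real K"]]])
      show "(\<lambda>w. r i w * J K (Suc i) w) \<in> borel_measurable M"
        using measurable_F_M[OF rF[of i i]] measurable_F_M[OF JF[of "Suc i" i]] by simp
      show "AE w in M. norm (r i w * J K (Suc i) w) \<le> norm (V i w + real K)"
        using step[of i] AE_space
      proof eventually_elim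
        case (elim w)
        note w = \<open>w \<in> space M\<close>
        have "J K (Suc i) w * (V i w / A i w) \<le> 1 * V i w"
          using VA[OF w, of i] J01 by (intro mult_mono) auto
        with eJ1[OF w, of i K] elim have "r i w * J K (Suc i) w \<le> V i w + real K"
          by (simp add: algebra_simps)
        moreover have "0 \<le> r i w * J K (Suc i) w" using r0[OF w] J01 by simp
        ultimately show ?case by simp
      qed
    qed
    show iY: "integrable M (Y K n)" for n
      unfolding Y_def using iV ie ir
      by (intro Bochner_Integration.integrable_add Bochner_Integration.integrable_diff
          Bochner_Integration.integrable_sum integrable_const)
    show "AE w in M. CE n (Y K (Suc n)) w \<le> Y K n w" for n
    proof -
      interpret F: sigma_finite_subalgebra M "F n" by (rule sigma_finite_subalg)
      let ?R = "\<lambda>w. (real K - (\<Sum>i<Suc n. e i w * J K (Suc i) w)) + (\<Sum>i<Suc n. r i w * J K (Suc i) w)"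
      have iR: "integrable M ?R"
        using ie ir by (intro Bochner_Integration.integrable_add Bochner_Integration.integrable_diff
          Bochner_Integration.integrable_sum integrable_const)
      have RF: "?R \<in> borel_measurable (F n)"
        using eF rF JF by (intro borel_measurable_add borel_measurable_diff borel_measurable_times
          borel_measurable_sum borel_measurable_const) auto
      have Ys: "Y K (Suc n) = (\<lambda>w. V (Suc n) w / A (Suc n) w * J K (Suc n) w + ?R w)"
        by (auto simp: Y_def)
      have "AE w in M. CE n ?R w = ?R w"
        by (rule F.real_cond_exp_F_meas[OF iR RF])
      moreover have "AE w in M. CE n (\<lambda>w. V (Suc n) w / A (Suc n) w * J K (Suc n) w + ?R w) w
        = CE n (\<lambda>w. V (Suc n) w / A (Suc n) w * J K (Suc n) w) w + CE n ?R w"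
        by (rule F.real_cond_exp_add[OF iV iR])
      ultimately show ?thesis
        unfolding Ys using step[of n] AE_space
      proof eventually_elim
        case (elim w)
        note w = \<open>w \<in> space M\<close>
        have "J K (Suc n) w * (V n w / A n w) \<le> J K n w * (V n w / A n w)"
          using Jdec[OF w] nonneg(1)[OF w, of n] A0[OF w, of n] by (intro mult_right_mono) auto
        then show ?case using elim by (simp add: Y_def algebra_simps)
      qed
    qed
  qed
  then have "AE w in M. \<forall>K. convergent (\<lambda>n. Y K n w)"
    by (simp add: AE_all_countable)
  then show ?thesis
    using summ AE_space
  proof eventually_elim
    case (elim w)
    note w = \<open>w \<in> space M\<close>
    have se: "summable (\<lambda>n. e n w)"
      using e0[OF w] by (intro summable_comparison_test'[OF elim(3)]) auto
    \<comment> \<open>On this path the switch at level \<open>K\<close> is never triggered, so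
      \<open>Y K\<close> is the process without indicators.\<close>
    obtain K where K: "(\<Sum>n. e n w) \<le> real K" using real_arch_simple by blast
    have "J K n w = 1" for n
      using K sum_le_suminf[OF se, of "{..<n}"] e0[OF w] by (auto simp: J_def)
    then have Yeq: "Y K n w = V n w / A n w + (real K - (\<Sum>i<n. e i w)) + (\<Sum>i<n. r i w)" for n
      by (simp add: Y_def)
    have cY: "convergent (\<lambda>n. Y K n w)" using elim by blast
    then have "Bseq (\<lambda>n. Y K n w)" by (rule convergent_imp_Bseq)
    then obtain B where B: "\<And>n. \<bar>Y K n w\<bar> \<le> B"
      unfolding Bseq_def real_norm_def by blast
    have "(\<Sum>i<n. r i w) \<le> B" for n
    proof -
      have "(\<Sum>i<n. e i w) \<le> real K"
        using K sum_le_suminf[OF se, of "{..<n}"] e0[OF w] by auto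
      then show ?thesis using B[of n] VA(2)[OF w, of n] by (simp add: Yeq)
    qed
    then have sr: "summable (\<lambda>n. r n w)"
      using r0[OF w] by (intro summableI_nonneg_bounded) auto
    have "convergent (\<lambda>n. Y K n w - (real K - (\<Sum>i<n. e i w)) - (\<Sum>i<n. r i w))"
      using cY se sr by (intro convergent_diff convergent_const) (auto simp: summable_iff_convergent)
    then have cV: "convergent (\<lambda>n. V n w / A n w)" by (simp add: Yeq)
    \<comment> \<open>The normalisation has to be undone: \<open>A\<close> increases and is bounded
      by the exponential of the sum of \<open>X\<close>, so it converges, and so does
      \<open>V\<close> as the product of \<open>V / A\<close> and \<open>A\<close>.\<close>
    have Aexp: "A n w \<le> exp (\<Sum>i. X i w)" for n
    proof -
      have "A n w \<le> exp (\<Sum>i<n. X i w)"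
        unfolding A_def using nonneg(2)[OF w] by (intro prod_le_exp_sum) auto
      also have "\<dots> \<le> exp (\<Sum>i. X i w)"
        using nonneg(2)[OF w] elim(2) by (simp add: sum_le_suminf)
      finally show ?thesis .
    qed
    have "incseq (\<lambda>n. A n w)"
    proof (rule incseq_SucI)
      fix n
      have "A n w * 1 \<le> A n w * (1 + X n w)"
        using A0[OF w, of n] nonneg(2)[OF w, of n] by (intro mult_left_mono) auto
      then show "A n w \<le> A (Suc n) w" by (simp add: A_def)
    qed
    with Aexp have cA: "convergent (\<lambda>n. A n w)"
      by (metis incseq_convergent convergentI)
    have "convergent (\<lambda>n. V n w / A n w * A n w)"
      by (rule convergent_mult[OF cV cA])
    moreover have "V n w / A n w * A n w = V n w" for n
      using A0[OF w, of n] by simp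
    ultimately have "convergent (\<lambda>n. V n w)" by simp
    moreover have "summable (\<lambda>n. \<xi> n w)"
    proof (rule summable_comparison_test'[OF summable_mult2[OF sr, of "exp (\<Sum>i. X i w)"]])
      fix n
      have "\<xi> n w = r n w * A (Suc n) w" using A0[OF w, of "Suc n"] by (simp add: r_def)
      also have "\<dots> \<le> r n w * exp (\<Sum>i. X i w)"
        using r0[OF w] Aexp by (intro mult_left_mono)
      finally show "norm (\<xi> n w) \<le> r n w * exp (\<Sum>i. X i w)" using nonneg(4)[OF w] by simp
    qed
    ultimately show ?case ..
  qed
qed

end

section \<open>Stochastic quasi-Fejer sequences and conditional expectations of random vectors\<close>

text \<open>The deterministic part, for one path. Convergence of \<open>Q (z n - p)\<close> is
  available only for \<open>p\<close> in the set \<open>E\<close>, whose closure contains the fixed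
  points, while the cluster point may lie outside \<open>E\<close>; it is therefore approached by
  points \<open>q k\<close> of \<open>E\<close>.\<close>

lemma quasi_Fejer_convergence:
  fixes z :: "nat \<Rightarrow> 'a::euclidean_space"
  assumes m: "0 < m" "\<And>w. m * (norm w)^2 \<le> Q w" and Q0: "Q 0 = 0" and Q: "continuous_on UNIV Q"
    and D: "closed D" "\<And>n. z n \<in> D" and T: "continuous_on D T"
    and E: "E \<noteq> {}" "\<And>p. p \<in> D \<Longrightarrow> T p = p \<Longrightarrow> p \<in> closure E"
    and conv: "\<And>p. p \<in> E \<Longrightarrow> convergent (\<lambda>n. Q (z n - p))"
    and l: "\<And>n. 0 \<le> l n" "\<not> summable l" and summ: "summable (\<lambda>n. l n * Q (z n - T (z n)))"
  shows "\<exists>p\<in>D. T p = p \<and> z \<longlonglongrightarrow> p"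
proof -
  have Qpos: "0 \<le> Q w" for w
    by (rule order_trans[OF _ m(2)]) (use m(1) in simp)
  obtain p0 where "p0 \<in> E" using E by blast
  then have "Bseq (\<lambda>n. Q (z n - p0))" by (intro convergent_imp_Bseq conv)
  then obtain B where B: "\<And>n. \<bar>Q (z n - p0)\<bar> \<le> B" unfolding Bseq_def real_norm_def by blast
  have "norm (z n) \<le> norm p0 + sqrt (B / m)" for n
  proof -
    have "m * (norm (z n - p0))^2 \<le> B" using B[of n] m(2)[of "z n - p0"] by linarith
    then have "norm (z n - p0) \<le> sqrt (B / m)"
      using m(1) by (intro real_le_rsqrt) (simp add: field_simps)
    then show ?thesis using norm_triangle_sub[of "z n" p0] by linarith
  qed
  then have bnd: "bounded (range z)" by (auto simp: bounded_iff)
  \<comment> \<open>If \<open>Q (z n - T (z n))\<close> stayed above \<open>1 / real (Suc k)\<close>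
    from \<open>k\<close> on, the weighted sum would dominate a multiple of the divergent series of
    \<open>l\<close>.\<close>
  have "\<exists>n\<ge>k. Q (z n - T (z n)) < 1 / real (Suc k)" for k
  proof (rule ccontr)
    assume "\<not> ?thesis"
    then have ge: "1 / real (Suc k) \<le> Q (z n - T (z n))" if "n \<ge> k" for n
      using that by (auto simp: not_less)
    have "summable (\<lambda>n. l n * (1 / real (Suc k)))"
    proof (rule summable_comparison_test'[OF summ])
      fix n assume "n \<ge> k"
      then have "l n * (1 / real (Suc k)) \<le> l n * Q (z n - T (z n))"
        using ge l(1) by (intro mult_left_mono) auto
      then show "norm (l n * (1 / real (Suc k))) \<le> l n * Q (z n - T (z n))"
        using l(1) by (simp del: of_nat_Suc)
    qed
    then have "summable (\<lambda>n. l n * (1 / real (Suc k)) * real (Suc k))" by (rule summable_mult2)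
    with l(2) show False by (simp del: of_nat_Suc)
  qed
  then obtain s where s: "\<And>k. s k \<ge> k" "\<And>k. Q (z (s k) - T (z (s k))) < 1 / real (Suc k)"
    by metis
  have "bounded (range (\<lambda>k. z (s k)))" using bnd by (rule bounded_subset) auto
  then obtain p r where r: "strict_mono r" "((\<lambda>k. z (s k)) \<circ> r) \<longlonglongrightarrow> p"
    using bounded_imp_convergent_subsequence by blast
  have zr: "(\<lambda>k. z (s (r k))) \<longlonglongrightarrow> p" using r(2) by (simp add: o_def)
  \<comment> \<open>The indices \<open>s k\<close> need not increase; all that is known, and enough,
    is that they tend to infinity.\<close>
  have sr: "filterlim (\<lambda>k. s (r k)) at_top sequentially"
    by (rule filterlim_at_top_mono[OF filterlim_ident])
       (use s(1) r(1) in \<open>auto intro!: always_eventually intro: order_trans[OF seq_suble]\<close>)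
  have pD: "p \<in> D" using D zr by (intro closed_sequentially[OF D(1) _ zr]) auto
  have fixp: "T p = p"
  proof -
    have "(\<lambda>k. T (z (s (r k)))) \<longlonglongrightarrow> T p"
      using D pD by (intro continuous_on_tendsto_compose[OF T zr]) auto
    then have "(\<lambda>k. Q (z (s (r k)) - T (z (s (r k))))) \<longlonglongrightarrow> Q (p - T p)"
      by (intro continuous_on_tendsto_compose[OF Q] tendsto_diff zr) auto
    moreover have "(\<lambda>k. Q (z (s k) - T (z (s k)))) \<longlonglongrightarrow> 0"
      by (rule tendsto_sandwich[OF _ _ tendsto_const LIMSEQ_inverse_real_of_nat])
         (use s(2) Qpos in \<open>auto intro!: always_eventually simp: inverse_eq_divide less_imp_le simp del: of_nat_Suc\<close>)
    then have "(\<lambda>k. Q (z (s (r k)) - T (z (s (r k))))) \<longlonglongrightarrow> 0"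
      using LIMSEQ_subseq_LIMSEQ[OF _ r(1)] by (fastforce simp: o_def)
    ultimately have "Q (p - T p) = 0" by (rule LIMSEQ_unique)
    then have "m * (norm (p - T p))^2 \<le> 0" using m(2)[of "p - T p"] by simp
    then show ?thesis using m(1) by (simp add: mult_le_0_iff)
  qed
  obtain q where q: "\<And>k. q k \<in> E" "q \<longlonglongrightarrow> p"
    using E(2)[OF pD fixp] unfolding closure_sequential by blast
  have "z \<longlonglongrightarrow> p"
  proof (rule tendstoI)
    \<comment> \<open>The radius \<open>e\<close> is shared equally between \<open>q k\<close> and
      the tail of \<open>z\<close>. A limit of \<open>Q (z n - q k)\<close> below
      \<open>m * e^2 / 4\<close> puts \<open>z n\<close> within \<open>e / 2\<close> of
      \<open>q k\<close>; that limit is \<open>Q (p - q k)\<close>, evaluated along the subsequence,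
      and choosing it below \<open>m * e^2 / 8\<close> leaves a margin.\<close>
    fix e :: real assume e: "0 < e"
    have "(\<lambda>k. Q (p - q k)) \<longlonglongrightarrow> Q (p - p)"
      by (intro continuous_on_tendsto_compose[OF Q] tendsto_intros q) auto
    then have "\<forall>\<^sub>F k in sequentially. Q (p - q k) < m * e^2 / 8"
      using m(1) e Q0 by (intro order_tendstoD(2)) auto
    moreover have "\<forall>\<^sub>F k in sequentially. dist (q k) p < e / 2"
      using q(2) e by (intro tendstoD) auto
    ultimately have "\<forall>\<^sub>F k in sequentially. Q (p - q k) < m * e^2 / 8 \<and> dist (q k) p < e / 2"
      by (rule eventually_conj)
    then obtain k where k: "Q (p - q k) < m * e^2 / 8" "dist (q k) p < e / 2"
      using eventually_happens'[OF sequentially_bot] by blast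
    obtain c where c: "(\<lambda>n. Q (z n - q k)) \<longlonglongrightarrow> c"
      using conv[OF q(1)] by (auto simp: convergent_def)
    have "(\<lambda>j. Q (z (s (r j)) - q k)) \<longlonglongrightarrow> c"
      by (rule filterlim_compose[OF c sr])
    moreover have "(\<lambda>j. Q (z (s (r j)) - q k)) \<longlonglongrightarrow> Q (p - q k)"
      by (intro continuous_on_tendsto_compose[OF Q] tendsto_intros zr) auto
    ultimately have "c = Q (p - q k)" by (rule LIMSEQ_unique)
    then have "c < m * e^2 / 4"
      using k(1) m(1) e Qpos[of "p - q k"] by simp
    then have "\<forall>\<^sub>F n in sequentially. Q (z n - q k) < m * e^2 / 4"
      using c by (rule order_tendstoD(2)[rotated])
    then show "\<forall>\<^sub>F n in sequentially. dist (z n) p < e"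
    proof eventually_elim
      case (elim n)
      then have "m * (norm (z n - q k))^2 < m * (e / 2)^2"
        using m(2)[of "z n - q k"] by (simp add: power_divide)
      then have "norm (z n - q k) < e / 2"
        using m(1) e by (intro power2_less_imp_less[of _ "e / 2"]) auto
      then show ?case using k(2) dist_triangle[of "z n" p "q k"] by (simp add: dist_norm)
    qed
  qed
  with pD fixp show ?thesis by blast
qed

text \<open>Needed because the primal-dual operator is controlled only on \<open>feasible\<close>:
  outside \<open>G k\<close> the dual proximity operators are arbitrary.\<close>

lemma borel_measurable_continuous_on_closed:
  assumes T: "continuous_on D T" and D: "closed D"
    and X: "X \<in> borel_measurable N" "\<And>w. w \<in> space N \<Longrightarrow> X w \<in> D"
  shows "(\<lambda>w. T (X w)) \<in> borel_measurable N"
proof -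
  have "X \<in> measurable N (restrict_space borel D)"
    using X by (intro measurable_restrict_space2) auto
  from measurable_compose[OF this borel_measurable_continuous_on_restrict[OF T]] show ?thesis .
qed

text \<open>The limit has to lie in \<open>S\<close> at every point of the space. The failure set
  may not be measurable, so a null set \<open>N\<close> covering it is fixed and the value there is
  reset to \<open>p0\<close>.\<close>

lemma (in prob_space) random_limit_in_set:
  fixes z :: "nat \<Rightarrow> 'a \<Rightarrow> 'b::euclidean_space"
  assumes [measurable]: "\<And>n. z n \<in> borel_measurable M" and p0: "p0 \<in> S"
    and ae: "AE w in M. \<exists>p\<in>S. (\<lambda>n. z n w) \<longlonglongrightarrow> p"
  shows "\<exists>Z\<in>borel_measurable M. (\<forall>w\<in>space M. Z w \<in> S) \<and> (AE w in M. (\<lambda>n. z n w) \<longlonglongrightarrow> Z w)"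
proof -
  obtain N where N: "N \<in> null_sets M" "{w\<in>space M. \<not> (\<exists>p\<in>S. (\<lambda>n. z n w) \<longlonglongrightarrow> p)} \<subseteq> N"
    using ae unfolding eventually_ae_filter by blast
  have [measurable]: "N \<in> sets M" using N by auto
  define Z where "Z w = (if w \<in> N then p0 else lim (\<lambda>n. z n w))" for w
  have lim: "(\<lambda>n. z n w) \<longlonglongrightarrow> Z w" "Z w \<in> S" if w: "w \<in> space M" "w \<notin> N" for w
  proof -
    obtain p where p: "p \<in> S" "(\<lambda>n. z n w) \<longlonglongrightarrow> p"
      using w N(2) by blast
    then have "lim (\<lambda>n. z n w) = p" by (simp add: limI)
    with p w show "(\<lambda>n. z n w) \<longlonglongrightarrow> Z w" "Z w \<in> S" by (auto simp: Z_def)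
  qed
  have "Z \<in> borel_measurable M"
  proof (rule borel_measurable_LIMSEQ_metric)
    show "(\<lambda>w. if w \<in> N then p0 else z n w) \<in> borel_measurable M" for n by measurable
    show "(\<lambda>n. if w \<in> N then p0 else z n w) \<longlonglongrightarrow> Z w" if "w \<in> space M" for w
      using lim(1)[OF that] by (auto simp: Z_def)
  qed
  moreover have "\<forall>w\<in>space M. Z w \<in> S"
    using lim(2) p0 by (metis Z_def)
  moreover have "AE w in M. (\<lambda>n. z n w) \<longlonglongrightarrow> Z w"
    using AE_not_in[OF N(1)] AE_space by eventually_elim (use lim in auto)
  ultimately show ?thesis by blast
qed

text \<open>In \<open>rec\<close> the perturbation and the rate may depend on \<open>p\<close>, and
  so does the null set on which convergence fails. Separability reduces the fixed points to
  countably many, so that one null set serves all of them.\<close>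

theorem (in filtered_prob_space) stochastic_quasi_Fejer:
  fixes z :: "nat \<Rightarrow> 'w \<Rightarrow> 'a::euclidean_space"
  assumes m: "0 < m" "\<And>w. m * (norm w)^2 \<le> Q w" and Q0: "Q 0 = 0" and Q: "continuous_on UNIV Q"
    and D: "closed D" "\<And>n w. w \<in> space M \<Longrightarrow> z n w \<in> D" and T: "continuous_on D T"
    and z: "\<And>n. z n \<in> borel_measurable (F n)"
    and int: "\<And>n p. integrable M (\<lambda>w. Q (z n w - p))"
    and l: "\<And>n. 0 \<le> l n" "\<not> summable l"
    and ne: "\<exists>p\<in>D. T p = p"
    and rec: "\<And>p. p \<in> D \<Longrightarrow> T p = p \<Longrightarrow> \<exists>X \<theta>. 0 < (\<theta>::real) \<and> (\<forall>n. X n \<in> borel_measurable (F n)) \<and>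
        (\<forall>n. \<forall>w\<in>space M. 0 \<le> X n w) \<and> (AE w in M. summable (\<lambda>n. X n w)) \<and>
        (\<forall>n. AE w in M. CE n (\<lambda>w. Q (z (Suc n) w - p)) w
            \<le> Q (z n w - p) + X n w * (1 + Q (z n w - p)) - \<theta> * (l n * Q (z n w - T (z n w))))"
  shows "\<exists>Z\<in>borel_measurable M. (\<forall>w\<in>space M. Z w \<in> D \<and> T (Z w) = Z w) \<and>
           (AE w in M. (\<lambda>n. z n w) \<longlonglongrightarrow> Z w)"
proof -
  have Qpos: "0 \<le> Q w" for w
    by (rule order_trans[OF _ m(2)]) (use m(1) in simp)
  have [measurable]: "Q \<in> borel_measurable borel"
    by (rule borel_measurable_continuous_onI[OF Q])
  let ?Z = "{p\<in>D. T p = p}"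
  have pointwise: "AE w in M. convergent (\<lambda>n. Q (z n w - p)) \<and> summable (\<lambda>n. l n * Q (z n w - T (z n w)))"
    if p: "p \<in> D" "T p = p" for p
  proof -
    obtain X \<theta> where X: "0 < (\<theta>::real)" "\<And>n. X n \<in> borel_measurable (F n)"
        "\<And>n w. w \<in> space M \<Longrightarrow> 0 \<le> X n w" "AE w in M. summable (\<lambda>n. X n w)"
      and r: "\<And>n. AE w in M. CE n (\<lambda>w. Q (z (Suc n) w - p)) w
            \<le> Q (z n w - p) + X n w * (1 + Q (z n w - p)) - \<theta> * (l n * Q (z n w - T (z n w)))"
      using rec[OF p] by blast
    have [measurable]: "z n \<in> borel_measurable (F n)" "(\<lambda>w. T (z n w)) \<in> borel_measurable (F n)" for n
      using z D by (auto intro: borel_measurable_continuous_on_closed[OF T])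
    have "AE w in M. convergent (\<lambda>n. Q (z n w - p)) \<and> summable (\<lambda>n. \<theta> * (l n * Q (z n w - T (z n w))))"
    \<comment> \<open>The same \<open>X\<close> is used as growth factor and as additive
      perturbation, since \<open>X n w * (1 + Q)\<close> is the sum of the two.\<close>
    proof (rule Robbins_Siegmund[OF _ X(2) X(2) _ _ X(3) X(3) _ _ X(4) X(4)])
      show "AE w in M. CE n (\<lambda>w. Q (z (Suc n) w - p)) w
            \<le> (1 + X n w) * Q (z n w - p) + X n w - \<theta> * (l n * Q (z n w - T (z n w)))" for n
        using r[of n] by eventually_elim (simp add: algebra_simps)
    qed (use Qpos l(1) X(1) int in auto)
    then show ?thesis using X(1) by (auto simp: summable_cmult_iff)
  qed
  obtain E where E: "countable E" "E \<subseteq> ?Z" "?Z \<subseteq> closure E"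
    by (rule separable)
  have "E \<noteq> {}" using E(3) ne by auto
  have "AE w in M. \<forall>p\<in>E. convergent (\<lambda>n. Q (z n w - p)) \<and> summable (\<lambda>n. l n * Q (z n w - T (z n w)))"
    using pointwise E(2) by (subst AE_ball_countable[OF E(1)]) auto
  then have "AE w in M. \<exists>p\<in>?Z. (\<lambda>n. z n w) \<longlonglongrightarrow> p"
    using AE_space
  proof eventually_elim
    case (elim w)
    have "\<exists>p\<in>D. T p = p \<and> (\<lambda>n. z n w) \<longlonglongrightarrow> p"
      by (rule quasi_Fejer_convergence[OF m Q0 Q D(1) D(2) T \<open>E \<noteq> {}\<close> _ _ l])
         (use elim E(3) \<open>E \<noteq> {}\<close> in auto)
    then show ?case by blast
  qed
  moreover obtain p0 where "p0 \<in> ?Z" using ne by blast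
  ultimately have "\<exists>Z\<in>borel_measurable M. (\<forall>w\<in>space M. Z w \<in> ?Z) \<and> (AE w in M. (\<lambda>n. z n w) \<longlonglongrightarrow> Z w)"
    using measurable_F_M[OF z] by (intro random_limit_in_set) auto
  then show ?thesis by auto
qed

section \<open>Conditional expectations of random vectors\<close>

lemma set_integral_inner:
  fixes f :: "'a \<Rightarrow> 'b::euclidean_space"
  assumes "set_integrable M A f"
  shows "(LINT w:A|M. f w) \<bullet> b = (LINT w:A|M. f w \<bullet> b)"
  using assms by (simp add: set_lebesgue_integral_def set_integrable_def flip: integral_inner_left)

lemma mult_le_sum_squares: "x * y \<le> x^2 + y^2" for x y :: real
  using sum_squares_bound[of x y] zero_le_power2[of x] zero_le_power2[of y] unfolding mult.assoc by linarith

context sigma_finite_subalgebra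
begin

text \<open>\<open>vec_cond_exp\<close> is a choice, so some version has to be exhibited; it is
  assembled coordinatewise from the real conditional expectations.\<close>

lemma has_cond_exp_vec_cond_exp:
  fixes X :: "'a \<Rightarrow> 'b::euclidean_space"
  assumes X: "integrable M X"
  shows "has_cond_exp M F X (vec_cond_exp M F X)"
proof -
  define Y where "Y w = (\<Sum>b\<in>Basis. real_cond_exp M F (\<lambda>w. X w \<bullet> b) w *\<^sub>R b)" for w
  have iX: "integrable M (\<lambda>w. X w \<bullet> b)" for b using X by simp
  have iY: "integrable M Y"
    unfolding Y_def using iX by (intro Bochner_Integration.integrable_sum integrable_scaleR_left) auto
  have "(LINT w:A|M. Y w) = (LINT w:A|M. X w)" if A: "A \<in> sets F" for A
  proof (rule euclidean_eqI)
    fix b :: 'b assume b: "b \<in> Basis"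
    have AM: "A \<in> sets M" using A subalg by (auto simp: subalgebra_def)
    have s: "set_integrable M A Y" "set_integrable M A X"
      using iY X AM by (auto simp: set_integrable_def intro: integrable_mult_indicator)
    have "Y w \<bullet> b = real_cond_exp M F (\<lambda>w. X w \<bullet> b) w" for w
      using b by (simp add: Y_def inner_sum_left inner_Basis if_distrib sum.delta cong: if_cong)
    then show "(LINT w:A|M. Y w) \<bullet> b = (LINT w:A|M. X w) \<bullet> b"
      using real_cond_exp_intA[OF iX A] by (simp add: set_integral_inner s)
  qed
  then have "has_cond_exp M F X Y"
    using X iY unfolding has_cond_exp_def by (auto simp: Y_def[abs_def])
  then show ?thesis unfolding vec_cond_exp_def by (rule someI[of "has_cond_exp M F X"])
qed

lemma real_cond_exp_inner_const:
  fixes X :: "'a \<Rightarrow> 'b::euclidean_space"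
  assumes Y: "has_cond_exp M F X Y"
  shows "AE w in M. real_cond_exp M F (\<lambda>w. X w \<bullet> b) w = Y w \<bullet> b"
proof (rule real_cond_exp_charact)
  fix A assume A: "A \<in> sets F"
  have AM: "A \<in> sets M" using A subalg by (auto simp: subalgebra_def)
  have "set_integrable M A X" "set_integrable M A Y"
    using Y AM by (auto simp: has_cond_exp_def set_integrable_def intro: integrable_mult_indicator)
  then show "(LINT w:A|M. X w \<bullet> b) = (LINT w:A|M. Y w \<bullet> b)"
    using Y A by (metis has_cond_exp_def set_integral_inner)
qed (use Y in \<open>auto simp: has_cond_exp_def\<close>)

lemma integrable_inner_L2:
  fixes X Z :: "'a \<Rightarrow> 'b::euclidean_space"
  assumes [measurable]: "X \<in> borel_measurable M" "Z \<in> borel_measurable M"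
    and sq: "integrable M (\<lambda>w. (norm (X w))^2)" "integrable M (\<lambda>w. (norm (Z w))^2)"
  shows "integrable M (\<lambda>w. X w \<bullet> Z w)"
proof (rule Bochner_Integration.integrable_bound[OF Bochner_Integration.integrable_add[OF sq]])
  show "AE w in M. norm (X w \<bullet> Z w) \<le> norm ((norm (X w))^2 + (norm (Z w))^2)"
  proof (rule AE_I2)
    fix w
    have "\<bar>X w \<bullet> Z w\<bar> \<le> norm (X w) * norm (Z w)" by (rule Cauchy_Schwarz_ineq2)
    also have "\<dots> \<le> (norm (X w))^2 + (norm (Z w))^2"
      by (rule mult_le_sum_squares)
    finally show "norm (X w \<bullet> Z w) \<le> norm ((norm (X w))^2 + (norm (Z w))^2)" by simp
  qed
qed simp

text \<open>The rule that removes the noise from the cross term: a factor known from the past comes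
  out of the inner product, coordinate by coordinate.\<close>

lemma real_cond_exp_inner:
  fixes X Z :: "'a \<Rightarrow> 'b::euclidean_space"
  assumes Y: "has_cond_exp M F X Y" and Z: "Z \<in> borel_measurable F"
    and sq: "integrable M (\<lambda>w. (norm (X w))^2)" "integrable M (\<lambda>w. (norm (Z w))^2)"
  shows "AE w in M. real_cond_exp M F (\<lambda>w. X w \<bullet> Z w) w = Y w \<bullet> Z w"
proof -
  have [measurable]: "X \<in> borel_measurable M" "Z \<in> borel_measurable M"
    using Y measurable_from_subalg[OF subalg Z] by (auto simp: has_cond_exp_def)
  have int: "integrable M (\<lambda>w. (Z w \<bullet> b) * (X w \<bullet> b))" for b
  proof (rule Bochner_Integration.integrable_bound)
    show "integrable M (\<lambda>w. (norm b)^2 * ((norm (X w))^2 + (norm (Z w))^2))" using sq by simp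
    show "AE w in M. norm ((Z w \<bullet> b) * (X w \<bullet> b)) \<le> norm ((norm b)^2 * ((norm (X w))^2 + (norm (Z w))^2))"
    proof (rule AE_I2)
      fix w
      have "\<bar>(Z w \<bullet> b) * (X w \<bullet> b)\<bar> \<le> (norm (Z w) * norm b) * (norm (X w) * norm b)"
        unfolding abs_mult by (intro mult_mono Cauchy_Schwarz_ineq2) auto
      also have "\<dots> = (norm b)^2 * (norm (X w) * norm (Z w))" by (simp add: power2_eq_square)
      also have "\<dots> \<le> (norm b)^2 * ((norm (X w))^2 + (norm (Z w))^2)"
        by (intro mult_left_mono mult_le_sum_squares) auto
      finally show "norm ((Z w \<bullet> b) * (X w \<bullet> b)) \<le> norm ((norm b)^2 * ((norm (X w))^2 + (norm (Z w))^2))"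
        by (simp add: abs_mult)
    qed
  qed simp
  have "(\<lambda>w. X w \<bullet> Z w) = (\<lambda>w. \<Sum>b\<in>Basis. (Z w \<bullet> b) * (X w \<bullet> b))"
    by (subst euclidean_inner) (simp add: mult.commute)
  then have "AE w in M. real_cond_exp M F (\<lambda>w. X w \<bullet> Z w) w
      = (\<Sum>b\<in>Basis. real_cond_exp M F (\<lambda>w. (Z w \<bullet> b) * (X w \<bullet> b)) w)"
    using real_cond_exp_sum[where f = "\<lambda>b w. (Z w \<bullet> b) * (X w \<bullet> b)" and I = Basis, OF int] by simp
  moreover have "AE w in M. \<forall>b\<in>Basis. real_cond_exp M F (\<lambda>w. (Z w \<bullet> b) * (X w \<bullet> b)) w = (Z w \<bullet> b) * (Y w \<bullet> b)"
  proof (rule AE_finite_allI)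
    fix b :: 'b
    have "AE w in M. real_cond_exp M F (\<lambda>w. (Z w \<bullet> b) * (X w \<bullet> b)) w
        = (Z w \<bullet> b) * real_cond_exp M F (\<lambda>w. X w \<bullet> b) w"
      using Z by (intro real_cond_exp_mult int) auto
    with real_cond_exp_inner_const[OF Y, of b]
    show "AE w in M. real_cond_exp M F (\<lambda>w. (Z w \<bullet> b) * (X w \<bullet> b)) w = (Z w \<bullet> b) * (Y w \<bullet> b)"
      by eventually_elim simp
  qed simp
  ultimately show ?thesis
  proof eventually_elim
    case (elim w)
    have "Y w \<bullet> Z w = (\<Sum>b\<in>Basis. (Z w \<bullet> b) * (Y w \<bullet> b))"
      by (subst euclidean_inner) (simp add: mult.commute)
    with elim show ?case by simp
  qed
qed

text \<open>Jensen's inequality for the square in each coordinate.\<close>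

lemma has_cond_exp_square_integrable:
  fixes X :: "'a \<Rightarrow> 'b::euclidean_space"
  assumes Y: "has_cond_exp M F X Y" and sq: "integrable M (\<lambda>w. (norm (X w))^2)"
  shows "integrable M (\<lambda>w. (norm (Y w))^2)"
proof -
  have X: "integrable M X" and [measurable]: "Y \<in> borel_measurable M"
    using Y by (auto simp: has_cond_exp_def)
  have "integrable M (\<lambda>w. (Y w \<bullet> b)^2)" if b: "b \<in> Basis" for b
  proof -
    have "integrable M (\<lambda>w. (X w \<bullet> b)^2)"
    proof (rule Bochner_Integration.integrable_bound[OF sq])
      show "AE w in M. norm ((X w \<bullet> b)^2) \<le> norm ((norm (X w))^2)"
        using Basis_le_norm[OF b] by (intro AE_I2) (auto intro: abs_le_square_iff[THEN iffD1])
    qed (use X in auto)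
    then have "integrable M (\<lambda>w. (real_cond_exp M F (\<lambda>w. X w \<bullet> b) w)^2)"
      using X by (intro integrable_convex_cond_exp[where I = UNIV] convex_power2) auto
    then show ?thesis
      by (rule integrable_cong_AE_imp)
         (use real_cond_exp_inner_const[OF Y, of b] in \<open>auto elim!: eventually_mono\<close>)
  qed
  then have "integrable M (\<lambda>w. \<Sum>b\<in>Basis. (Y w \<bullet> b)^2)" by auto
  moreover have "(norm (Y w))^2 = (\<Sum>b\<in>Basis. (Y w \<bullet> b)^2)" for w
    unfolding power2_norm_eq_inner by (subst euclidean_inner) (simp add: power2_eq_square)
  ultimately show ?thesis by simp
qed

end

section \<open>The primal-dual operator\<close>

text \<open>\<open>g_conj\<close> is kept as an assumption here; it is discharged at the end from
  the subgradients provided by the inclusion.\<close>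

locale primal_dual_splitting =
  fixes f :: "'h::euclidean_space \<Rightarrow> ereal"
    and h :: "'h \<Rightarrow> real"
    and grad_h :: "'h \<Rightarrow> 'h"
    and G :: "'q::finite \<Rightarrow> 'g::euclidean_space set"
    and g :: "'q \<Rightarrow> 'g \<Rightarrow> ereal"
    and L :: "'q \<Rightarrow> 'h \<Rightarrow> 'g"
    and \<mu> \<rho> :: real
    and \<sigma> :: "'q \<Rightarrow> real"
  assumes f: "f \<in> Gamma0 UNIV"
    and \<mu>: "0 < \<mu>"
    and h_convex: "convex_on UNIV h"
    and h_grad: "\<And>z. GDERIV h z :> grad_h z"
    and h_lipschitz: "(1 / \<mu>)-lipschitz_on UNIV grad_h"
    and G: "\<And>k. subspace (G k)"
    and g: "\<And>k. g k \<in> Gamma0 (G k)"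
    and g_conj: "\<And>k. fenchel_conjugate (G k) (g k) \<in> Gamma0 (G k)"
    and L_linear: "\<And>k. linear (L k)"
    and L_range: "\<And>k z. L k z \<in> G k"
    and \<rho>: "0 < \<rho>"
    and \<sigma>: "\<And>k. 0 < \<sigma> k"
    and steps: "(1 / \<rho> - (\<Sum>k\<in>UNIV. \<sigma> k * (onorm (L k))^2)) * \<mu> > 1 / 2"
begin

abbreviation Ladj :: "'g ^ 'q \<Rightarrow> 'h" where
  "Ladj v \<equiv> \<Sum>k\<in>UNIV. adjoint (L k) (v $ k)"

abbreviation gc :: "'q \<Rightarrow> 'g \<Rightarrow> ereal" where
  "gc k \<equiv> fenchel_conjugate (G k) (g k)"

definition feasible :: "('h \<times> ('g ^ 'q)) set" where
  "feasible = UNIV \<times> hilbert_sum G"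

text \<open>The coercivity constant of \<open>Q\<close> in the primal variable, obtained by
  minimising over the dual ones; see \<open>Q_ge_primal\<close>.\<close>

definition \<kappa> :: real where
  "\<kappa> = 1 / \<rho> - (\<Sum>k\<in>UNIV. \<sigma> k * (onorm (L k))^2)"

text \<open>The fraction of the decrease that survives: the backward step gains \<open>Q\<close> of
  the displacement once, and the gradient term consumes the fraction 1 / (2 \<mu> \<kappa>) of it.
  It is positive by \<open>steps\<close>.\<close>

definition \<theta> :: real where
  "\<theta> = 1 - 1 / (2 * \<mu> * \<kappa>)"

text \<open>In the renormed product space with this inner product the algorithm is a forward-backward
  splitting whose forward operator is cocoercive with constant \<open>\<mu> * \<kappa> > 1/2\<close>.\<close>

definition B :: "'h \<times> ('g ^ 'q) \<Rightarrow> 'h \<times> ('g ^ 'q) \<Rightarrow> real" where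
  "B z z' = fst z \<bullet> fst z' / \<rho> - (\<Sum>k\<in>UNIV. L k (fst z) \<bullet> snd z' $ k)
     - (\<Sum>k\<in>UNIV. L k (fst z') \<bullet> snd z $ k) + (\<Sum>k\<in>UNIV. snd z $ k \<bullet> snd z' $ k / \<sigma> k)"

definition Q :: "'h \<times> ('g ^ 'q) \<Rightarrow> real" where
  "Q z = B z z"

text \<open>The argument \<open>u\<close> stands for whatever replaces the gradient: the random
  estimate in the algorithm, the exact gradient in \<open>T\<close>.\<close>

definition primal_step :: "'h \<times> ('g ^ 'q) \<Rightarrow> 'h \<Rightarrow> 'h" where
  "primal_step z u = prox UNIV \<rho> f (fst z - \<rho> *\<^sub>R (Ladj (snd z) + u))"

abbreviation dual_step :: "'h \<times> ('g ^ 'q) \<Rightarrow> 'h \<Rightarrow> 'q \<Rightarrow> 'g" where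
  "dual_step z y k \<equiv> prox (G k) (\<sigma> k) (gc k) (snd z $ k + \<sigma> k *\<^sub>R L k (2 *\<^sub>R y - fst z))"

definition step :: "'h \<times> ('g ^ 'q) \<Rightarrow> 'h \<Rightarrow> 'h \<times> ('g ^ 'q)" where
  "step z u = (primal_step z u,
     \<chi> k. dual_step z (primal_step z u) k)"

definition T :: "'h \<times> ('g ^ 'q) \<Rightarrow> 'h \<times> ('g ^ 'q)" where
  "T z = step z (grad_h (fst z))"

section \<open>Geometry of the renormed product space\<close>

lemma fst_step [simp]: "fst (step z u) = primal_step z u"
  and snd_step [simp]: "snd (step z u) $ k =
    dual_step z (primal_step z u) k"
  by (simp_all add: step_def)

lemma L_bounded_linear: "bounded_linear (L k)"
  using L_linear linear_conv_bounded_linear by blast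

lemma inner_Ladj: "x \<bullet> Ladj v = (\<Sum>k\<in>UNIV. L k x \<bullet> v $ k)"
  by (simp add: inner_sum_right adjoint_works[OF L_linear])

lemma linear_Ladj: "linear Ladj"
  by (rule linearI) (simp_all add: linear_add[OF adjoint_linear[OF L_linear]]
      linear_scale[OF adjoint_linear[OF L_linear]] sum.distrib scaleR_sum_right)

lemma subspace_hilbert_sum: "subspace (hilbert_sum G)"
  using G by (auto simp: hilbert_sum_def subspace_def)

lemma subspace_feasible: "subspace feasible"
  unfolding feasible_def by (intro subspace_Times subspace_UNIV subspace_hilbert_sum)

lemma snd_feasible: "z \<in> feasible \<Longrightarrow> snd z $ k \<in> G k"
  by (auto simp: feasible_def hilbert_sum_def)

lemma dual_arg_in: "z \<in> feasible \<Longrightarrow> snd z $ k + \<sigma> k *\<^sub>R L k x \<in> G k"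
  using snd_feasible L_range G by (simp add: subspace_add subspace_scale)

lemma \<kappa>_pos: "0 < \<kappa>"
proof (rule ccontr)
  assume "\<not> 0 < \<kappa>"
  then have "\<kappa> * \<mu> \<le> 0" using \<mu> by (simp add: mult_nonpos_nonneg)
  then show False using steps by (simp add: \<kappa>_def)
qed

lemma \<theta>_pos: "0 < \<theta>" and \<theta>_le_1: "\<theta> \<le> 1"
  using steps \<mu> \<kappa>_pos by (auto simp: \<theta>_def \<kappa>_def[symmetric] field_simps)

lemma bilinear_B: "bilinear B"
  unfolding bilinear_def
proof (intro conjI allI linearI)
  fix x y z c
  note l = linear_add[OF L_linear] linear_scale[OF L_linear] inner_add_left inner_add_right
      add_divide_distrib sum.distrib sum_distrib_left right_diff_distrib distrib_left
  show "B x (y + z) = B x y + B x z" "B (x + y) z = B x z + B y z" by (simp_all add: B_def l)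
  show "B x (c *\<^sub>R y) = c *\<^sub>R B x y" "B (c *\<^sub>R x) y = c *\<^sub>R B x y" by (simp_all add: B_def l)
qed

lemma B_sym: "B x y = B y x"
  by (simp add: B_def inner_commute)

lemma Q_add: "Q (x + y) = Q x + 2 * B x y + Q y"
  using B_sym[of x y] by (simp add: Q_def bilinear_ladd[OF bilinear_B] bilinear_radd[OF bilinear_B])

lemma Q_diff: "Q (x - y) = Q x - 2 * B x y + Q y"
  using B_sym[of x y] by (simp add: Q_def bilinear_lsub[OF bilinear_B] bilinear_rsub[OF bilinear_B])

lemma Q_scale: "Q (c *\<^sub>R x) = c^2 * Q x"
  by (simp add: Q_def bilinear_lmul[OF bilinear_B] bilinear_rmul[OF bilinear_B] power2_eq_square)

lemma Q_0 [simp]: "Q 0 = 0"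
  using Q_scale[of 0 0] by simp

lemma Q_minus: "Q (- x) = Q x"
  using Q_scale[of "-1" x] by simp

lemma Q_minus_commute: "Q (x - y) = Q (y - x)"
  using Q_minus[of "x - y"] by simp

text \<open>Completing the square in each dual variable: \<open>Q z\<close> is a sum of the squares
  of \<open>snd z $ k - \<sigma> k *\<^sub>R L k (fst z)\<close>, divided by
  \<open>\<sigma> k\<close>, plus a form in \<open>fst z\<close> that is bounded below through the
  operator norms.\<close>

lemma Q_ge_primal: "\<kappa> * (norm (fst z))^2 \<le> Q z"
proof -
  have "0 \<le> (\<Sum>k\<in>UNIV. (norm (snd z $ k - \<sigma> k *\<^sub>R L k (fst z)))^2 / \<sigma> k)"
    using \<sigma> by (intro sum_nonneg) (simp add: less_imp_le)
  also have "\<dots> = (\<Sum>k\<in>UNIV. snd z $ k \<bullet> snd z $ k / \<sigma> k - 2 * (L k (fst z) \<bullet> snd z $ k)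
      + \<sigma> k * (norm (L k (fst z)))^2)"
  proof (rule sum.cong[OF refl])
    fix k
    show "(norm (snd z $ k - \<sigma> k *\<^sub>R L k (fst z)))^2 / \<sigma> k = snd z $ k \<bullet> snd z $ k / \<sigma> k
        - 2 * (L k (fst z) \<bullet> snd z $ k) + \<sigma> k * (norm (L k (fst z)))^2"
      using \<sigma>[of k] unfolding power2_norm_eq_inner
      by (simp add: inner_diff_left inner_diff_right inner_commute field_simps power2_eq_square)
  qed
  also have "\<dots> = (\<Sum>k\<in>UNIV. snd z $ k \<bullet> snd z $ k / \<sigma> k) - 2 * (\<Sum>k\<in>UNIV. L k (fst z) \<bullet> snd z $ k)
      + (\<Sum>k\<in>UNIV. \<sigma> k * (norm (L k (fst z)))^2)"
    by (simp add: sum.distrib sum_subtractf sum_distrib_left)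
  also have "(\<Sum>k\<in>UNIV. \<sigma> k * (norm (L k (fst z)))^2)
      \<le> (\<Sum>k\<in>UNIV. \<sigma> k * (onorm (L k))^2) * (norm (fst z))^2"
    unfolding sum_distrib_right
  proof (rule sum_mono)
    fix k
    have "(norm (L k (fst z)))^2 \<le> (onorm (L k) * norm (fst z))^2"
      by (intro power_mono onorm[OF L_bounded_linear]) auto
    then show "\<sigma> k * (norm (L k (fst z)))^2 \<le> \<sigma> k * (onorm (L k))^2 * (norm (fst z))^2"
      using \<sigma>[of k] by (simp add: power_mult_distrib)
  qed
  finally show ?thesis
    by (simp add: Q_def B_def \<kappa>_def left_diff_distrib power2_norm_eq_inner)
qed

lemma Q_nonneg: "0 \<le> Q z"
  using Q_ge_primal[of z] \<kappa>_pos by (meson mult_nonneg_nonneg order_trans less_imp_le zero_le_power2)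

lemma Q_Young:
  assumes "0 < \<delta>"
  shows "Q (x + y) \<le> (1 + \<delta>) * Q x + (1 + 1 / \<delta>) * Q y"
proof -
  have "0 \<le> Q (\<delta> *\<^sub>R x - y)" by (rule Q_nonneg)
  also have "\<dots> = \<delta>^2 * Q x - 2 * \<delta> * B x y + Q y"
    by (simp only: Q_diff Q_scale bilinear_lmul[OF bilinear_B]) simp
  finally have "2 * B x y \<le> \<delta> * Q x + 1 / \<delta> * Q y"
    using assms by (simp add: field_simps power2_eq_square)
  then show ?thesis by (simp add: Q_add algebra_simps)
qed

lemma Q_add_le: "Q (x + y) \<le> 2 * Q x + 2 * Q y"
  using Q_Young[of 1 x y] by simp

lemma Q_pos: "z \<noteq> 0 \<Longrightarrow> 0 < Q z"
proof (rule ccontr)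
  assume z: "z \<noteq> 0" "\<not> 0 < Q z"
  then have Q: "Q z = 0" using Q_nonneg[of z] by simp
  then have "\<kappa> * (norm (fst z))^2 \<le> 0" using Q_ge_primal[of z] by simp
  then have x: "fst z = 0" using \<kappa>_pos by (simp add: mult_le_0_iff)
  then have "(\<Sum>k\<in>UNIV. snd z $ k \<bullet> snd z $ k / \<sigma> k) = 0"
    using Q by (simp add: Q_def B_def linear_0[OF L_linear])
  then have "\<forall>k. snd z $ k \<bullet> snd z $ k / \<sigma> k = 0"
    using \<sigma> by (subst (asm) sum_nonneg_eq_0_iff) (auto simp: less_imp_le)
  moreover have "\<sigma> k \<noteq> 0" for k using \<sigma>[of k] by simp
  ultimately have "snd z = 0" by (simp add: vec_eq_iff)
  with x z(1) show False by (simp add: prod_eq_iff)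
qed

lemma continuous_on_Q: "continuous_on A Q"
proof -
  have "bounded_bilinear B" by (simp add: bilinear_B flip: bilinear_conv_bounded_bilinear)
  from bounded_bilinear.continuous_on[OF this continuous_on_id continuous_on_id]
  show ?thesis by (simp add: Q_def[abs_def])
qed

text \<open>Positive definiteness becomes uniform by compactness of the unit sphere and homogeneity,
  so no explicit constant is computed.\<close>

lemma Q_coercive: "\<exists>m>0. \<forall>z. m * (norm z)^2 \<le> Q z"
proof -
  obtain b :: "'h \<times> ('g ^ 'q)" where "norm b = 1" by (rule vector_choose_size[of 1]) simp
  then have "sphere (0 :: 'h \<times> ('g ^ 'q)) 1 \<noteq> {}" by auto
  then obtain s where s: "s \<in> sphere 0 1" "\<And>z. z \<in> sphere 0 1 \<Longrightarrow> Q s \<le> Q z"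
    using continuous_attains_inf[OF compact_sphere _ continuous_on_Q] by blast
  have "s \<noteq> 0" using s(1) by auto
  then have "0 < Q s" by (rule Q_pos)
  moreover have "Q s * (norm z)^2 \<le> Q z" for z
  proof (cases "z = 0")
    case False
    then have "Q s \<le> Q ((1 / norm z) *\<^sub>R z)" by (intro s) auto
    then show ?thesis using False by (simp add: Q_scale field_simps)
  qed simp
  ultimately show ?thesis by blast
qed

lemma Q_bounded: "\<exists>C>0. \<forall>z. Q z \<le> C * (norm z)^2"
  using bilinear_bounded_pos[OF bilinear_B] unfolding Q_def power2_eq_square
  by (metis abs_le_D1 mult.assoc real_norm_def)

text \<open>Monotonicity of the set-valued operator behind the backward step, in the metric
  \<open>B\<close>, for two different forward inputs. The inequalities for \<open>f\<close> and for
  the conjugates are added; the terms with \<open>L\<close> that remain are exactly the off-diagonal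
  part of \<open>B\<close>.\<close>

lemma step_monotone:
  assumes z: "z \<in> feasible" "z' \<in> feasible"
  shows "(u - u') \<bullet> (fst (step z u) - fst (step z' u'))
    \<le> B ((z - z') - (step z u - step z' u')) (step z u - step z' u')"
proof -
  define p where "p = primal_step z u"
  define p' where "p' = primal_step z' u'"
  define q where "q k = snd (step z u) $ k" for k
  define q' where "q' k = snd (step z' u') $ k" for k
  let ?a = "\<lambda>z u p. (1 / \<rho>) *\<^sub>R (fst z - \<rho> *\<^sub>R (Ladj (snd z) + u) - p)"
  let ?b = "\<lambda>z p q k. (1 / \<sigma> k) *\<^sub>R (snd z $ k + \<sigma> k *\<^sub>R L k (2 *\<^sub>R p - fst z) - q k)"
  have "0 \<le> (p - p') \<bullet> (?a z u p - ?a z' u' p')"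
    unfolding p_def p'_def primal_step_def
    by (intro subdifferential_monotone[OF f] prox_subdifferential[OF f]) (auto simp: \<rho>)
  also have "?a z u p - ?a z' u' p' = (1 / \<rho>) *\<^sub>R ((fst z - fst z') - (p - p'))
      - (Ladj (snd z) - Ladj (snd z')) - (u - u')"
    using \<rho> by (simp add: algebra_simps)
  finally have 1: "(u - u') \<bullet> (p - p') \<le> ((fst z - fst z') - (p - p')) \<bullet> (p - p') / \<rho>
      - (\<Sum>k\<in>UNIV. L k (p - p') \<bullet> (snd z - snd z') $ k)"
    by (simp add: inner_diff_right inner_Ladj sum_subtractf inner_commute)
  have "0 \<le> (q k - q' k) \<bullet> (?b z p q k - ?b z' p' q' k)" for k
    unfolding q_def q'_def snd_step p_def p'_def
    by (intro subdifferential_monotone[OF g_conj[of k]] prox_subdifferential[OF g_conj[of k] G[of k] \<sigma>[of k]]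
        prox_in_space[OF g_conj[of k] G[of k] \<sigma>[of k]] dual_arg_in z)
  \<comment> \<open>This is where the extrapolation matters: \<open>2 p - x\<close> is
    \<open>p\<close> minus \<open>x - p\<close>. The \<open>p\<close> part combines with the adjoint
    term of the primal inequality, and the \<open>x - p\<close> part supplies the second
    off-diagonal block that makes \<open>B\<close> symmetric.\<close>
  moreover have "?b z p q k - ?b z' p' q' k = (1 / \<sigma> k) *\<^sub>R ((snd z - snd z') $ k - (q k - q' k))
      - L k ((fst z - fst z') - (p - p')) + L k (p - p')" for k
    using \<sigma>[of k] by (simp add: algebra_simps linear_diff[OF L_linear] linear_add[OF L_linear] scaleR_2)
  ultimately have "0 \<le> ((snd z - snd z') $ k - (q k - q' k)) \<bullet> (q k - q' k) / \<sigma> k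
      - L k ((fst z - fst z') - (p - p')) \<bullet> (q k - q' k) + L k (p - p') \<bullet> (q k - q' k)" for k
    by (simp add: inner_diff_right inner_add_right inner_commute)
  then have "0 \<le> (\<Sum>k\<in>UNIV. ((snd z - snd z') $ k - (q k - q' k)) \<bullet> (q k - q' k) / \<sigma> k
      - L k ((fst z - fst z') - (p - p')) \<bullet> (q k - q' k) + L k (p - p') \<bullet> (q k - q' k))"
    by (intro sum_nonneg) auto
  then have 2: "0 \<le> (\<Sum>k\<in>UNIV. ((snd z - snd z') $ k - (q k - q' k)) \<bullet> (q k - q' k) / \<sigma> k)
      - (\<Sum>k\<in>UNIV. L k ((fst z - fst z') - (p - p')) \<bullet> (q k - q' k)) + (\<Sum>k\<in>UNIV. L k (p - p') \<bullet> (q k - q' k))"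
    by (simp only: sum.distrib sum_subtractf)
  have 3: "(\<Sum>k\<in>UNIV. L k (p - p') \<bullet> ((snd z - snd z') $ k - (q k - q' k)))
     = (\<Sum>k\<in>UNIV. L k (p - p') \<bullet> (snd z - snd z') $ k) - (\<Sum>k\<in>UNIV. L k (p - p') \<bullet> (q k - q' k))"
    by (simp only: inner_diff_right sum_subtractf)
  have "B ((z - z') - (step z u - step z' u')) (step z u - step z' u')
      = ((fst z - fst z') - (p - p')) \<bullet> (p - p') / \<rho> - (\<Sum>k\<in>UNIV. L k ((fst z - fst z') - (p - p')) \<bullet> (q k - q' k))
      - (\<Sum>k\<in>UNIV. L k (p - p') \<bullet> ((snd z - snd z') $ k - (q k - q' k)))
      + (\<Sum>k\<in>UNIV. ((snd z - snd z') $ k - (q k - q' k)) \<bullet> (q k - q' k) / \<sigma> k)"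
    by (simp only: B_def fst_diff snd_diff vector_minus_component q_def q'_def p_def p'_def fst_step)
  then show ?thesis
    using 1 2 3 unfolding fst_step p_def[symmetric] p'_def[symmetric] by linarith
qed

text \<open>With both base points equal, \<open>step_monotone\<close> bounds \<open>Q\<close> of the
  difference by the inner product of \<open>u - u'\<close> with its primal part, and
  \<open>Q_ge_primal\<close> absorbs that part. The dual change is thus controlled with no constant
  of its own.\<close>

lemma step_perturbation:
  assumes z: "z \<in> feasible"
  shows "norm (primal_step z u - primal_step z u') \<le> norm (u - u') / \<kappa>"
    and "Q (step z u - step z u') \<le> (norm (u - u'))^2 / \<kappa>"
proof -
  let ?r = "step z u - step z u'"
  have "(u - u') \<bullet> (fst ?r) \<le> B (- ?r) ?r"
    using step_monotone[OF z z, of u u'] by (simp only: diff_self diff_0 fst_diff)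
  moreover have "B (- ?r) ?r = - Q ?r" by (simp only: Q_def bilinear_lneg[OF bilinear_B])
  ultimately have 1: "Q ?r \<le> - ((u - u') \<bullet> fst ?r)" by linarith
  have "- ((u - u') \<bullet> fst ?r) \<le> norm (u - u') * norm (fst ?r)"
    using Cauchy_Schwarz_ineq2[of "u - u'" "fst ?r"] by linarith
  with 1 have 2: "Q ?r \<le> norm (u - u') * norm (fst ?r)" by linarith
  have "\<kappa> * norm (fst ?r) * norm (fst ?r) \<le> norm (u - u') * norm (fst ?r)"
    using 2 Q_ge_primal[of ?r] by (simp add: power2_eq_square mult.assoc)
  then have "\<kappa> * norm (fst ?r) \<le> norm (u - u')"
    by (cases "norm (fst ?r) = 0") (auto simp: mult_le_cancel_right)
  then have 3: "norm (fst ?r) \<le> norm (u - u') / \<kappa>"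
    using \<kappa>_pos by (simp add: field_simps)
  then show "norm (primal_step z u - primal_step z u') \<le> norm (u - u') / \<kappa>" by simp
  have "norm (u - u') * norm (fst ?r) \<le> norm (u - u') * (norm (u - u') / \<kappa>)"
    using 3 by (intro mult_left_mono) auto
  with 2 show "Q ?r \<le> (norm (u - u'))^2 / \<kappa>" by (simp add: power2_eq_square)
qed

text \<open>The cross term pairs the error with \<open>fst (T z) - fst p\<close>, a quantity free of
  \<open>u\<close>; replacing \<open>fst (step z u)\<close> by \<open>fst (T z)\<close> costs a
  second-order term only, by \<open>step_perturbation\<close>. Of the constant 3 / \<kappa>, two
  parts come from this replacement and one from passing to \<open>Q (z - T z)\<close>.\<close>

lemma step_Fejer:
  assumes z: "z \<in> feasible" and p: "p \<in> feasible" "T p = p"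
  shows "Q (step z u - p) \<le> Q (z - p) - \<theta> / 2 * Q (z - T z)
     - 2 * ((u - grad_h (fst z)) \<bullet> (fst (T z) - fst p)) + 3 / \<kappa> * (norm (u - grad_h (fst z)))^2"
proof -
  define r where "r = step z u"
  define e where "e = u - grad_h (fst z)"
  define \<Delta> where "\<Delta> = grad_h (fst z) - grad_h (fst p)"
  have rp: "step p (grad_h (fst p)) = p" using p(2) by (simp add: T_def)
  have "(u - grad_h (fst p)) \<bullet> (fst r - fst p) \<le> B (z - r) (r - p)"
    using step_monotone[OF z p(1), of u "grad_h (fst p)"] by (simp add: rp r_def)
  moreover have "Q (z - p) = Q (z - r) + 2 * B (z - r) (r - p) + Q (r - p)"
    using Q_add[of "z - r" "r - p"] by simp
  ultimately have 1: "Q (r - p) \<le> Q (z - p) - Q (z - r) - 2 * ((u - grad_h (fst p)) \<bullet> (fst r - fst p))"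
    by linarith
  have 2: "(u - grad_h (fst p)) \<bullet> (fst r - fst p) = e \<bullet> (fst (T z) - fst p) + e \<bullet> (fst r - fst (T z))
      + \<Delta> \<bullet> (fst z - fst p) - \<Delta> \<bullet> (fst z - fst r)"
    by (simp add: e_def \<Delta>_def algebra_simps)
  have 3: "\<mu> * (norm \<Delta>)^2 \<le> \<Delta> \<bullet> (fst z - fst p)"
    using Baillon_Haddad[OF h_convex h_grad \<mu> h_lipschitz, of "fst z" "fst p"]
    by (simp add: \<Delta>_def inner_commute)
  \<comment> \<open>The Young weight \<open>2 * \<mu>\<close> is chosen so that the square of
    \<open>\<Delta>\<close> is paid exactly by cocoercivity in step 3; the other square is at most
    \<open>(1 - \<theta>) * Q (z - r)\<close>.\<close>
  have 4: "2 * (\<Delta> \<bullet> (fst z - fst r)) \<le> 2 * \<mu> * (norm \<Delta>)^2 + (1 - \<theta>) * Q (z - r)"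
  proof -
    have "0 \<le> (norm ((2 * \<mu>) *\<^sub>R \<Delta> - (fst z - fst r)))^2" by simp
    also have "\<dots> = (2 * \<mu>)^2 * (norm \<Delta>)^2 - 2 * (2 * \<mu>) * (\<Delta> \<bullet> (fst z - fst r)) + (norm (fst z - fst r))^2"
      unfolding power2_norm_eq_inner
      by (simp add: inner_diff_left inner_diff_right inner_commute algebra_simps power2_eq_square)
    finally have "2 * (\<Delta> \<bullet> (fst z - fst r)) \<le> 2 * \<mu> * (norm \<Delta>)^2 + (norm (fst z - fst r))^2 / (2 * \<mu>)"
      using \<mu> by (simp add: field_simps power2_eq_square)
    also have "(norm (fst z - fst r))^2 / (2 * \<mu>) \<le> Q (z - r) / \<kappa> / (2 * \<mu>)"
      using Q_ge_primal[of "z - r"] \<kappa>_pos \<mu> by (intro divide_right_mono) (auto simp: field_simps)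
    finally show ?thesis by (simp add: \<theta>_def mult_ac)
  qed
  have 5: "- (e \<bullet> (fst r - fst (T z))) \<le> (norm e)^2 / \<kappa>"
  proof -
    have "- (e \<bullet> (fst r - fst (T z))) \<le> norm e * norm (fst r - fst (T z))"
      using Cauchy_Schwarz_ineq2[of e "fst r - fst (T z)"] by linarith
    also have "\<dots> \<le> norm e * (norm e / \<kappa>)"
      using step_perturbation(1)[OF z, of u "grad_h (fst z)"]
      by (intro mult_left_mono) (auto simp: r_def T_def e_def)
    finally show ?thesis by (simp add: power2_eq_square)
  qed
  \<comment> \<open>The decrease must be stated for \<open>T z\<close>, since \<open>r\<close>
    depends on the estimate \<open>u\<close>. The factor 2 of this change is the origin of
    \<open>\<theta> / 2\<close>.\<close>
  have 6: "Q (z - T z) \<le> 2 * Q (z - r) + 2 * ((norm e)^2 / \<kappa>)"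
  proof -
    have "Q (z - T z) = Q ((z - r) + (r - T z))" by simp
    also have "\<dots> \<le> 2 * Q (z - r) + 2 * Q (r - T z)"
      by (rule Q_add_le)
    finally show ?thesis
      using step_perturbation(2)[OF z, of u "grad_h (fst z)"] by (simp add: r_def T_def e_def)
  qed
  have "\<theta> / 2 * Q (z - T z) \<le> \<theta> / 2 * (2 * Q (z - r) + 2 * ((norm e)^2 / \<kappa>))"
    using 6 \<theta>_pos by (intro mult_left_mono) auto
  also have "\<dots> = \<theta> * Q (z - r) + \<theta> * ((norm e)^2 / \<kappa>)" by (simp add: algebra_simps)
  also have "\<theta> * ((norm e)^2 / \<kappa>) \<le> 1 * ((norm e)^2 / \<kappa>)"
    using \<theta>_le_1 \<kappa>_pos by (intro mult_right_mono) auto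
  finally have 7: "\<theta> / 2 * Q (z - T z) \<le> \<theta> * Q (z - r) + (norm e)^2 / \<kappa>" by simp
  have "(1 - \<theta>) * Q (z - r) = Q (z - r) - \<theta> * Q (z - r)" by (simp add: algebra_simps)
  moreover have "3 / \<kappa> * (norm e)^2 = 3 * ((norm e)^2 / \<kappa>)" by simp
  ultimately show ?thesis
    using 1 2 3 4 5 7 unfolding r_def[symmetric] e_def[symmetric] by argo
qed

lemma T_Fejer:
  assumes "z \<in> feasible" and "p \<in> feasible" "T p = p"
  shows "Q (T z - p) \<le> Q (z - p)"
proof -
  have "0 \<le> \<theta> / 2 * Q (z - T z)" using \<theta>_pos Q_nonneg by simp
  then show ?thesis
    using step_Fejer[OF assms, of "grad_h (fst z)"] by (simp add: T_def[of z, symmetric])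
qed

lemma closed_feasible: "closed feasible"
  by (intro closed_subspace subspace_feasible)

lemma continuous_on_grad_h: "continuous_on A grad_h"
  using lipschitz_on_continuous_on[OF h_lipschitz] continuous_on_subset by blast

lemma continuous_on_step: "continuous_on (feasible \<times> UNIV) (\<lambda>(z, u). step z u)"
proof -
  have cL: "continuous_on A (\<lambda>x. L k (a x))" if "continuous_on A a" for A and a :: "'z::topological_space \<Rightarrow> 'h" and k
    using bounded_linear.continuous_on[OF L_bounded_linear that] .
  have cLadj: "continuous_on A (\<lambda>x. Ladj (a x))" if "continuous_on A a" for A and a :: "'z::topological_space \<Rightarrow> 'g ^ 'q"
    using bounded_linear.continuous_on[OF _ that] linear_Ladj by (simp add: linear_conv_bounded_linear)
  have P: "continuous_on (feasible \<times> UNIV) (\<lambda>x. primal_step (fst x) (snd x))"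
    unfolding primal_step_def
    by (rule continuous_on_compose2[OF continuous_on_prox[OF f subspace_UNIV \<rho>]])
       (intro continuous_intros cLadj, auto)
  have "continuous_on (feasible \<times> UNIV)
     (\<lambda>x. prox (G k) (\<sigma> k) (gc k) (snd (fst x) $ k + \<sigma> k *\<^sub>R L k (2 *\<^sub>R primal_step (fst x) (snd x) - fst (fst x))))" for k
    by (rule continuous_on_compose2[OF continuous_on_prox[OF g_conj G \<sigma>]])
       (intro continuous_intros cL P, auto intro: dual_arg_in)
  then show ?thesis
    unfolding step_def case_prod_beta by (intro continuous_on_Pair continuous_on_vec_lambda P)
qed

lemma continuous_on_T: "continuous_on feasible T"
proof -
  have "continuous_on feasible (\<lambda>z. (\<lambda>(z, u). step z u) (z, grad_h (fst z)))"
    by (rule continuous_on_compose2[OF continuous_on_step])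
       (intro continuous_intros continuous_on_compose2[OF continuous_on_grad_h], auto)
  then show ?thesis by (simp add: T_def[abs_def])
qed

section \<open>Fixed points as solutions of the primal and dual problems\<close>

lemma fixed_point_imp:
  assumes z: "z \<in> feasible" "T z = z"
  shows "- (Ladj (snd z) + grad_h (fst z)) \<in> subdifferential UNIV f (fst z)"
    and "L k (fst z) \<in> subdifferential (G k) (gc k) (snd z $ k)"
proof -
  have p: "primal_step z (grad_h (fst z)) = fst z"
    using z(2) by (metis T_def fst_step)
  have q: "dual_step z (fst z) k = snd z $ k"
    using z(2) by (metis T_def snd_step p)
  have "(1 / \<rho>) *\<^sub>R (fst z - \<rho> *\<^sub>R (Ladj (snd z) + grad_h (fst z)) - fst z) \<in> subdifferential UNIV f (fst z)"
    using prox_subdifferential[OF f subspace_UNIV \<rho>, of "fst z - \<rho> *\<^sub>R (Ladj (snd z) + grad_h (fst z))"]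
    by (simp only: p[unfolded primal_step_def]) simp
  then show "- (Ladj (snd z) + grad_h (fst z)) \<in> subdifferential UNIV f (fst z)"
    using \<rho> by simp
  have "(1 / \<sigma> k) *\<^sub>R (snd z $ k + \<sigma> k *\<^sub>R L k (2 *\<^sub>R fst z - fst z) - snd z $ k)
      \<in> subdifferential (G k) (gc k) (snd z $ k)"
    using prox_subdifferential[OF g_conj G \<sigma>[of k] dual_arg_in[OF z(1), of k "2 *\<^sub>R fst z - fst z"]]
    by (simp only: q)
  then show "L k (fst z) \<in> subdifferential (G k) (gc k) (snd z $ k)"
    using \<sigma>[of k] by (simp add: scaleR_2)
qed

text \<open>This direction supplies a fixed point to start from: solutions of the two inclusions are
  recognised as values of \<open>prox\<close> by \<open>prox_eqI\<close>.\<close>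

lemma fixed_pointI:
  assumes z: "z \<in> feasible"
    and f': "- (Ladj (snd z) + grad_h (fst z)) \<in> subdifferential UNIV f (fst z)"
    and g': "\<And>k. L k (fst z) \<in> subdifferential (G k) (gc k) (snd z $ k)"
  shows "T z = z"
proof -
  have p: "primal_step z (grad_h (fst z)) = fst z"
    unfolding primal_step_def using f' \<rho> by (intro prox_eqI[OF f]) auto
  have "dual_step z (fst z) k = snd z $ k" for k
    using g' \<sigma>[of k] by (intro prox_eqI[OF g_conj G \<sigma>] dual_arg_in z snd_feasible) (simp add: scaleR_2)
  then show ?thesis by (simp add: T_def prod_eq_iff vec_eq_iff p)
qed

text \<open>Three subgradient inequalities, for \<open>f\<close>, for the \<open>g k\<close> and for
  \<open>h\<close>, are added; the dual point makes their slopes cancel.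
  \<open>subdifferential_of_conjugate\<close> turns the inclusion for the conjugate into one for
  \<open>g k\<close>.\<close>

lemma fixed_point_primal:
  assumes z: "z \<in> feasible" "T z = z"
  shows "fst z \<in> primal_solutions f h g L"
proof -
  define x where "x = fst z"
  define v where "v k = snd z $ k" for k
  let ?a = "- (Ladj (snd z) + grad_h x)"
  have a: "?a \<in> subdifferential UNIV f x"
    using fixed_point_imp[OF z] by (simp add: x_def)
  have v: "v k \<in> subdifferential (G k) (g k) (L k x)" for k
    using fixed_point_imp(2)[OF z] snd_feasible[OF z(1)]
    by (auto simp: x_def v_def intro!: subdifferential_of_conjugate[OF g G g_conj])
  obtain fx where fx: "f x = ereal fx"
    using subdifferential_finite[OF f _ a] by auto
  have "\<exists>r. g k (L k x) = ereal r" for k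
    using subdifferential_finite[OF g L_range v] by auto
  then obtain gx where gx: "\<And>k. g k (L k x) = ereal (gx k)" by metis
  have "f x + (\<Sum>k\<in>UNIV. g k (L k x)) + ereal (h x) \<le> f y + (\<Sum>k\<in>UNIV. g k (L k y)) + ereal (h y)" for y
  proof -
    have "ereal ((y - x) \<bullet> ?a + fx) \<le> f y"
      using a fx by (auto simp: subdifferential_def)
    moreover have "ereal (\<Sum>k\<in>UNIV. (L k y - L k x) \<bullet> v k + gx k) \<le> (\<Sum>k\<in>UNIV. g k (L k y))"
    proof -
      have "ereal ((L k y - L k x) \<bullet> v k + gx k) \<le> g k (L k y)" for k
        using v[of k] L_range gx[of k] by (auto simp: subdifferential_def)
      then show ?thesis unfolding sum_ereal[symmetric] by (intro sum_mono)
    qed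
    moreover have "ereal (h x + grad_h x \<bullet> (y - x)) \<le> ereal (h y)"
      using convex_gradient_inequality[OF h_convex h_grad] by simp
    ultimately have "ereal ((y - x) \<bullet> ?a + fx) + ereal (\<Sum>k\<in>UNIV. (L k y - L k x) \<bullet> v k + gx k)
        + ereal (h x + grad_h x \<bullet> (y - x)) \<le> f y + (\<Sum>k\<in>UNIV. g k (L k y)) + ereal (h y)"
      by (intro add_mono)
    moreover have "(y - x) \<bullet> ?a + fx + (\<Sum>k\<in>UNIV. (L k y - L k x) \<bullet> v k + gx k) + (h x + grad_h x \<bullet> (y - x))
        = fx + (\<Sum>k\<in>UNIV. gx k) + h x"
    proof -
      have "(y - x) \<bullet> Ladj (snd z) = (\<Sum>k\<in>UNIV. (L k y - L k x) \<bullet> v k)"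
        by (simp only: inner_Ladj v_def linear_diff[OF L_linear])
      then have "(y - x) \<bullet> ?a = - (\<Sum>k\<in>UNIV. (L k y - L k x) \<bullet> v k) - grad_h x \<bullet> (y - x)"
        by (simp only: inner_minus_right inner_add_right inner_commute[of _ "grad_h x"])
      then show ?thesis by (simp only: sum.distrib)
    qed
    ultimately show ?thesis by (simp only: fx gx sum_ereal plus_ereal.simps(1))
  qed
  then show ?thesis
    by (simp add: primal_solutions_def is_arg_min_linorder x_def)
qed

text \<open>Weak duality with the primal point as multiplier: Fenchel-Young at \<open>x\<close>
  bounds the infimal convolution from below for every dual point, and this bound is attained at
  \<open>v\<close>.\<close>

lemma fixed_point_dual:
  assumes z: "z \<in> feasible" "T z = z"
  shows "snd z \<in> dual_solutions f h G g L"
proof -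
  define x where "x = fst z"
  define v where "v = snd z"
  let ?h = "\<lambda>x. ereal (h x)"
  let ?fc = "fenchel_conjugate UNIV f" and ?hc = "fenchel_conjugate UNIV ?h"
  let ?I = "\<lambda>v. inf_convolution UNIV ?fc ?hc (- Ladj v)"
  define a where "a = - (Ladj v + grad_h x)"
  have a: "a \<in> subdifferential UNIV f x"
    using fixed_point_imp[OF z] by (simp add: x_def v_def a_def)
  have gh: "grad_h x \<in> subdifferential UNIV ?h x"
    using convex_gradient_inequality[OF h_convex h_grad, of x] by (auto simp: subdifferential_def inner_commute add.commute)
  have Lx: "L k x \<in> subdifferential (G k) (gc k) (v $ k)" for k
    using fixed_point_imp(2)[OF z] by (simp add: x_def v_def)
  have vG: "v $ k \<in> G k" for k using snd_feasible[OF z(1)] by (simp add: v_def)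
  obtain fx where fx: "f x = ereal fx"
    using subdifferential_finite[OF f _ a] by auto
  have "\<exists>r. gc k (v $ k) = ereal r" for k
    using subdifferential_finite[OF g_conj vG Lx] by auto
  then obtain gv where gv: "\<And>k. gc k (v $ k) = ereal (gv k)" by metis
  have lower: "ereal (- (x \<bullet> Ladj v') - fx - h x) \<le> ?I v'" for v'
    unfolding inf_convolution_def
  proof (rule INF_greatest)
    fix w
    have "ereal (x \<bullet> w) - f x \<le> ?fc w" "ereal (x \<bullet> (- Ladj v' - w)) - ?h x \<le> ?hc (- Ladj v' - w)"
      by (rule Fenchel_Young[OF UNIV_I])+
    then have "(ereal (x \<bullet> w) - f x) + (ereal (x \<bullet> (- Ladj v' - w)) - ?h x) \<le> ?fc w + ?hc (- Ladj v' - w)"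
      by (rule add_mono)
    moreover have "(ereal (x \<bullet> w) - f x) + (ereal (x \<bullet> (- Ladj v' - w)) - ?h x)
        = ereal (- (x \<bullet> Ladj v') - fx - h x)"
      by (simp add: fx inner_diff_right)
    ultimately show "ereal (- (x \<bullet> Ladj v') - fx - h x) \<le> ?fc w + ?hc (- Ladj v' - w)" by simp
  qed
  have upper: "?I v \<le> ereal (- (x \<bullet> Ladj v) - fx - h x)"
  proof -
    \<comment> \<open>The split of \<open>- Ladj v\<close> into \<open>a\<close> and
      \<open>grad_h x\<close> is the optimal one: both are subgradients at the same point
      \<open>x\<close>, so Fenchel-Young is an equality in both terms.\<close>
    have "?I v \<le> ?fc a + ?hc (- Ladj v - a)"
      unfolding inf_convolution_def by (rule INF_lower) simp
    also have "- Ladj v - a = grad_h x" by (simp add: a_def)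
    also have "?fc a + ?hc (grad_h x) = (ereal (x \<bullet> a) - f x) + (ereal (x \<bullet> grad_h x) - ?h x)"
      using fenchel_conjugate_subgradient[OF _ a] fenchel_conjugate_subgradient[OF _ gh] by (simp add: fx)
    also have "\<dots> = ereal (- (x \<bullet> Ladj v) - fx - h x)"
      by (simp add: fx a_def inner_diff_right)
    finally show ?thesis .
  qed
  have "?I v + (\<Sum>k\<in>UNIV. gc k (v $ k)) \<le> ?I v' + (\<Sum>k\<in>UNIV. gc k (v' $ k))" if v': "v' \<in> hilbert_sum G" for v'
  proof -
    have "?I v + (\<Sum>k\<in>UNIV. gc k (v $ k)) \<le> ereal (- (x \<bullet> Ladj v) - fx - h x) + (\<Sum>k\<in>UNIV. gc k (v $ k))"
      by (rule add_right_mono[OF upper])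
    also have "\<dots> = ereal (- (x \<bullet> Ladj v') - fx - h x) + ereal (\<Sum>k\<in>UNIV. (v' $ k - v $ k) \<bullet> L k x + gv k)"
    proof -
      have "(\<Sum>k\<in>UNIV. (v' $ k - v $ k) \<bullet> L k x) = x \<bullet> Ladj v' - x \<bullet> Ladj v"
        unfolding inner_Ladj inner_diff_left sum_subtractf by (simp only: inner_commute)
      then show ?thesis by (simp add: gv sum.distrib)
    qed
    also have "\<dots> \<le> ?I v' + (\<Sum>k\<in>UNIV. gc k (v' $ k))"
    proof (rule add_mono[OF lower])
      have "ereal ((v' $ k - v $ k) \<bullet> L k x + gv k) \<le> gc k (v' $ k)" for k
        using Lx[of k] v' gv[of k] by (auto simp: subdifferential_def hilbert_sum_def)
      then show "ereal (\<Sum>k\<in>UNIV. (v' $ k - v $ k) \<bullet> L k x + gv k) \<le> (\<Sum>k\<in>UNIV. gc k (v' $ k))"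
        unfolding sum_ereal[symmetric] by (intro sum_mono)
    qed
    finally show ?thesis .
  qed
  then show ?thesis
    using vG by (simp add: dual_solutions_def is_arg_min_linorder v_def hilbert_sum_def)
qed

end

section \<open>Effect of errors on one step\<close>

lemma four_squares: "(a + b + c + d)^2 \<le> 4 * (a^2 + b^2 + c^2 + d^2)" for a b c d :: real
  using zero_le_power2[of "a - b"] zero_le_power2[of "a - c"] zero_le_power2[of "a - d"]
    zero_le_power2[of "b - c"] zero_le_power2[of "b - d"] zero_le_power2[of "c - d"]
  by (simp add: power2_eq_square algebra_simps)

lemma norm_vec_le_sum: "norm (v :: 'a::real_normed_vector ^ 'n) \<le> (\<Sum>k\<in>UNIV. norm (v $ k))"
  by (simp add: norm_vec_def L2_set_le_sum)

context primal_dual_splitting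
begin

lemma grad_h_Lipschitz: "norm (grad_h x - grad_h y) \<le> norm (x - y) / \<mu>"
  using lipschitz_onD[OF h_lipschitz, of x y] by (simp add: dist_norm)

abbreviation arg_norm :: "'h \<times> ('g ^ 'q) \<Rightarrow> 'h \<Rightarrow> real" where
  "arg_norm z u \<equiv> norm (fst z - \<rho> *\<^sub>R (Ladj (snd z) + u))"

text \<open>The approximate proximity operators and the additive errors are reduced to the two
  bounds \<open>A\<close> and \<open>c\<close>. As in the algorithm, the dual residual is measured
  at the computed point \<open>fst s\<close>, not at the exact
  \<open>primal_step z u\<close>.\<close>

definition perturbed_step :: "'h \<times> ('g ^ 'q) \<Rightarrow> 'h \<Rightarrow> real \<Rightarrow> real \<Rightarrow> 'h \<times> ('g ^ 'q) \<Rightarrow> bool" where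
  "perturbed_step z u A c s \<longleftrightarrow> z \<in> feasible \<and> 0 \<le> c \<and> norm (fst s - primal_step z u) \<le> A \<and>
     (\<forall>k. norm (snd s $ k - dual_step z (fst s) k) \<le> c)"

text \<open>The free vector \<open>U\<close> will be the conditional mean of \<open>u\<close>; it
  separates bias from noise, which are controlled by different hypotheses. The fixed reference
  \<open>p\<close> is absorbed in the constant.\<close>

lemma step_argument_bound:
  "\<exists>K>0. \<forall>z u U. arg_norm z u
      \<le> K * (1 + norm (z - p) + norm (U - grad_h (fst z)) + norm (u - U))"
proof -
  let ?A = "\<lambda>x. fst (fst x) - \<rho> *\<^sub>R (Ladj (snd (fst x)) + snd x)"
  have "linear ?A"
    by (rule linearI) (simp_all add: linear_add[OF linear_Ladj] linear_scale[OF linear_Ladj] algebra_simps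
        del: vector_add_component vector_scaleR_component)
  then obtain K where K: "0 < K" "\<And>x. norm (?A x) \<le> K * norm x"
    using linear_bounded_pos by blast
  define c where "c = 1 + norm p + norm (grad_h (fst p)) + 1 / \<mu>"
  have c: "norm p + norm (grad_h (fst p)) \<le> c" "1 + 1 / \<mu> \<le> c" "1 \<le> c"
    using \<mu> by (auto simp: c_def)
  have "arg_norm z u \<le> K * c * (1 + norm (z - p) + norm (U - grad_h (fst z)) + norm (u - U))" for z u U
  proof -
    define t where "t = norm (z - p)"
    define d where "d = norm (U - grad_h (fst z))"
    define n where "n = norm (u - U)"
    have "norm (fst z - fst p) \<le> t"
      using norm_fst_le[of "fst (z - p)" "snd (z - p)"] unfolding prod.collapse by (simp add: t_def)
    then have "norm (fst z - fst p) / \<mu> \<le> t / \<mu>" using \<mu> by (intro divide_right_mono) auto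
    then have g: "norm (grad_h (fst z)) \<le> norm (grad_h (fst p)) + 1 / \<mu> * t"
      using grad_h_Lipschitz[of "fst z" "fst p"] norm_triangle_sub[of "grad_h (fst z)" "grad_h (fst p)"] by simp
    have "norm u \<le> n + d + norm (grad_h (fst z))"
      using norm_triangle_sub[of u U] norm_triangle_sub[of U "grad_h (fst z)"] by (simp add: n_def d_def)
    moreover have "norm z \<le> t + norm p" using norm_triangle_sub[of z p] by (simp add: t_def)
    ultimately have "norm (z, u) \<le> (norm p + norm (grad_h (fst p))) * 1 + (1 + 1 / \<mu>) * t + 1 * d + 1 * n"
      using g norm_Pair_le[of z u] by (simp add: distrib_right)
    also have "\<dots> \<le> c * 1 + c * t + c * d + c * n"
      using c by (intro add_mono mult_right_mono) (auto simp: t_def d_def n_def)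
    finally have "K * norm (z, u) \<le> K * (c * (1 + t + d + n))"
      using K(1) by (intro mult_left_mono) (auto simp: distrib_left)
    then show ?thesis using K(2)[of "(z, u)"] by (simp add: t_def d_def n_def mult.assoc)
  qed
  moreover have "0 < K * c" using K(1) c(3) by simp
  ultimately show ?thesis by blast
qed

text \<open>The perturbation of \<open>fst s\<close> enters the dual update through \<open>2 * fst s - fst z\<close>.\<close>

lemma step_error_norm:
  "\<exists>K>0. \<forall>z s u A c. perturbed_step z u A c s \<longrightarrow> norm (s - step z u) \<le> K * (A + c)"
proof -
  define S where "S = (\<Sum>k\<in>UNIV. 2 * \<sigma> k * onorm (L k))"
  define K where "K = 1 + S + real CARD('q)"
  have S0: "0 \<le> S"
    unfolding S_def using \<sigma> onorm_pos_le[OF L_bounded_linear] by (intro sum_nonneg mult_nonneg_nonneg) (auto simp: less_imp_le)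
  have "norm (s - step z u) \<le> K * (A + c)"
    if "perturbed_step z u A c s" for z s u A c
  proof -
    have z: "z \<in> feasible" and c: "0 \<le> c" and A: "norm (fst s - primal_step z u) \<le> A"
      and q: "\<And>k. norm (snd s $ k - dual_step z (fst s) k) \<le> c"
      using that by (auto simp: perturbed_step_def)
    let ?e = "s - step z u"
    have A0: "0 \<le> A" using A norm_ge_zero order_trans by blast
    have "norm (snd ?e $ k) \<le> c + 2 * \<sigma> k * onorm (L k) * A" for k
    proof -
      let ?P = "\<lambda>y. dual_step z y k"
      have "norm (?P (fst s) - ?P (primal_step z u))
          \<le> norm ((snd z $ k + \<sigma> k *\<^sub>R L k (2 *\<^sub>R fst s - fst z))
              - (snd z $ k + \<sigma> k *\<^sub>R L k (2 *\<^sub>R primal_step z u - fst z)))"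
        by (intro prox_nonexpansive[OF g_conj G \<sigma>] dual_arg_in z)
      also have "(snd z $ k + \<sigma> k *\<^sub>R L k (2 *\<^sub>R fst s - fst z))
              - (snd z $ k + \<sigma> k *\<^sub>R L k (2 *\<^sub>R primal_step z u - fst z))
          = (2 * \<sigma> k) *\<^sub>R L k (fst s - primal_step z u)"
        by (simp add: linear_diff[OF L_linear] linear_scale[OF L_linear] algebra_simps)
      also have "norm \<dots> = 2 * \<sigma> k * norm (L k (fst s - primal_step z u))"
        using \<sigma>[of k] by simp
      also have "\<dots> \<le> 2 * \<sigma> k * (onorm (L k) * A)"
      proof (intro mult_left_mono)
        have "norm (L k (fst s - primal_step z u)) \<le> onorm (L k) * norm (fst s - primal_step z u)"
          by (rule onorm[OF L_bounded_linear])
        also have "\<dots> \<le> onorm (L k) * A"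
          by (intro mult_left_mono A onorm_pos_le[OF L_bounded_linear])
        finally show "norm (L k (fst s - primal_step z u)) \<le> onorm (L k) * A" .
      qed (use \<sigma>[of k] in simp)
      finally have "norm (?P (fst s) - ?P (primal_step z u)) \<le> 2 * \<sigma> k * onorm (L k) * A" by (simp add: mult_ac)
      moreover have "norm (snd ?e $ k) \<le> norm (snd s $ k - ?P (fst s)) + norm (?P (fst s) - ?P (primal_step z u))"
        using norm_triangle_ineq[of "snd s $ k - ?P (fst s)" "?P (fst s) - ?P (primal_step z u)"] by simp
      ultimately show ?thesis using q[of k] by linarith
    qed
    then have "(\<Sum>k\<in>UNIV. norm (snd ?e $ k)) \<le> (\<Sum>k\<in>UNIV. c + 2 * \<sigma> k * onorm (L k) * A)"
      by (intro sum_mono)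
    also have "\<dots> = real CARD('q) * c + S * A"
      by (simp add: sum.distrib S_def sum_distrib_right)
    finally have "norm (snd ?e) \<le> real CARD('q) * c + S * A"
      using norm_vec_le_sum[of "snd ?e"] by linarith
    moreover have "norm (fst ?e) \<le> A" using A by simp
    moreover have "norm ?e \<le> norm (fst ?e) + norm (snd ?e)"
      using norm_Pair_le[of "fst ?e" "snd ?e"] by (simp only: prod.collapse)
    ultimately have "norm ?e \<le> A + (real CARD('q) * c + S * A)" by linarith
    moreover have "K * (A + c) = A + (real CARD('q) * c + S * A) + (real CARD('q) * A + c + S * c)"
      by (simp add: K_def algebra_simps)
    moreover have "0 \<le> real CARD('q) * A + c + S * c" using A0 c S0 by simp
    ultimately show ?thesis by linarith
  qed
  moreover have "0 < K" using S0 by (simp add: K_def)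
  ultimately show ?thesis by blast
qed

text \<open>The form needed for conditioning: a sum of squares, each with one kind of error. The
  relative error \<open>\<alpha>\<close> multiplies the size of the prox argument, which is why
  \<open>Q (z - p)\<close>, bias and noise reappear next to \<open>\<alpha>^2\<close>.\<close>

lemma step_error_bound:
  "\<exists>C>0. \<forall>z s u U \<alpha> \<beta> b c. perturbed_step z u (\<alpha> * arg_norm z u + \<beta> + b) c s \<longrightarrow>
     Q (s - step z u) \<le> C * (\<alpha>^2 * (1 + Q (z - p) + (norm (U - grad_h (fst z)))^2 + (norm (u - U))^2)
        + \<beta>^2 + b^2 + c^2)"
proof -
  obtain C0 where C0: "0 < C0" "\<And>w. Q w \<le> C0 * (norm w)^2" using Q_bounded by blast
  obtain m where m: "0 < m" "\<And>w. m * (norm w)^2 \<le> Q w" using Q_coercive by blast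
  obtain K2 where K2: "0 < K2" "\<And>z u U. arg_norm z u
      \<le> K2 * (1 + norm (z - p) + norm (U - grad_h (fst z)) + norm (u - U))"
    using step_argument_bound[of p] by blast
  obtain K1 where K1: "0 < K1" "\<And>z s u A c. perturbed_step z u A c s \<Longrightarrow> norm (s - step z u) \<le> K1 * (A + c)"
    using step_error_norm by blast
  define K3 where "K3 = 4 * K2^2 * (1 + 1 / m)"
  define C where "C = C0 * (K1^2 * (4 * (1 + K3)))"
  have K3: "0 \<le> K3" using m(1) by (simp add: K3_def)
  have "Q (s - step z u) \<le> C * (\<alpha>^2 * (1 + Q (z - p) + (norm (U - grad_h (fst z)))^2 + (norm (u - U))^2)
        + \<beta>^2 + b^2 + c^2)"
    if "perturbed_step z u (\<alpha> * arg_norm z u + \<beta> + b) c s" for z s u U \<alpha> \<beta> b c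
  proof -
    define a where "a = arg_norm z u"
    define W where "W = 1 + Q (z - p) + (norm (U - grad_h (fst z)))^2 + (norm (u - U))^2"
    have "a^2 \<le> (K2 * (1 + norm (z - p) + norm (U - grad_h (fst z)) + norm (u - U)))^2"
      unfolding a_def by (intro power_mono K2) auto
    also have "\<dots> \<le> K2^2 * (4 * (1^2 + (norm (z - p))^2 + (norm (U - grad_h (fst z)))^2 + (norm (u - U))^2))"
      unfolding power_mult_distrib by (intro mult_left_mono four_squares) auto
    also have "\<dots> \<le> K2^2 * (4 * ((1 + 1 / m) * W))"
    proof -
      have "(norm (z - p))^2 \<le> 1 / m * Q (z - p)"
        using m(2)[of "z - p"] m(1) by (simp add: field_simps)
      moreover have "0 \<le> Q (z - p)" by (rule Q_nonneg)
      moreover have "1 / m * Q (z - p) \<le> 1 / m * W" unfolding W_def using m(1) by (intro mult_left_mono) auto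
      moreover have "(1 + 1 / m) * W = W + 1 / m * W" by (simp add: algebra_simps)
      ultimately have "1^2 + (norm (z - p))^2 + (norm (U - grad_h (fst z)))^2 + (norm (u - U))^2 \<le> (1 + 1 / m) * W"
        unfolding W_def by simp
      then show ?thesis using K2(1) by (intro mult_left_mono) auto
    qed
    finally have a2: "a^2 \<le> K3 * W" by (simp only: K3_def mult_ac)
    have "norm (s - step z u) \<le> K1 * (\<alpha> * a + \<beta> + b + c)"
      using K1(2)[OF that] by (simp add: a_def)
    then have "(norm (s - step z u))^2 \<le> (K1 * (\<alpha> * a + \<beta> + b + c))^2"
      by (intro power_mono) auto
    also have "\<dots> \<le> K1^2 * (4 * ((\<alpha> * a)^2 + \<beta>^2 + b^2 + c^2))"
      unfolding power_mult_distrib[of K1] by (intro mult_left_mono four_squares) auto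
    also have "\<dots> \<le> K1^2 * (4 * ((1 + K3) * (\<alpha>^2 * W + \<beta>^2 + b^2 + c^2)))"
    proof -
      have "(\<alpha> * a)^2 \<le> K3 * (\<alpha>^2 * W)"
        using mult_left_mono[OF a2, of "\<alpha>^2"] by (simp add: power_mult_distrib mult_ac)
      moreover have "0 \<le> \<alpha>^2 * W" unfolding W_def using Q_nonneg[of "z - p"] by simp
      moreover have "0 \<le> K3 * \<beta>^2" "0 \<le> K3 * b^2" "0 \<le> K3 * c^2" using K3 by auto
      moreover have "(1 + K3) * (\<alpha>^2 * W + \<beta>^2 + b^2 + c^2)
        = \<alpha>^2 * W + \<beta>^2 + b^2 + c^2 + K3 * (\<alpha>^2 * W) + K3 * \<beta>^2 + K3 * b^2 + K3 * c^2"
        by (simp add: algebra_simps)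
      ultimately have "(\<alpha> * a)^2 + \<beta>^2 + b^2 + c^2 \<le> (1 + K3) * (\<alpha>^2 * W + \<beta>^2 + b^2 + c^2)"
        by linarith
      then show ?thesis by (intro mult_left_mono) auto
    qed
    finally have "C0 * (norm (s - step z u))^2
        \<le> C0 * (K1^2 * (4 * ((1 + K3) * (\<alpha>^2 * W + \<beta>^2 + b^2 + c^2))))"
      using C0(1) by (intro mult_left_mono) auto
    also have "\<dots> = C * (\<alpha>^2 * W + \<beta>^2 + b^2 + c^2)" by (simp only: C_def mult.assoc)
    finally have "C0 * (norm (s - step z u))^2 \<le> C * (\<alpha>^2 * W + \<beta>^2 + b^2 + c^2)" .
    then show ?thesis using C0(2)[of "s - step z u"] unfolding W_def by linarith
  qed
  moreover have "0 < C" using C0(1) K1(1) K3 by (simp add: C_def)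
  ultimately show ?thesis by blast
qed

text \<open>Convexity of \<open>Q\<close> handles the relaxation, and Young's inequality separates
  the step error \<open>t *\<^sub>R (s - r)\<close>, whence the factor \<open>t^2\<close>. Dividing
  by \<open>1 + \<delta>\<close> leaves \<delta> on the right in the error term alone, which keeps
  the conditioning below simple.\<close>

lemma relaxed_step_Fejer:
  assumes z: "z \<in> feasible" and p: "p \<in> feasible" "T p = p" and t: "0 \<le> t" "t \<le> 1" and \<delta>: "0 < \<delta>"
  shows "Q (z + t *\<^sub>R (s - z) - p) / (1 + \<delta>) \<le> Q (z - p) - t * (\<theta> / 2 * Q (z - T z))
     - 2 * t * ((u - grad_h (fst z)) \<bullet> (fst (T z) - fst p)) + t * (3 / \<kappa> * (norm (u - grad_h (fst z)))^2)
     + t^2 * Q (s - step z u) / \<delta>"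
proof -
  define r where "r = step z u"
  let ?X = "(1 - t) *\<^sub>R (z - p) + t *\<^sub>R (r - p)" and ?Y = "t *\<^sub>R (s - r)"
  have "z + t *\<^sub>R (s - z) - p = ?X + ?Y" by (simp add: algebra_simps)
  then have "Q (z + t *\<^sub>R (s - z) - p) \<le> (1 + \<delta>) * Q ?X + (1 + 1 / \<delta>) * Q ?Y"
    using Q_Young[OF \<delta>, of ?X ?Y] by simp
  also have "\<dots> = (1 + \<delta>) * (Q ?X + t^2 * Q (s - r) / \<delta>)"
    using \<delta> unfolding Q_scale by (simp add: field_simps)
  finally have 1: "Q (z + t *\<^sub>R (s - z) - p) / (1 + \<delta>) \<le> Q ?X + t^2 * Q (s - r) / \<delta>"
    using \<delta> by (simp add: divide_le_eq mult.commute)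
  have "Q ?X = (1 - t) * Q (z - p) + t * Q (r - p) - t * (1 - t) * Q ((z - p) - (r - p))"
    unfolding Q_add[of "(1 - t) *\<^sub>R (z - p)"] Q_scale Q_diff[of "z - p" "r - p"]
      bilinear_lmul[OF bilinear_B] bilinear_rmul[OF bilinear_B]
    by (simp add: power2_eq_square algebra_simps)
  moreover have "0 \<le> t * (1 - t) * Q ((z - p) - (r - p))"
    using t Q_nonneg by (intro mult_nonneg_nonneg) auto
  ultimately have 2: "Q ?X \<le> (1 - t) * Q (z - p) + t * Q (r - p)" by linarith
  have "t * Q (r - p) \<le> t * (Q (z - p) - \<theta> / 2 * Q (z - T z)
     - 2 * ((u - grad_h (fst z)) \<bullet> (fst (T z) - fst p)) + 3 / \<kappa> * (norm (u - grad_h (fst z)))^2)"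
    unfolding r_def by (intro mult_left_mono step_Fejer[OF z p] t)
  with 1 2 show ?thesis unfolding r_def[symmetric] by (simp add: algebra_simps)
qed

end

lemma (in sigma_finite_subalgebra) real_cond_exp_add_mult:
  assumes Y: "integrable M Y" and k: "k \<in> borel_measurable F" and D: "D \<in> borel_measurable M"
    and kD: "integrable M (\<lambda>w. k w * D w)"
  shows "AE w in M. real_cond_exp M F (\<lambda>w. Y w + k w * D w) w
      = real_cond_exp M F Y w + k w * real_cond_exp M F D w"
  using real_cond_exp_add[OF Y kD] real_cond_exp_mult[OF k D kD] by eventually_elim simp

lemma summable_mult_nonneg:
  fixes f g :: "nat \<Rightarrow> real"
  assumes f: "summable f" "\<And>n. 0 \<le> f n" and g: "summable g" "\<And>n. 0 \<le> g n"
  shows "summable (\<lambda>n. f n * g n)"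
proof (rule summable_comparison_test'[OF summable_mult[OF g(1), of "suminf f"]])
  fix n
  have "f n \<le> suminf f" using sum_le_suminf[OF f(1), of "{n}"] f(2) by simp
  then show "norm (f n * g n) \<le> suminf f * g n"
    using f(2)[of n] g(2)[of n] by (simp add: mult_right_mono)
qed

section \<open>The stochastic iteration\<close>

lemmas integrable_plus = Bochner_Integration.integrable_add
  and integrable_minus = Bochner_Integration.integrable_diff

section \<open>Square integrability\<close>

context prob_space
begin

abbreviation L2 :: "('a \<Rightarrow> 'b::euclidean_space) \<Rightarrow> bool" where
  "L2 X \<equiv> integrable M (\<lambda>w. (norm (X w))^2)"

lemma integrable_squeeze:
  fixes X Y :: "'a \<Rightarrow> real"
  assumes "integrable M Y" "X \<in> borel_measurable M" "\<And>w. w \<in> space M \<Longrightarrow> 0 \<le> X w \<and> X w \<le> Y w"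
  shows "integrable M X"
  by (rule Bochner_Integration.integrable_bound[OF assms(1,2)]) (use assms(3) in \<open>force intro: AE_I2\<close>)

lemma integrable_bounded_mult:
  fixes k D :: "'a \<Rightarrow> real"
  assumes "integrable M D" "k \<in> borel_measurable M" "\<And>w. w \<in> space M \<Longrightarrow> \<bar>k w\<bar> \<le> K"
  shows "integrable M (\<lambda>w. k w * D w)"
proof (rule Bochner_Integration.integrable_bound)
  show "integrable M (\<lambda>w. K * D w)" using assms(1) by simp
  show "AE w in M. norm (k w * D w) \<le> norm (K * D w)"
  proof (rule AE_I2)
    fix w assume "w \<in> space M"
    then have "\<bar>k w\<bar> \<le> \<bar>K\<bar>" using assms(3) by (meson abs_ge_self order_trans)
    then show "norm (k w * D w) \<le> norm (K * D w)" by (simp add: abs_mult mult_right_mono)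
  qed
qed (use assms in measurable)

lemma L2_imp_integrable:
  fixes X :: "'a \<Rightarrow> 'b::euclidean_space"
  assumes X: "X \<in> borel_measurable M" and sq: "L2 X"
  shows "integrable M X"
proof -
  have "integrable M (\<lambda>w. norm (X w))"
    by (rule square_integrable_imp_integrable[OF measurable_compose[OF X borel_measurable_norm] sq])
  then show ?thesis by (rule integrable_norm_cancel) (rule X)
qed

lemma L2_affine_bound:
  fixes X :: "'a \<Rightarrow> 'b::euclidean_space" and Y :: "'a \<Rightarrow> 'c::euclidean_space"
  assumes X: "X \<in> borel_measurable M" and Y: "L2 Y"
    and le: "\<And>w. w \<in> space M \<Longrightarrow> norm (X w) \<le> K + K' * norm (Y w)"
  shows "L2 X"
proof (rule integrable_squeeze)
  show "integrable M (\<lambda>w. 2 * K^2 + 2 * K'^2 * (norm (Y w))^2)" using Y by simp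
  fix w assume "w \<in> space M"
  then have "(norm (X w))^2 \<le> (K + K' * norm (Y w))^2" by (intro power_mono le) auto
  also have "\<dots> \<le> 2 * K^2 + 2 * (K' * norm (Y w))^2"
    using zero_le_power2[of "K - K' * norm (Y w)"] by (simp add: power2_eq_square algebra_simps)
  finally show "0 \<le> (norm (X w))^2 \<and> (norm (X w))^2 \<le> 2 * K^2 + 2 * K'^2 * (norm (Y w))^2"
    by (simp add: power_mult_distrib)
qed (use X in measurable)

lemma L2_diff:
  fixes X Y :: "'a \<Rightarrow> 'b::euclidean_space"
  assumes [measurable]: "X \<in> borel_measurable M" "Y \<in> borel_measurable M"
    and "L2 X" "L2 Y"
  shows "L2 (\<lambda>w. X w - Y w)"
proof (rule integrable_squeeze)
  show "integrable M (\<lambda>w. 2 * (norm (X w))^2 + 2 * (norm (Y w))^2)" using assms by simp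
  fix w
  have "(norm (X w - Y w))^2 \<le> (norm (X w) + norm (Y w))^2"
    by (intro power_mono norm_triangle_ineq4) auto
  also have "\<dots> \<le> 2 * (norm (X w))^2 + 2 * (norm (Y w))^2"
    using zero_le_power2[of "norm (X w) - norm (Y w)"] by (simp add: power2_eq_square algebra_simps)
  finally show "0 \<le> (norm (X w - Y w))^2 \<and> (norm (X w - Y w))^2 \<le> 2 * (norm (X w))^2 + 2 * (norm (Y w))^2"
    by simp
qed measurable

end

text \<open>\<open>s n\<close> is the unrelaxed pair of primal and dual updates. The approximating
  functions have disappeared: they act only through \<open>s_perturbed\<close>.\<close>

locale stochastic_primal_dual =
  primal_dual_splitting f h grad_h G g L \<mu> \<rho> \<sigma> + filtered_prob_space M F
  for f :: "'h::euclidean_space \<Rightarrow> ereal" and h grad_h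
    and G :: "'q::finite \<Rightarrow> 'g::euclidean_space set" and g L \<mu> \<rho> \<sigma>
    and M :: "'w measure" and F +
  fixes z s :: "nat \<Rightarrow> 'w \<Rightarrow> 'h \<times> ('g ^ 'q)"
    and u b :: "nat \<Rightarrow> 'w \<Rightarrow> 'h" and c :: "nat \<Rightarrow> 'w \<Rightarrow> 'g ^ 'q"
    and l \<alpha> \<beta> \<tau> :: "nat \<Rightarrow> real"
  assumes l: "\<And>n. 0 < l n" "\<And>n. l n \<le> 1" "\<not> summable l"
    and z_F: "\<And>n. z n \<in> borel_measurable (F n)"
    and z0_L2: "L2 (z 0)"
    and z_Suc: "\<And>n w. w \<in> space M \<Longrightarrow> z (Suc n) w = z n w + l n *\<^sub>R (s n w - z n w)"
    and u [measurable]: "\<And>n. u n \<in> borel_measurable M" and u_L2: "\<And>n. L2 (u n)"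
    and b [measurable]: "\<And>n. b n \<in> borel_measurable M" and b_L2: "\<And>n. L2 (b n)"
    and c [measurable]: "\<And>n. c n \<in> borel_measurable M" and c_L2: "\<And>n. L2 (c n)"
    and s_perturbed: "\<And>n w. w \<in> space M \<Longrightarrow> perturbed_step (z n w) (u n w)
      (\<alpha> n * arg_norm (z n w) (u n w) + \<beta> n + norm (b n w)) (norm (c n w)) (s n w)"
    and b_sum: "AE w in M. summable (\<lambda>n. l n * sqrt (CE2 n (b n) w))"
    and c_sum: "AE w in M. summable (\<lambda>n. l n * sqrt (CE2 n (c n) w))"
    and u_bias: "AE w in M. summable (\<lambda>n. sqrt (l n) * norm (vec_cond_exp M (F n) (u n) w - grad_h (fst (z n w))))"
    and \<tau>: "\<And>n. 0 \<le> \<tau> n" "summable \<tau>"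
    and u_var: "\<And>p. p \<in> primal_solutions f h g L \<Longrightarrow> \<exists>\<zeta>\<in>ell_plus_infty M F.
        (\<lambda>n w. l n * \<zeta> n w) \<in> ell_plus_half M F \<and>
        (\<forall>n. AE w in M. CE n (\<lambda>w. (norm (u n w - vec_cond_exp M (F n) (u n) w))^2) w
           \<le> \<tau> n * (norm (grad_h (fst (z n w)) - grad_h p))^2 + \<zeta> n w)"
    and \<alpha>: "\<And>n. 0 \<le> \<alpha> n" "summable (\<lambda>n. sqrt (l n) * \<alpha> n)"
    and \<beta>: "\<And>n. 0 \<le> \<beta> n" "summable (\<lambda>n. l n * \<beta> n)"
    and fixed_point_exists: "\<exists>p\<in>feasible. T p = p"
begin

definition U :: "nat \<Rightarrow> 'w \<Rightarrow> 'h" where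
  "U n = vec_cond_exp M (F n) (u n)"

abbreviation gz :: "nat \<Rightarrow> 'w \<Rightarrow> 'h" where
  "gz n w \<equiv> grad_h (fst (z n w))"

lemma z_feasible: "w \<in> space M \<Longrightarrow> z n w \<in> feasible"
  using s_perturbed by (simp add: perturbed_step_def)

text \<open>Cross term, bias, variance and squared errors are parameters, so that the same
  expression is used along a path and again with their conditional expectations.\<close>

definition descent_bound ::
    "'h \<times> ('g ^ 'q) \<Rightarrow> real \<Rightarrow> nat \<Rightarrow> 'w \<Rightarrow> real \<Rightarrow> real \<Rightarrow> real \<Rightarrow> real \<Rightarrow> real \<Rightarrow> real \<Rightarrow> real" where
  "descent_bound p C n w \<delta> X d V b' c' = Q (z n w - p) - l n * (\<theta> / 2 * Q (z n w - T (z n w)))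
      - 2 * l n * X + l n * (6 / \<kappa>) * (d^2 + V)
      + (l n)^2 / \<delta> * C * ((\<alpha> n)^2 * (1 + Q (z n w - p) + d^2 + V) + (\<beta> n)^2 + b' + c')"

abbreviation pathwise_bound :: "'h \<times> ('g ^ 'q) \<Rightarrow> real \<Rightarrow> nat \<Rightarrow> 'w \<Rightarrow> 'h \<Rightarrow> real \<Rightarrow> real" where
  "pathwise_bound p C n w V \<delta> \<equiv> descent_bound p C n w \<delta> ((u n w - gz n w) \<bullet> (fst (T (z n w)) - fst p))
     (norm (V - gz n w)) ((norm (u n w - V))^2) ((norm (b n w))^2) ((norm (c n w))^2)"

text \<open>\<open>C\<close> is uniform in time, path and \<delta>, so \<delta> may later be random.
  The constant 6 / \<kappa> is twice that of \<open>step_Fejer\<close>, from splitting the gradient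
  error into bias and noise.\<close>

lemma descent_pathwise:
  assumes p: "p \<in> feasible" "T p = p"
  shows "\<exists>C>0. \<forall>n w V \<delta>. w \<in> space M \<longrightarrow> 0 < \<delta> \<longrightarrow>
    Q (z (Suc n) w - p) / (1 + \<delta>) \<le> pathwise_bound p C n w V \<delta>"
proof -
  obtain C where C: "0 < C" "\<And>z s u U \<alpha> \<beta> b c. perturbed_step z u (\<alpha> * arg_norm z u + \<beta> + b) c s \<Longrightarrow>
     Q (s - step z u) \<le> C * (\<alpha>^2 * (1 + Q (z - p) + (norm (U - grad_h (fst z)))^2 + (norm (u - U))^2)
        + \<beta>^2 + b^2 + c^2)"
    using step_error_bound[of p] by blast
  show ?thesis
  proof (intro exI[of _ C] conjI allI impI)
    fix n w V and \<delta> :: real assume w: "w \<in> space M" and \<delta>: "0 < \<delta>"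
    let ?S = "(\<alpha> n)^2 * (1 + Q (z n w - p) + (norm (V - gz n w))^2 + (norm (u n w - V))^2)
         + (\<beta> n)^2 + (norm (b n w))^2 + (norm (c n w))^2"
    have "Q (z (Suc n) w - p) / (1 + \<delta>)
      \<le> Q (z n w - p) - l n * (\<theta> / 2 * Q (z n w - T (z n w)))
      - 2 * l n * ((u n w - gz n w) \<bullet> (fst (T (z n w)) - fst p))
      + l n * (3 / \<kappa> * (norm (u n w - gz n w))^2) + (l n)^2 * Q (s n w - step (z n w) (u n w)) / \<delta>"
      unfolding z_Suc[OF w] using l(1,2)[of n]
      by (intro relaxed_step_Fejer[OF z_feasible[OF w] p _ _ \<delta>]) auto
    moreover have "l n * (3 / \<kappa> * (norm (u n w - gz n w))^2)
       \<le> l n * (6 / \<kappa>) * ((norm (V - gz n w))^2 + (norm (u n w - V))^2)"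
    proof -
      have "(norm (u n w - gz n w))^2 \<le> (norm (V - gz n w) + norm (u n w - V))^2"
        using norm_triangle_ineq[of "V - gz n w" "u n w - V"] by (intro power_mono) auto
      also have "\<dots> \<le> 2 * ((norm (V - gz n w))^2 + (norm (u n w - V))^2)"
        using zero_le_power2[of "norm (V - gz n w) - norm (u n w - V)"]
        by (simp add: power2_eq_square algebra_simps)
      finally have "l n * (3 / \<kappa>) * (norm (u n w - gz n w))^2
          \<le> l n * (3 / \<kappa>) * (2 * ((norm (V - gz n w))^2 + (norm (u n w - V))^2))"
        using l(1)[of n] \<kappa>_pos by (intro mult_left_mono) auto
      then show ?thesis by (simp add: mult_ac)
    qed
    moreover have "(l n)^2 * Q (s n w - step (z n w) (u n w)) / \<delta> \<le> (l n)^2 / \<delta> * C * ?S"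
    proof -
      have "Q (s n w - step (z n w) (u n w)) \<le> C * ?S"
        by (rule C(2)[OF s_perturbed[OF w]])
      then have "(l n)^2 / \<delta> * Q (s n w - step (z n w) (u n w)) \<le> (l n)^2 / \<delta> * (C * ?S)"
        using \<delta> by (intro mult_left_mono) auto
      then show ?thesis by (simp add: mult_ac)
    qed
    ultimately show "Q (z (Suc n) w - p) / (1 + \<delta>) \<le> pathwise_bound p C n w V \<delta>"
      unfolding descent_bound_def by linarith
  qed (rule C(1))
qed

section \<open>Measurability and integrability of the iterates\<close>

lemma z_M [measurable]: "z n \<in> borel_measurable M"
  by (rule measurable_F_M[OF z_F])

lemma Tz_F: "(\<lambda>w. T (z n w)) \<in> borel_measurable (F n)"
  using z_F z_feasible by (intro borel_measurable_continuous_on_closed[OF continuous_on_T closed_feasible]) auto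

lemma Tz_M [measurable]: "(\<lambda>w. T (z n w)) \<in> borel_measurable M"
  by (rule measurable_F_M[OF Tz_F])

lemma fst_Tz_F: "(\<lambda>w. fst (T (z n w)) - x) \<in> borel_measurable (F n)"
proof -
  have "continuous_on UNIV (\<lambda>y :: 'h \<times> ('g ^ 'q). fst y - x)" by (intro continuous_intros)
  from borel_measurable_continuous_on[OF this Tz_F] show ?thesis .
qed

lemma borel_Q [measurable]: "Q \<in> borel_measurable borel"
  by (rule borel_measurable_continuous_onI[OF continuous_on_Q])

lemma gz_F: "gz n \<in> borel_measurable (F n)"
proof -
  have "continuous_on UNIV (\<lambda>y :: 'h \<times> ('g ^ 'q). grad_h (fst y))"
    by (rule continuous_on_compose2[OF continuous_on_grad_h[of UNIV]]) (auto intro: continuous_intros)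
  from borel_measurable_continuous_on[OF this z_F] show ?thesis .
qed

lemma gz_M [measurable]: "gz n \<in> borel_measurable M"
  by (rule measurable_F_M[OF gz_F])

lemma has_cond_exp_U: "has_cond_exp M (F n) (u n) (U n)"
proof -
  interpret F: sigma_finite_subalgebra M "F n" by (rule sigma_finite_subalg)
  show ?thesis unfolding U_def by (rule F.has_cond_exp_vec_cond_exp[OF L2_imp_integrable[OF u u_L2]])
qed

lemma U_F: "U n \<in> borel_measurable (F n)"
  using has_cond_exp_U by (simp add: has_cond_exp_def)

lemma U_M [measurable]: "U n \<in> borel_measurable M"
  by (rule measurable_F_M[OF U_F])

lemma U_L2: "L2 (U n)"
proof -
  interpret F: sigma_finite_subalgebra M "F n" by (rule sigma_finite_subalg)
  show ?thesis by (rule F.has_cond_exp_square_integrable[OF has_cond_exp_U u_L2])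
qed

lemma integrable_Q_iff:
  assumes [measurable]: "X \<in> borel_measurable M"
  shows "integrable M (\<lambda>w. Q (X w - p)) \<longleftrightarrow> L2 X"
proof
  obtain m where m: "0 < m" "\<And>w. m * (norm w)^2 \<le> Q w" using Q_coercive by blast
  assume i: "integrable M (\<lambda>w. Q (X w - p))"
  have "L2 (\<lambda>w. X w - p)"
  proof (rule integrable_squeeze)
    show "integrable M (\<lambda>w. 1 / m * Q (X w - p))" using i by simp
  qed (use m in \<open>auto simp: field_simps\<close>)
  then show "L2 X"
    by (rule L2_affine_bound[where K = "norm p" and K' = 1, rotated])
       (use norm_triangle_sub[of _ p] in \<open>auto simp: add.commute\<close>)
next
  obtain C where C: "0 < C" "\<And>w. Q w \<le> C * (norm w)^2" using Q_bounded by blast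
  assume "L2 X"
  then have i: "L2 (\<lambda>w. X w - p)"
    by (intro L2_diff) auto
  show "integrable M (\<lambda>w. Q (X w - p))"
  proof (rule integrable_squeeze)
    show "integrable M (\<lambda>w. C * (norm (X w - p))^2)" using i by simp
  qed (use C Q_nonneg in auto)
qed

text \<open>\<open>T z\<close> is compared with the fixed point: \<open>T_Fejer\<close> bounds
  everything that involves \<open>T z\<close> by \<open>Q (z - p)\<close>, in place of a growth
  estimate for \<open>T\<close>.\<close>

lemma integrable_of_z_L2:
  assumes zn: "L2 (z n)" and p: "p \<in> feasible" "T p = p"
  shows "integrable M (\<lambda>w. Q (z n w - p))"
    and "integrable M (\<lambda>w. Q (z n w - T (z n w)))"
    and "L2 (\<lambda>w. fst (T (z n w)) - fst p)"
    and "L2 (\<lambda>w. u n w - gz n w)"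
    and "L2 (\<lambda>w. U n w - gz n w)"
    and "L2 (\<lambda>w. u n w - U n w)"
    and "integrable M (\<lambda>w. (u n w - gz n w) \<bullet> (fst (T (z n w)) - fst p))"
proof -
  show iW: "integrable M (\<lambda>w. Q (z n w - p))" using zn by (simp add: integrable_Q_iff)
  show "integrable M (\<lambda>w. Q (z n w - T (z n w)))"
  proof (rule integrable_squeeze)
    show "integrable M (\<lambda>w. 4 * Q (z n w - p))" using iW by simp
    fix w assume w: "w \<in> space M"
    have "Q (z n w - T (z n w)) \<le> 2 * Q (z n w - p) + 2 * Q (p - T (z n w))"
      using Q_add_le[of "z n w - p" "p - T (z n w)"] by simp
    also have "\<dots> \<le> 4 * Q (z n w - p)"
      using T_Fejer[OF z_feasible[OF w] p, of n] Q_minus_commute[of p "T (z n w)"] by simp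
    finally show "0 \<le> Q (z n w - T (z n w)) \<and> Q (z n w - T (z n w)) \<le> 4 * Q (z n w - p)"
      using Q_nonneg by simp
  qed measurable
  show ig: "L2 (\<lambda>w. fst (T (z n w)) - fst p)"
  proof (rule integrable_squeeze)
    show "integrable M (\<lambda>w. 1 / \<kappa> * Q (z n w - p))" using iW by simp
    fix w assume w: "w \<in> space M"
    have "\<kappa> * (norm (fst (T (z n w)) - fst p))^2 \<le> Q (z n w - p)"
      using T_Fejer[OF z_feasible[OF w] p, of n] Q_ge_primal[of "T (z n w) - p"] by simp
    then show "0 \<le> (norm (fst (T (z n w)) - fst p))^2 \<and>
        (norm (fst (T (z n w)) - fst p))^2 \<le> 1 / \<kappa> * Q (z n w - p)"
      using \<kappa>_pos by (simp add: field_simps)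
  qed (intro borel_measurable_power measurable_compose[OF measurable_F_M[OF fst_Tz_F] borel_measurable_norm])
  have igz: "L2 (gz n)"
  proof (rule L2_affine_bound[OF _ zn])
    fix w assume "w \<in> space M"
    have "norm (gz n w) \<le> norm (grad_h 0) + norm (gz n w - grad_h 0)"
      by (rule norm_triangle_sub)
    also have "norm (gz n w - grad_h 0) \<le> norm (fst (z n w)) / \<mu>"
      using grad_h_Lipschitz[of "fst (z n w)" 0] by simp
    also have "\<dots> \<le> norm (z n w) / \<mu>"
      using norm_fst_le[of "fst (z n w)" "snd (z n w)"] \<mu> by (intro divide_right_mono) auto
    finally show "norm (gz n w) \<le> norm (grad_h 0) + 1 / \<mu> * norm (z n w)" by simp
  qed (rule gz_M)
  show iu: "L2 (\<lambda>w. u n w - gz n w)"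
    by (rule L2_diff[OF u gz_M u_L2 igz])
  show "L2 (\<lambda>w. U n w - gz n w)"
    by (rule L2_diff[OF U_M gz_M U_L2 igz])
  show "L2 (\<lambda>w. u n w - U n w)"
    by (rule L2_diff[OF u U_M u_L2 U_L2])
  interpret F: sigma_finite_subalgebra M "F n" by (rule sigma_finite_subalg)
  show "integrable M (\<lambda>w. (u n w - gz n w) \<bullet> (fst (T (z n w)) - fst p))"
    by (rule F.integrable_inner_L2[OF borel_measurable_diff[OF u gz_M] measurable_F_M[OF fst_Tz_F] iu ig])
qed

text \<open>The induction goes through \<open>Q\<close> of the next iterate, dominated by the
  pathwise bound with \<delta> = 1 and the conditional mean as reference, every term of which is
  integrable.\<close>

lemma z_L2: "L2 (z n)"
proof (induction n)
  case (Suc n)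
  obtain p where p: "p \<in> feasible" "T p = p" using fixed_point_exists by blast
  obtain C where C: "\<And>n w V \<delta>. w \<in> space M \<Longrightarrow> 0 < \<delta> \<Longrightarrow>
      Q (z (Suc n) w - p) / (1 + \<delta>) \<le> pathwise_bound p C n w V \<delta>"
    using descent_pathwise[OF p] by blast
  let ?R = "\<lambda>w. pathwise_bound p C n w (U n w) 1"
  note i = integrable_of_z_L2[OF Suc p]
  have "integrable M (\<lambda>w. Q (z (Suc n) w - p))"
  proof (rule integrable_squeeze)
    show "integrable M (\<lambda>w. 2 * ?R w)"
      unfolding descent_bound_def
      by (intro integrable_mult_right integrable_plus integrable_minus
          integrable_const i b_L2 c_L2)
    fix w assume w: "w \<in> space M"
    have half: "x \<le> 2 * y" if "x / (1 + 1) \<le> y" for x y :: real using that by simp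
    show "0 \<le> Q (z (Suc n) w - p) \<and> Q (z (Suc n) w - p) \<le> 2 * ?R w"
      by (rule conjI[OF Q_nonneg half[OF C[OF w zero_less_one]]])
  qed measurable
  then show ?case by (simp add: integrable_Q_iff)
qed (rule z0_L2)

end

section \<open>Choice of the Young parameter and the conditional recursion\<close>

lemma add_square_le:
  fixes s x y :: real
  assumes "s \<le> x^2" "0 \<le> x" "0 \<le> y"
  shows "s + y^2 \<le> (x + y)^2"
  using assms(1) mult_nonneg_nonneg[OF assms(2,3)] unfolding power2_sum mult.assoc by linarith

text \<open>One time step at one point of the space, all quantities being numbers.
  \<open>\<delta>\<close> adds up the square roots of the error terms, so that
  \<open>\<delta>^2\<close> dominates their sum and division by \<open>\<delta>\<close> still leaves
  a factor \<open>\<delta>\<close>. \<open>S\<close> collects the terms of first order in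
  \<open>l\<close>, written as products of summable factors.\<close>

lemma descent_arithmetic:
  fixes W N l \<theta> \<kappa> C \<alpha> \<beta> d \<zeta> \<tau> t0 K V X Eb Ec e :: real
  defines "\<delta> \<equiv> sqrt l * \<alpha> + (sqrt l * \<alpha>) * (sqrt l * d) + (sqrt l * \<alpha>) * sqrt (l * \<zeta>) + l * \<beta>
      + l * \<bar>sqrt Eb\<bar> + l * \<bar>sqrt Ec\<bar> + e"
  defines "S \<equiv> sqrt l * d + \<tau> + sqrt (l * \<zeta>) * sqrt (l * \<zeta>) + (sqrt l * d) * (sqrt l * d)"
  assumes WN: "0 \<le> W" "0 \<le> N" and pos: "0 < \<theta>" "0 < \<kappa>" "0 < C" and l: "0 < l" "l \<le> 1"
    and nn: "0 \<le> \<alpha>" "0 \<le> \<beta>" "0 \<le> d" "0 \<le> \<zeta>" "0 \<le> \<tau>" "\<tau> \<le> t0" "0 \<le> K" "0 \<le> Eb" "0 \<le> Ec" "0 < e"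
    and V: "V \<le> K * \<tau> * W + \<zeta>" and X: "\<bar>X\<bar> \<le> d * ((1 + 1 / \<kappa>) * (1 + W))"
  shows "(1 + \<delta>) * (W - l * (\<theta> / 2 * N) - 2 * l * X + l * (6 / \<kappa>) * (d^2 + V)
      + l^2 / \<delta> * C * (\<alpha>^2 * (1 + W + d^2 + V) + \<beta>^2 + Eb + Ec))
    \<le> W + (\<delta> + (1 + \<delta>) * ((6 / \<kappa> * (1 + K) + 2 * (1 + 1 / \<kappa>)) * S + C * (1 + K * t0) * \<delta>)) * (1 + W)
       - \<theta> / 2 * (l * N)"
proof -
  have sq: "sqrt l * sqrt l = l" "0 < sqrt l" using l by auto
  have l_le: "l \<le> sqrt l" using l sq by (metis mult_le_cancel_left1 mult_left_le real_sqrt_le_1_iff less_imp_le)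
  have \<delta>e: "0 < \<delta>" unfolding \<delta>_def using l nn by (intro add_nonneg_pos add_nonneg_nonneg mult_nonneg_nonneg) auto
  have S_parts: "l * d \<le> S" "\<tau> \<le> S" "l * \<zeta> + l * d^2 + \<tau> \<le> S"
  proof -
    have e1: "sqrt (l * \<zeta>) * sqrt (l * \<zeta>) = l * \<zeta>" using l nn by simp
    have e2: "(sqrt l * d) * (sqrt l * d) = l * d^2" using sq(1) by (simp add: power2_eq_square algebra_simps)
    have "0 \<le> l * \<zeta>" "0 \<le> l * d^2" "l * d \<le> sqrt l * d" "0 \<le> l * d"
      using l nn l_le by (auto intro: mult_right_mono)
    then show "l * d \<le> S" "\<tau> \<le> S" "l * \<zeta> + l * d^2 + \<tau> \<le> S" unfolding S_def e1 e2 using nn by linarith+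
  qed
  \<comment> \<open>A square of a sum of nonnegative numbers dominates the sum of the squares. The
    term in \<open>\<alpha>\<close> alone uses \<open>l^2\<close> \<le> \<open>l\<close>, which is
    why its weight is \<open>sqrt l\<close>; \<open>e\<close> only keeps \<open>\<delta>\<close>
    positive.\<close>
  have squares: "l^2 * \<alpha>^2 + l^2 * \<alpha>^2 * d^2 + l^2 * \<alpha>^2 * \<zeta> + l^2 * \<beta>^2 + l^2 * Eb + l^2 * Ec + e^2 \<le> \<delta>^2"
  proof -
    have 1: "l^2 * \<alpha>^2 \<le> (sqrt l * \<alpha>)^2"
    proof -
      have "l^2 \<le> l" using l by (simp add: power2_eq_square mult_left_le)
      then show ?thesis using l by (simp add: power_mult_distrib mult_right_mono)
    qed
    have 2: "l^2 * \<alpha>^2 * d^2 = ((sqrt l * \<alpha>) * (sqrt l * d))^2"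
      using l by (simp add: power_mult_distrib) (simp add: power2_eq_square)
    have 3: "l^2 * \<alpha>^2 * \<zeta> = ((sqrt l * \<alpha>) * sqrt (l * \<zeta>))^2"
      using l nn by (simp add: power_mult_distrib) (simp add: power2_eq_square)
    have 4: "l^2 * \<beta>^2 = (l * \<beta>)^2" "l^2 * Eb = (l * \<bar>sqrt Eb\<bar>)^2" "l^2 * Ec = (l * \<bar>sqrt Ec\<bar>)^2"
      using nn by (simp_all add: power_mult_distrib)
    show ?thesis
      unfolding 2 3 4 \<delta>_def using l nn
      by (intro add_square_le 1 add_nonneg_nonneg mult_nonneg_nonneg) auto
  qed
  let ?T = "l^2 * \<alpha>^2 * (1 + W + d^2 + V) + l^2 * \<beta>^2 + l^2 * Eb + l^2 * Ec"
  \<comment> \<open>Here \<open>\<tau>\<close> may be replaced by its bound \<open>t0\<close>,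
    because \<open>\<delta>^2\<close> already carries the smallness. In \<open>T3\<close> no such
    factor is present and \<open>\<tau>\<close> itself is kept, as part of \<open>S\<close>.\<close>
  have T: "?T \<le> \<delta>^2 * ((1 + K * t0) * (1 + W))"
  proof -
    have nonneg: "0 \<le> l^2 * \<alpha>^2" "0 \<le> l^2 * \<alpha>^2 * d^2" "0 \<le> l^2 * \<alpha>^2 * \<zeta>" "0 \<le> l^2 * \<beta>^2" "0 \<le> l^2 * Eb" "0 \<le> l^2 * Ec" "0 \<le> e^2"
      using nn by auto
    have la: "l^2 * \<alpha>^2 \<le> \<delta>^2" using squares nonneg by linarith
    have "l^2 * \<alpha>^2 * V \<le> l^2 * \<alpha>^2 * (K * \<tau> * W + \<zeta>)" using V by (intro mult_left_mono) auto
    moreover have "l^2 * \<alpha>^2 * (K * \<tau> * W) \<le> \<delta>^2 * (K * t0 * W)"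
      using la nn WN by (intro mult_mono mult_right_mono mult_left_mono mult_nonneg_nonneg) auto
    moreover have "l^2 * \<alpha>^2 * W \<le> \<delta>^2 * W" using la WN by (intro mult_right_mono)
    moreover have "0 \<le> \<delta>^2 * (K * t0)" using nn by auto
    moreover have "\<delta>^2 * ((1 + K * t0) * (1 + W)) = \<delta>^2 + \<delta>^2 * W + \<delta>^2 * (K * t0) + \<delta>^2 * (K * t0 * W)"
      by (simp add: algebra_simps)
    moreover have "?T = l^2 * \<alpha>^2 + l^2 * \<alpha>^2 * W + l^2 * \<alpha>^2 * d^2 + l^2 * \<alpha>^2 * V + l^2 * \<beta>^2 + l^2 * Eb + l^2 * Ec"
      by (simp add: algebra_simps)
    moreover have "l^2 * \<alpha>^2 * (K * \<tau> * W + \<zeta>) = l^2 * \<alpha>^2 * (K * \<tau> * W) + l^2 * \<alpha>^2 * \<zeta>"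
      by (rule distrib_left)
    ultimately show ?thesis using squares nonneg by linarith
  qed
  have T2: "l^2 / \<delta> * C * (\<alpha>^2 * (1 + W + d^2 + V) + \<beta>^2 + Eb + Ec) \<le> C * (1 + K * t0) * \<delta> * (1 + W)"
  proof -
    have "l^2 / \<delta> * C * (\<alpha>^2 * (1 + W + d^2 + V) + \<beta>^2 + Eb + Ec) = C / \<delta> * ?T"
      by (simp add: distrib_left mult_ac)
    also have "\<dots> \<le> C / \<delta> * (\<delta>^2 * ((1 + K * t0) * (1 + W)))"
      using pos \<delta>e by (intro mult_left_mono T) auto
    also have "\<dots> = C * (1 + K * t0) * \<delta> * (1 + W)" using \<delta>e by (simp add: power2_eq_square)
    finally show ?thesis .
  qed
  have T3: "l * (6 / \<kappa>) * (d^2 + V) \<le> 6 / \<kappa> * (1 + K) * S * (1 + W)"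
  proof -
    have "l * V \<le> l * (K * \<tau> * W + \<zeta>)" using V l by (intro mult_left_mono) auto
    moreover have "l * (K * \<tau> * W) \<le> 1 * (K * S * W)"
      using l nn WN S_parts by (intro mult_mono mult_nonneg_nonneg) auto
    ultimately have "l * (d^2 + V) \<le> S + K * S * W"
      using S_parts(3) nn by (simp add: distrib_left)
    also have "\<dots> \<le> (1 + K) * S * (1 + W)"
    proof -
      have "0 \<le> S" using S_parts(2) nn by linarith
      then have "0 \<le> K * S" "0 \<le> S * W" using nn WN by auto
      then show ?thesis by (simp add: algebra_simps)
    qed
    finally have "6 / \<kappa> * (l * (d^2 + V)) \<le> 6 / \<kappa> * ((1 + K) * S * (1 + W))"
      using pos by (intro mult_left_mono) auto
    then show ?thesis by (simp only: mult_ac)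
  qed
  have T4: "- 2 * l * X \<le> 2 * (1 + 1 / \<kappa>) * S * (1 + W)"
  proof -
    have "2 * l * (- X) \<le> 2 * l * \<bar>X\<bar>" using l by (intro mult_left_mono) auto
    then have "- 2 * l * X \<le> 2 * l * \<bar>X\<bar>" by simp
    also have "\<dots> \<le> 2 * l * (d * ((1 + 1 / \<kappa>) * (1 + W)))" using X l by (intro mult_left_mono) auto
    also have "\<dots> = (l * d) * (2 * ((1 + 1 / \<kappa>) * (1 + W)))" by (simp only: mult_ac)
    also have "\<dots> \<le> S * (2 * ((1 + 1 / \<kappa>) * (1 + W)))" using S_parts(1) WN pos by (intro mult_right_mono) auto
    also have "\<dots> = 2 * (1 + 1 / \<kappa>) * S * (1 + W)" by (simp only: mult_ac)
    finally show ?thesis .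
  qed
  define R where "R = (6 / \<kappa> * (1 + K) + 2 * (1 + 1 / \<kappa>)) * S + C * (1 + K * t0) * \<delta>"
  have "R * (1 + W) = 6 / \<kappa> * (1 + K) * S * (1 + W) + 2 * (1 + 1 / \<kappa>) * S * (1 + W) + C * (1 + K * t0) * \<delta> * (1 + W)"
    unfolding R_def by (simp only: distrib_right)
  then have "W - l * (\<theta> / 2 * N) - 2 * l * X + l * (6 / \<kappa>) * (d^2 + V)
      + l^2 / \<delta> * C * (\<alpha>^2 * (1 + W + d^2 + V) + \<beta>^2 + Eb + Ec) \<le> W - l * (\<theta> / 2 * N) + R * (1 + W)"
    using T2 T3 T4 by linarith
  then have "(1 + \<delta>) * (W - l * (\<theta> / 2 * N) - 2 * l * X + l * (6 / \<kappa>) * (d^2 + V)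
      + l^2 / \<delta> * C * (\<alpha>^2 * (1 + W + d^2 + V) + \<beta>^2 + Eb + Ec)) \<le> (1 + \<delta>) * (W - l * (\<theta> / 2 * N) + R * (1 + W))"
    using \<delta>e by (intro mult_left_mono) auto
  also have "\<dots> = W + \<delta> * W - (l * (\<theta> / 2 * N)) - \<delta> * (l * (\<theta> / 2 * N)) + (1 + \<delta>) * R * (1 + W)"
    by (simp add: algebra_simps)
  also have "\<dots> \<le> W + \<delta> * (1 + W) - \<theta> / 2 * (l * N) + (1 + \<delta>) * R * (1 + W)"
  proof -
    have "0 \<le> \<delta> * (l * (\<theta> / 2 * N))" using \<delta>e l pos WN by auto
    moreover have "\<delta> * (1 + W) = \<delta> + \<delta> * W" by (simp add: distrib_left)
    moreover have "l * (\<theta> / 2 * N) = \<theta> / 2 * (l * N)" by simp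
    ultimately show ?thesis using \<delta>e by linarith
  qed
  also have "\<dots> = W + (\<delta> + (1 + \<delta>) * R) * (1 + W) - \<theta> / 2 * (l * N)" by (simp add: distrib_right)
  finally show ?thesis unfolding R_def .
qed

context stochastic_primal_dual
begin

text \<open>\<open>\<delta>\<close> is a function of the past, so all coefficients factor out. Its
  deterministic lower bound makes them bounded for each fixed \<open>n\<close>, which secures
  integrability of every product.\<close>

lemma descent_conditional:
  assumes p: "p \<in> feasible" "T p = p"
    and C: "\<And>n w V \<delta>. w \<in> space M \<Longrightarrow> 0 < \<delta> \<Longrightarrow>
      Q (z (Suc n) w - p) / (1 + \<delta>) \<le> pathwise_bound p C n w V \<delta>"
    and \<delta>: "\<delta> \<in> borel_measurable (F n)" "\<And>w. w \<in> space M \<Longrightarrow> (1 / 2) ^ n \<le> \<delta> w"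
  shows "AE w in M. CE n (\<lambda>w. Q (z (Suc n) w - p)) w \<le> (1 + \<delta> w) *
    descent_bound p C n w (\<delta> w) ((U n w - gz n w) \<bullet> (fst (T (z n w)) - fst p)) (norm (U n w - gz n w))
      (CE2 n (\<lambda>w. u n w - U n w) w) (CE2 n (b n) w)
      (CE2 n (c n) w)"
proof -
  interpret F: sigma_finite_subalgebra M "F n" by (rule sigma_finite_subalg)
  note i = integrable_of_z_L2[OF z_L2 p, of n]
  define g where "g w = fst (T (z n w)) - fst p" for w
  define W where "W w = Q (z n w - p)" for w
  define d where "d w = (norm (U n w - gz n w))^2" for w
  define D where "D w = (norm (u n w - U n w))^2" for w
  define k2 where "k2 w = (l n)^2 / \<delta> w * C" for w
  define k1 where "k1 w = l n * (6 / \<kappa>) + k2 w * (\<alpha> n)^2" for w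
  define A where "A w = W w - l n * (\<theta> / 2 * Q (z n w - T (z n w))) + l n * (6 / \<kappa>) * d w
     + k2 w * ((\<alpha> n)^2 * (1 + W w + d w) + (\<beta> n)^2)" for w
  have [measurable]: "\<delta> \<in> borel_measurable (F n)" by (rule \<delta>)
  have \<delta>pos: "0 < \<delta> w" if "w \<in> space M" for w
    by (rule less_le_trans[OF _ \<delta>(2)[OF that]]) simp
  have k2F: "k2 \<in> borel_measurable (F n)" unfolding k2_def by measurable
  have k1F: "k1 \<in> borel_measurable (F n)" unfolding k1_def using k2F by measurable
  have k2b: "\<bar>k2 w\<bar> \<le> 2 ^ n * \<bar>C\<bar>" if w: "w \<in> space M" for w
  proof -
    have "(l n)^2 / \<delta> w \<le> 1 / (1 / 2) ^ n"
      using l(1,2)[of n] \<delta>(2)[OF w] by (intro frac_le) (auto simp: power_le_one)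
    then have "(l n)^2 / \<delta> w \<le> 2 ^ n" by (simp add: power_divide)
    then have "(l n)^2 / \<delta> w * \<bar>C\<bar> \<le> 2 ^ n * \<bar>C\<bar>" by (rule mult_right_mono) simp
    then show ?thesis using \<delta>pos[OF w] by (simp add: k2_def abs_mult)
  qed
  have k1b: "\<bar>k1 w\<bar> \<le> l n * (6 / \<kappa>) + 2 ^ n * \<bar>C\<bar> * (\<alpha> n)^2" if w: "w \<in> space M" for w
  proof -
    have "\<bar>k1 w\<bar> \<le> \<bar>l n * (6 / \<kappa>)\<bar> + \<bar>k2 w\<bar> * (\<alpha> n)^2"
      unfolding k1_def using abs_triangle_ineq[of "l n * (6 / \<kappa>)" "k2 w * (\<alpha> n)^2"] by (simp add: abs_mult)
    also have "\<dots> \<le> l n * (6 / \<kappa>) + 2 ^ n * \<bar>C\<bar> * (\<alpha> n)^2"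
      using k2b[OF w] l(1)[of n] \<kappa>_pos by (intro add_mono mult_right_mono) auto
    finally show ?thesis .
  qed
  note k1M = measurable_F_M[OF k1F] and k2M = measurable_F_M[OF k2F]
  have WF: "W \<in> borel_measurable (F n)" and dF: "d \<in> borel_measurable (F n)"
    and NF: "(\<lambda>w. Q (z n w - T (z n w))) \<in> borel_measurable (F n)"
  proof -
    have [measurable]: "z n \<in> borel_measurable (F n)" "U n \<in> borel_measurable (F n)" "gz n \<in> borel_measurable (F n)"
      "(\<lambda>w. T (z n w)) \<in> borel_measurable (F n)"
      by (rule z_F U_F gz_F Tz_F)+
    show "W \<in> borel_measurable (F n)" unfolding W_def by measurable
    show "d \<in> borel_measurable (F n)" unfolding d_def by measurable
    show "(\<lambda>w. Q (z n w - T (z n w))) \<in> borel_measurable (F n)" by measurable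
  qed
  have iW: "integrable M W" and id: "integrable M d" and iD: "integrable M D"
    unfolding W_def d_def D_def using i by auto
  have iA: "integrable M A"
    unfolding A_def using iW id i(2)
    by (intro integrable_plus integrable_minus integrable_mult_right
        integrable_bounded_mult[OF _ k2M k2b] integrable_const) auto
  have AF: "A \<in> borel_measurable (F n)"
    unfolding A_def using WF dF NF k2F
    by (intro borel_measurable_add borel_measurable_diff borel_measurable_times borel_measurable_const)
  have gF: "g \<in> borel_measurable (F n)" unfolding g_def by (rule fst_Tz_F)
  \<comment> \<open>The terms not known at time \<open>n\<close> are added one at a time, each with
    a coefficient measurable with respect to \<open>F n\<close>, and are later removed in the
    reverse order by \<open>real_cond_exp_add_mult\<close>.\<close>
  define Y1 where "Y1 w = A w + (- 2 * l n) * ((u n w - gz n w) \<bullet> g w)" for w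
  define Y2 where "Y2 w = Y1 w + k1 w * D w" for w
  define Y3 where "Y3 w = Y2 w + k2 w * (norm (b n w))^2" for w
  define Y4 where "Y4 w = Y3 w + k2 w * (norm (c n w))^2" for w
  have bound_eq: "pathwise_bound p C n w (U n w) (\<delta> w) = Y4 w" for w
    unfolding Y4_def Y3_def Y2_def Y1_def
    unfolding descent_bound_def A_def k1_def W_def[symmetric] d_def[symmetric] D_def[symmetric] g_def[symmetric]
      k2_def[symmetric]
    by (simp add: algebra_simps add_divide_distrib)
  have i0: "integrable M (\<lambda>w. (- 2 * l n) * ((u n w - gz n w) \<bullet> g w))"
    unfolding g_def using i(7) by (intro integrable_mult_right)
  have i1: "integrable M (\<lambda>w. k1 w * D w)" by (rule integrable_bounded_mult[OF iD k1M k1b])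
  have i2: "integrable M (\<lambda>w. k2 w * (norm (b n w))^2)" "integrable M (\<lambda>w. k2 w * (norm (c n w))^2)"
    by (rule integrable_bounded_mult[OF _ k2M k2b], rule b_L2 c_L2, assumption)+
  have s1: "integrable M Y1" unfolding Y1_def by (rule integrable_plus[OF iA i0])
  have s2: "integrable M Y2" unfolding Y2_def by (rule integrable_plus[OF s1 i1])
  have s3: "integrable M Y3" unfolding Y3_def by (rule integrable_plus[OF s2 i2(1)])
  have s4: "integrable M Y4" unfolding Y4_def by (rule integrable_plus[OF s3 i2(2)])
  have iQ: "integrable M (\<lambda>w. Q (z (Suc n) w - p))" using z_L2[of "Suc n"] by (simp add: integrable_Q_iff)
  have iQ': "integrable M (\<lambda>w. 1 / (1 + \<delta> w) * Q (z (Suc n) w - p))"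
  proof (rule integrable_bounded_mult[OF iQ])
    show "(\<lambda>w. 1 / (1 + \<delta> w)) \<in> borel_measurable M" by (rule measurable_F_M[of _ n]) measurable
    show "\<bar>1 / (1 + \<delta> w)\<bar> \<le> 1" if "w \<in> space M" for w using \<delta>pos[OF that] by simp
  qed
  have hce: "has_cond_exp M (F n) (\<lambda>w. u n w - gz n w) (\<lambda>w. U n w - gz n w)"
  proof -
    have igz: "integrable M (gz n)"
    proof -
      have "integrable M (\<lambda>w. u n w - gz n w)"
        by (rule L2_imp_integrable[OF borel_measurable_diff[OF u gz_M] i(4)])
      with L2_imp_integrable[OF u u_L2]
      have "integrable M (\<lambda>w. u n w - (u n w - gz n w))" by (rule integrable_minus)
      then show ?thesis by simp
    qed
    have "(LINT w:B|M. U n w - gz n w) = (LINT w:B|M. u n w - gz n w)" if B: "B \<in> sets (F n)" for B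
    proof -
      have BM: "B \<in> sets M" using B subalg[of n] by (auto simp: subalgebra_def)
      have si: "set_integrable M B X" if "integrable M X" for X :: "'w \<Rightarrow> 'h"
        using that BM by (auto simp: set_integrable_def intro: integrable_mult_indicator)
      show ?thesis
        using has_cond_exp_U[of n] B by (simp add: has_cond_exp_def set_integral_diff si igz)
    qed
    then show ?thesis
      using has_cond_exp_U[of n] igz gz_F[of n] by (auto simp: has_cond_exp_def)
  qed
  have "AE w in M. CE n (\<lambda>w. 1 / (1 + \<delta> w) * Q (z (Suc n) w - p)) w
      = 1 / (1 + \<delta> w) * CE n (\<lambda>w. Q (z (Suc n) w - p)) w"
    using iQ iQ' by (intro F.real_cond_exp_mult) auto
  moreover have "AE w in M. CE n (\<lambda>w. 1 / (1 + \<delta> w) * Q (z (Suc n) w - p)) w \<le> CE n Y4 w"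
  proof (rule F.real_cond_exp_mono[OF AE_I2 iQ' s4])
    show "1 / (1 + \<delta> w) * Q (z (Suc n) w - p) \<le> Y4 w" if "w \<in> space M" for w
      using C[OF that \<delta>pos[OF that], of n "U n w"] by (simp add: bound_eq)
  qed
  moreover have "AE w in M. CE n Y4 w = CE n Y3 w + k2 w * CE2 n (c n) w"
    using i2 unfolding Y4_def[abs_def] by (intro F.real_cond_exp_add_mult[OF s3 k2F]) auto
  moreover have "AE w in M. CE n Y3 w = CE n Y2 w + k2 w * CE2 n (b n) w"
    using i2 unfolding Y3_def[abs_def] by (intro F.real_cond_exp_add_mult[OF s2 k2F]) auto
  moreover have "AE w in M. CE n Y2 w = CE n Y1 w + k1 w * CE n D w"
    using i1 iD unfolding Y2_def[abs_def] by (intro F.real_cond_exp_add_mult[OF s1 k1F]) auto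
  moreover have "AE w in M. CE n Y1 w = CE n A w + (- 2 * l n) * CE n (\<lambda>w. (u n w - gz n w) \<bullet> g w) w"
    using i0 i(7) unfolding Y1_def[abs_def] by (intro F.real_cond_exp_add_mult[OF iA]) (auto simp: g_def)
  moreover have "AE w in M. CE n A w = A w"
    by (rule F.real_cond_exp_F_meas[OF iA AF])
  \<comment> \<open>The noise \<open>u - U\<close> vanishes from the cross term here, because
    \<open>g\<close> is known at time \<open>n\<close>; only the bias remains.\<close>
  moreover have "AE w in M. CE n (\<lambda>w. (u n w - gz n w) \<bullet> g w) w = (U n w - gz n w) \<bullet> g w"
    using i(3) by (intro F.real_cond_exp_inner[OF hce gF i(4)]) (simp add: g_def)
  ultimately show ?thesis
    using AE_space
  proof eventually_elim
    case (elim w)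
    let ?B = "A w + (- 2 * l n) * ((U n w - gz n w) \<bullet> g w) + k1 w * CE n D w
      + k2 w * CE2 n (b n) w + k2 w * CE2 n (c n) w"
    have "1 / (1 + \<delta> w) * CE n (\<lambda>w. Q (z (Suc n) w - p)) w \<le> ?B"
      using elim(1-7) unfolding elim(8) by linarith
    then have "CE n (\<lambda>w. Q (z (Suc n) w - p)) w \<le> (1 + \<delta> w) * ?B"
      using \<delta>pos[OF \<open>w \<in> space M\<close>] by (simp add: divide_le_eq mult.commute)
    also have "?B = descent_bound p C n w (\<delta> w) ((U n w - gz n w) \<bullet> (fst (T (z n w)) - fst p))
        (norm (U n w - gz n w)) (CE n D w) (CE2 n (b n) w) (CE2 n (c n) w)"
      unfolding descent_bound_def A_def k1_def W_def[symmetric] d_def[symmetric] g_def[symmetric] k2_def[symmetric]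
      by (simp add: algebra_simps add_divide_distrib)
    finally show ?case unfolding D_def[abs_def] .
  qed
qed

end

context stochastic_primal_dual
begin

text \<open>The variance hypothesis is available since \<open>fst p\<close> is a primal solution by
  \<open>fixed_point_primal\<close>. The sequences are then combined so that
  \<open>descent_arithmetic\<close> applies at almost every point.\<close>

lemma recursion_at_fixed_point:
  assumes p: "p \<in> feasible" "T p = p"
  shows "\<exists>X t. 0 < (t::real) \<and> (\<forall>n. X n \<in> borel_measurable (F n)) \<and>
        (\<forall>n. \<forall>w\<in>space M. 0 \<le> X n w) \<and> (AE w in M. summable (\<lambda>n. X n w)) \<and>
        (\<forall>n. AE w in M. CE n (\<lambda>w. Q (z (Suc n) w - p)) w
            \<le> Q (z n w - p) + X n w * (1 + Q (z n w - p)) - t * (l n * Q (z n w - T (z n w))))"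
proof -
  obtain C where C: "0 < C" "\<And>n w V \<delta>. w \<in> space M \<Longrightarrow> 0 < \<delta> \<Longrightarrow>
      Q (z (Suc n) w - p) / (1 + \<delta>) \<le> pathwise_bound p C n w V \<delta>"
    using descent_pathwise[OF p] by blast
  obtain \<zeta> where \<zeta>: "\<And>n. \<zeta> n \<in> borel_measurable (F n)" "\<And>n w. w \<in> space M \<Longrightarrow> 0 \<le> \<zeta> n w"
      "AE w in M. summable (\<lambda>n. sqrt (l n * \<zeta> n w))"
      "\<And>n. AE w in M. CE2 n (\<lambda>w. u n w - U n w) w
           \<le> \<tau> n * (norm (gz n w - grad_h (fst p)))^2 + \<zeta> n w"
    using u_var[OF fixed_point_primal[OF p]]
    unfolding U_def ell_plus_infty_def ell_plus_half_def ell_plus_def by blast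
  define d where "d n w = norm (U n w - gz n w)" for n w
  define Eb where "Eb n = CE2 n (b n)" for n
  define Ec where "Ec n = CE2 n (c n)" for n
  \<comment> \<open>Conditional expectations of squares are nonnegative only almost everywhere, and
    \<open>sqrt\<close> of a negative number is negative. The absolute values and the summable term
    \<open>(1 / 2) ^ n\<close> make the lower bound required by \<open>descent_conditional\<close>
    hold at every point.\<close>
  define \<delta> where "\<delta> n w = sqrt (l n) * \<alpha> n + (sqrt (l n) * \<alpha> n) * (sqrt (l n) * d n w)
      + (sqrt (l n) * \<alpha> n) * sqrt (l n * \<zeta> n w) + l n * \<beta> n
      + l n * \<bar>sqrt (Eb n w)\<bar> + l n * \<bar>sqrt (Ec n w)\<bar> + (1 / 2) ^ n" for n w
  define S where "S n w = sqrt (l n) * d n w + \<tau> n + sqrt (l n * \<zeta> n w) * sqrt (l n * \<zeta> n w)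
      + (sqrt (l n) * d n w) * (sqrt (l n) * d n w)" for n w
  \<comment> \<open>From the Lipschitz constant 1 / \<mu> of the gradient, squared, and from
    \<open>Q_ge_primal\<close>: it converts the gradient difference in the variance bound into
    \<open>Q (z n w - p)\<close>.\<close>
  define K where "K = 1 / (\<mu>^2 * \<kappa>)"
  define t0 where "t0 = suminf \<tau>"
  define K5 where "K5 = 6 / \<kappa> * (1 + K) + 2 * (1 + 1 / \<kappa>)"
  define K4 where "K4 = C * (1 + K * t0)"
  define X where "X n w = \<delta> n w + (1 + \<delta> n w) * (K5 * S n w + K4 * \<delta> n w)" for n w
  have K0: "0 \<le> K" using \<mu> \<kappa>_pos by (simp add: K_def)
  have t0: "0 \<le> t0" "\<tau> n \<le> t0" for n
    using \<tau> sum_le_suminf[OF \<tau>(2), of "{n}"] by (auto simp: t0_def suminf_nonneg)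
  have K45: "0 \<le> K4" "0 \<le> K5"
    unfolding K4_def K5_def using K0 t0(1) C(1) \<kappa>_pos by (auto intro!: add_nonneg_nonneg mult_nonneg_nonneg)
  have l0: "0 \<le> l n" for n using l(1)[of n] by simp
  have \<delta>S: "(1 / 2) ^ n \<le> \<delta> n w" "0 \<le> S n w" if w: "w \<in> space M" for n w
  proof -
    have "0 \<le> sqrt (l n) * \<alpha> n" "0 \<le> sqrt (l n) * d n w" "0 \<le> sqrt (l n * \<zeta> n w)" "0 \<le> l n * \<beta> n"
      "0 \<le> l n * \<bar>sqrt (Eb n w)\<bar>" "0 \<le> l n * \<bar>sqrt (Ec n w)\<bar>"
      using l0[of n] \<alpha>(1)[of n] \<beta>(1)[of n] \<zeta>(2)[OF w, of n] by (auto simp: d_def)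
    then show "(1 / 2) ^ n \<le> \<delta> n w" "0 \<le> S n w"
      unfolding \<delta>_def S_def using \<tau>(1)[of n] by (auto intro!: add_nonneg_nonneg mult_nonneg_nonneg)
  qed
  have \<delta>pos: "0 < \<delta> n w" if w: "w \<in> space M" for n w
    by (rule less_le_trans[OF _ \<delta>S(1)[OF w]]) simp
  have [measurable]: "d n \<in> borel_measurable (F n)" "Eb n \<in> borel_measurable (F n)" "Ec n \<in> borel_measurable (F n)"
    "\<zeta> n \<in> borel_measurable (F n)" for n
    using U_F[of n] gz_F[of n] \<zeta>(1)[of n] unfolding d_def Eb_def Ec_def by auto
  have \<delta>F [measurable]: "\<delta> n \<in> borel_measurable (F n)" and [measurable]: "S n \<in> borel_measurable (F n)" for n
    unfolding \<delta>_def[abs_def] S_def[abs_def] by measurable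
  have "0 < \<theta> / 2" using \<theta>_pos by simp
  moreover have "\<forall>n. X n \<in> borel_measurable (F n)" unfolding X_def[abs_def] by measurable
  moreover have "\<forall>n. \<forall>w\<in>space M. 0 \<le> X n w"
    unfolding X_def using \<delta>S(2) \<delta>pos K45
    by (intro allI ballI add_nonneg_nonneg mult_nonneg_nonneg) (auto intro: less_imp_le)
  moreover have "AE w in M. summable (\<lambda>n. X n w)"
  proof -
    have nnE: "AE w in M. \<forall>n. 0 \<le> Eb n w \<and> 0 \<le> Ec n w"
    proof (subst AE_all_countable, rule allI)
      fix n
      interpret F: sigma_finite_subalgebra M "F n" by (rule sigma_finite_subalg)
      have "AE w in M. 0 \<le> Eb n w" "AE w in M. 0 \<le> Ec n w"
        unfolding Eb_def Ec_def by (auto intro!: F.real_cond_exp_pos)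
      then show "AE w in M. 0 \<le> Eb n w \<and> 0 \<le> Ec n w" by eventually_elim simp
    qed
    show ?thesis
      using nnE b_sum c_sum u_bias \<zeta>(3) AE_space
    proof eventually_elim
      case (elim w)
      note w = \<open>w \<in> space M\<close>
      have sd: "summable (\<lambda>n. sqrt (l n) * d n w)" using elim(4) by (simp add: d_def U_def)
      have sb: "summable (\<lambda>n. l n * \<bar>sqrt (Eb n w)\<bar>)" and sc: "summable (\<lambda>n. l n * \<bar>sqrt (Ec n w)\<bar>)"
        using elim(1-3) by (simp_all add: Eb_def Ec_def)
      have nn: "0 \<le> sqrt (l n) * \<alpha> n" "0 \<le> sqrt (l n) * d n w" "0 \<le> sqrt (l n * \<zeta> n w)" for n
        using l0[of n] \<alpha>(1)[of n] \<zeta>(2)[OF w, of n] by (auto simp: d_def)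
      have s\<delta>: "summable (\<lambda>n. \<delta> n w)"
        unfolding \<delta>_def
        by (intro summable_add summable_mult_nonneg \<alpha>(2) \<beta>(2) sd sb sc elim(5) nn summable_geometric) simp
      have sS: "summable (\<lambda>n. S n w)"
        unfolding S_def by (intro summable_add summable_mult_nonneg sd \<tau>(2) elim(5) nn)
      have sR: "summable (\<lambda>n. K5 * S n w + K4 * \<delta> n w)"
        by (intro summable_add summable_mult sS s\<delta>)
      have "summable (\<lambda>n. \<delta> n w + ((K5 * S n w + K4 * \<delta> n w) + \<delta> n w * (K5 * S n w + K4 * \<delta> n w)))"
      proof (rule summable_add[OF s\<delta> summable_add[OF sR summable_mult_nonneg[OF s\<delta> _ sR]]])
        show "0 \<le> \<delta> n w" for n using \<delta>pos[OF w, of n] by simp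
        then show "0 \<le> K5 * S n w + K4 * \<delta> n w" for n using \<delta>S(2)[OF w] K45 by simp
      qed
      moreover have "X n w = \<delta> n w + ((K5 * S n w + K4 * \<delta> n w) + \<delta> n w * (K5 * S n w + K4 * \<delta> n w))" for n
        by (simp only: X_def distrib_right mult_1_left)
      ultimately show ?case by (simp only:)
    qed
  qed
  moreover have "\<forall>n. AE w in M. CE n (\<lambda>w. Q (z (Suc n) w - p)) w
            \<le> Q (z n w - p) + X n w * (1 + Q (z n w - p)) - \<theta> / 2 * (l n * Q (z n w - T (z n w)))"
  proof
    fix n
    interpret F: sigma_finite_subalgebra M "F n" by (rule sigma_finite_subalg)
    have "AE w in M. 0 \<le> Eb n w" "AE w in M. 0 \<le> Ec n w"
      unfolding Eb_def Ec_def by (auto intro!: F.real_cond_exp_pos)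
    moreover have "AE w in M. CE n (\<lambda>w. Q (z (Suc n) w - p)) w \<le> (1 + \<delta> n w) * descent_bound p C n w (\<delta> n w)
        ((U n w - gz n w) \<bullet> (fst (T (z n w)) - fst p)) (d n w) (CE2 n (\<lambda>w. u n w - U n w) w) (Eb n w) (Ec n w)"
      unfolding d_def Eb_def Ec_def
      by (rule descent_conditional[OF p]) (fact C(2) \<delta>F \<delta>S(1))+
    ultimately show "AE w in M. CE n (\<lambda>w. Q (z (Suc n) w - p)) w
            \<le> Q (z n w - p) + X n w * (1 + Q (z n w - p)) - \<theta> / 2 * (l n * Q (z n w - T (z n w)))"
      using \<zeta>(4)[of n] AE_space
    proof eventually_elim
      case (elim w)
      note w = \<open>w \<in> space M\<close>
      let ?W = "Q (z n w - p)" and ?V = "CE2 n (\<lambda>w. u n w - U n w) w"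
      let ?g = "fst (T (z n w)) - fst p"
      have V: "?V \<le> K * \<tau> n * ?W + \<zeta> n w"
      proof -
        have "(norm (gz n w - grad_h (fst p)))^2 \<le> (norm (fst (z n w) - fst p) / \<mu>)^2"
          by (intro power_mono grad_h_Lipschitz) simp
        also have "\<dots> \<le> K * ?W"
          using Q_ge_primal[of "z n w - p"] \<kappa>_pos \<mu> by (simp add: K_def power_divide field_simps)
        finally have "\<tau> n * (norm (gz n w - grad_h (fst p)))^2 \<le> \<tau> n * (K * ?W)"
          using \<tau>(1) by (intro mult_left_mono)
        then show ?thesis using \<open>?V \<le> _\<close> by (simp add: mult_ac)
      qed
      have "\<bar>(U n w - gz n w) \<bullet> ?g\<bar> \<le> d n w * norm ?g"
        unfolding d_def by (rule Cauchy_Schwarz_ineq2)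
      also have "\<dots> \<le> d n w * ((1 + 1 / \<kappa>) * (1 + ?W))"
      proof (rule mult_left_mono)
        \<comment> \<open>The bias enters to first order, against a vector of size
          \<open>sqrt Q\<close>; bounding a norm by 1 plus its square brings it into the form
          \<open>1 + Q\<close> of the recursion.\<close>
        have "\<kappa> * (norm ?g)^2 \<le> ?W"
          using T_Fejer[OF z_feasible[OF w] p, of n] Q_ge_primal[of "T (z n w) - p"] by simp
        then have "(norm ?g)^2 \<le> 1 / \<kappa> * ?W" using \<kappa>_pos by (simp add: field_simps)
        moreover have "norm ?g \<le> 1 + (norm ?g)^2" using mult_le_sum_squares[of 1 "norm ?g"] by simp
        moreover have "(1 + 1 / \<kappa>) * (1 + ?W) = 1 + ?W + 1 / \<kappa> + 1 / \<kappa> * ?W" by (simp add: algebra_simps)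
        moreover have "0 \<le> 1 / \<kappa>" "0 \<le> ?W" using \<kappa>_pos Q_nonneg by auto
        ultimately show "norm ?g \<le> (1 + 1 / \<kappa>) * (1 + ?W)" by linarith
      qed (simp add: d_def)
      finally have inner: "\<bar>(U n w - gz n w) \<bullet> ?g\<bar> \<le> d n w * ((1 + 1 / \<kappa>) * (1 + ?W))" .
      have d0: "0 \<le> d n w" by (simp add: d_def)
      have "CE n (\<lambda>w. Q (z (Suc n) w - p)) w
          \<le> (1 + \<delta> n w) * descent_bound p C n w (\<delta> n w) ((U n w - gz n w) \<bullet> ?g) (d n w) ?V (Eb n w) (Ec n w)"
        by (rule elim(3))
      also have "\<dots> \<le> ?W + X n w * (1 + ?W) - \<theta> / 2 * (l n * Q (z n w - T (z n w)))"
        unfolding descent_bound_def X_def K4_def K5_def S_def \<delta>_def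
        by (rule descent_arithmetic[OF Q_nonneg Q_nonneg \<theta>_pos \<kappa>_pos C(1) l(1,2) \<alpha>(1) \<beta>(1) d0 \<zeta>(2)[OF w] \<tau>(1)
              t0(2) K0 _ _ _ V inner])
           (use elim in auto)
      finally show ?case .
    qed
  qed
  ultimately show ?thesis by blast
qed

theorem converges_to_fixed_point:
  "\<exists>Z\<in>borel_measurable M. (\<forall>w\<in>space M. Z w \<in> feasible \<and> T (Z w) = Z w) \<and>
     (AE w in M. (\<lambda>n. z n w) \<longlonglongrightarrow> Z w)"
proof -
  obtain m where m: "0 < m" "\<And>w. m * (norm w)^2 \<le> Q w" using Q_coercive by blast
  show ?thesis
  proof (rule stochastic_quasi_Fejer[OF m Q_0 continuous_on_Q closed_feasible z_feasible continuous_on_T z_F])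
    show "integrable M (\<lambda>w. Q (z n w - p))" for n p
      using z_L2[of n] by (simp add: integrable_Q_iff)
  qed (use l(3) fixed_point_exists less_imp_le[OF l(1)] recursion_at_fixed_point in auto)
qed

end

section \<open>The coupled algorithm as an instance of the perturbed iteration\<close>

theorem proposition3p3:
  fixes f :: "'h::euclidean_space \<Rightarrow> ereal"
    and h :: "'h \<Rightarrow> real"
    and grad_h :: "'h \<Rightarrow> 'h"
    and G :: "'q::finite \<Rightarrow> 'g::euclidean_space set"
    and g :: "'q \<Rightarrow> 'g \<Rightarrow> ereal"
    and L :: "'q \<Rightarrow> 'h \<Rightarrow> 'g"
    and \<mu> \<rho> :: real
    and \<sigma> :: "'q \<Rightarrow> real"
    and M :: "'w measure"
    and fn :: "nat \<Rightarrow> 'h \<Rightarrow> ereal"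
    and l :: "nat \<Rightarrow> real"
    and x y u b :: "nat \<Rightarrow> 'w \<Rightarrow> 'h"
    and v w c :: "nat \<Rightarrow> 'w \<Rightarrow> 'g ^ 'q"
    and \<X> :: "nat \<Rightarrow> 'w measure"
  assumes f: "f \<in> Gamma0 UNIV"
    and \<mu>: "0 < \<mu>"
    and h_convex: "convex_on UNIV h"
    and h_grad: "\<And>z. GDERIV h z :> grad_h z"
    and h_lipschitz: "(1 / \<mu>)-lipschitz_on UNIV grad_h"
    and G: "\<And>k. subspace (G k)"
    and g: "\<And>k. g k \<in> Gamma0 (G k)"
    and L_linear: "\<And>k. linear (L k)"
    and L_range: "\<And>k z. L k z \<in> G k"
    and inclusion: "\<exists>z. 0 \<in> subdifferential UNIV f z
          + (\<Sum>k\<in>UNIV. adjoint (L k) ` subdifferential (G k) (g k) (L k z))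
          + {grad_h z}"
    and M: "prob_space M"
    and \<rho>: "0 < \<rho>"
    and fn: "\<And>n. fn n \<in> Gamma0 UNIV"
    and l_range: "\<And>n. l n \<in> {0<..1}"
    and l_sum: "\<not> summable l"
    and \<sigma>: "\<And>k. 0 < \<sigma> k"
    and x0: "x 0 \<in> L2_rv M UNIV"
    and u: "\<And>n. u n \<in> L2_rv M UNIV"
    and b: "\<And>n. b n \<in> L2_rv M UNIV"
    and v0: "v 0 \<in> L2_rv M (hilbert_sum G)"
    and c: "\<And>n. c n \<in> L2_rv M (hilbert_sum G)"
    and y_def: "\<And>n \<omega>. \<omega> \<in> space M \<Longrightarrow>
          y n \<omega> = prox UNIV \<rho> (fn n)
                    (x n \<omega> - \<rho> *\<^sub>R ((\<Sum>k\<in>UNIV. adjoint (L k) (v n \<omega> $ k)) + u n \<omega>)) + b n \<omega>"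
    and x_Suc: "\<And>n \<omega>. \<omega> \<in> space M \<Longrightarrow>
          x (Suc n) \<omega> = x n \<omega> + l n *\<^sub>R (y n \<omega> - x n \<omega>)"
    and w_def: "\<And>n k \<omega>. \<omega> \<in> space M \<Longrightarrow>
          w n \<omega> $ k = prox (G k) (\<sigma> k) (fenchel_conjugate (G k) (g k))
                        (v n \<omega> $ k + \<sigma> k *\<^sub>R L k (2 *\<^sub>R y n \<omega> - x n \<omega>)) + c n \<omega> $ k"
    and v_Suc: "\<And>n k \<omega>. \<omega> \<in> space M \<Longrightarrow>
          v (Suc n) \<omega> $ k = v n \<omega> $ k + l n *\<^sub>R (w n \<omega> $ k - v n \<omega> $ k)"
    and \<X>: "\<And>n. subalgebra M (\<X> n)"
    and a: "\<And>n. sigma_sets (space M)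
                 (\<Union>m\<in>{0..n}. sets (vimage_algebra (space M) (\<lambda>\<omega>. (x m \<omega>, v m \<omega>)) borel))
               \<subseteq> sets (\<X> n)"
           "\<And>n. sets (\<X> n) \<subseteq> sets (\<X> (Suc n))"
    and b_sum: "AE \<omega> in M. summable (\<lambda>n. l n * sqrt (real_cond_exp M (\<X> n) (\<lambda>\<omega>. (norm (b n \<omega>))\<^sup>2) \<omega>))"
    and c_sum: "AE \<omega> in M. summable (\<lambda>n. l n * sqrt (real_cond_exp M (\<X> n) (\<lambda>\<omega>. (norm (c n \<omega>))\<^sup>2) \<omega>))"
    and u_bias: "AE \<omega> in M. summable (\<lambda>n. sqrt (l n) * norm (vec_cond_exp M (\<X> n) (u n) \<omega> - grad_h (x n \<omega>)))"
    and u_var: "\<exists>\<tau> :: nat \<Rightarrow> real. (\<forall>n. 0 \<le> \<tau> n) \<and> summable \<tau> \<and>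
          (\<forall>z \<in> primal_solutions f h g L. \<exists>\<zeta> \<in> ell_plus_infty M \<X>.
             (\<lambda>n \<omega>. l n * \<zeta> n \<omega>) \<in> ell_plus_half M \<X> \<and>
             (\<forall>n. AE \<omega> in M.
                real_cond_exp M (\<X> n) (\<lambda>\<omega>. (norm (u n \<omega> - vec_cond_exp M (\<X> n) (u n) \<omega>))\<^sup>2) \<omega>
                \<le> \<tau> n * (norm (grad_h (x n \<omega>) - grad_h z))\<^sup>2 + \<zeta> n \<omega>))"
    and prox_approx: "\<exists>\<alpha> \<beta> :: nat \<Rightarrow> real. (\<forall>n. 0 \<le> \<alpha> n) \<and> (\<forall>n. 0 \<le> \<beta> n) \<and>
          summable (\<lambda>n. sqrt (l n) * \<alpha> n) \<and> summable (\<lambda>n. l n * \<beta> n) \<and>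
          (\<forall>n z. norm (prox UNIV \<rho> (fn n) z - prox UNIV \<rho> f z) \<le> \<alpha> n * norm z + \<beta> n)"
    and steps: "(1 / \<rho> - (\<Sum>k\<in>UNIV. \<sigma> k * (onorm (L k))\<^sup>2)) * \<mu> > 1 / 2"
  shows "\<exists>xs vs.
           xs \<in> borel_measurable M \<and> (\<forall>\<omega>\<in>space M. xs \<omega> \<in> primal_solutions f h g L) \<and>
           vs \<in> borel_measurable M \<and> (\<forall>\<omega>\<in>space M. vs \<omega> \<in> dual_solutions f h G g L) \<and>
           (AE \<omega> in M. (\<lambda>n. x n \<omega>) \<longlonglongrightarrow> xs \<omega>) \<and>
           (AE \<omega> in M. (\<lambda>n. v n \<omega>) \<longlonglongrightarrow> vs \<omega>)"
proof -
  interpret M: prob_space M by (rule M)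
  obtain zz where "0 \<in> subdifferential UNIV f zz
      + (\<Sum>k\<in>UNIV. adjoint (L k) ` subdifferential (G k) (g k) (L k zz)) + {grad_h zz}"
    using inclusion by blast
  then obtain a0 s0 where a0: "a0 \<in> subdifferential UNIV f zz"
    and s0: "\<And>k. s0 k \<in> adjoint (L k) ` subdifferential (G k) (g k) (L k zz)"
    and sum0: "0 = a0 + (\<Sum>k\<in>UNIV. s0 k) + grad_h zz"
    by (auto simp: set_plus_def set_sum_alt)
  \<comment> \<open>The subgradients \<open>vv k\<close> are used twice: they make the conjugates
    proper, and together with \<open>zz\<close> they form a fixed point of \<open>T\<close>.\<close>
  have "\<forall>k. \<exists>v. v \<in> subdifferential (G k) (g k) (L k zz) \<and> s0 k = adjoint (L k) v"
    using s0 by blast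
  then obtain vv where vv: "\<And>k. vv k \<in> subdifferential (G k) (g k) (L k zz)" "\<And>k. s0 k = adjoint (L k) (vv k)"
    by (auto dest!: choice)
  have g_conj: "fenchel_conjugate (G k) (g k) \<in> Gamma0 (G k)" for k
    using fenchel_conjugate_Gamma0[OF g L_range vv(1)] .
  interpret primal_dual_splitting f h grad_h G g L \<mu> \<rho> \<sigma>
    by (rule primal_dual_splitting.intro)
      (fact f \<mu> h_convex h_grad h_lipschitz G g g_conj L_linear L_range \<rho> \<sigma> steps)+
  define z where "z n \<omega> = (x n \<omega>, v n \<omega>)" for n \<omega>
  define s where "s n \<omega> = (y n \<omega>, w n \<omega>)" for n \<omega>
  \<comment> \<open>The dual iterates stay in the subspaces at every point of the space: proximity
    operators and errors take values there, and relaxation is linear.\<close>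
  have v_in: "v n \<omega> \<in> hilbert_sum G" if \<omega>: "\<omega> \<in> space M" for n \<omega>
  proof (induction n)
    case 0
    show ?case using v0 \<omega> by (auto simp: L2_rv_def)
  next
    case (Suc n)
    have "w n \<omega> $ k \<in> G k" for k
    proof -
      have "v n \<omega> $ k + \<sigma> k *\<^sub>R L k (2 *\<^sub>R y n \<omega> - x n \<omega>) \<in> G k"
        using Suc L_range G by (auto simp: hilbert_sum_def intro!: subspace_add subspace_scale)
      moreover have "c n \<omega> $ k \<in> G k" using c[of n] \<omega> by (auto simp: L2_rv_def hilbert_sum_def)
      ultimately show ?thesis
        unfolding w_def[OF \<omega>] by (rule subspace_add[OF G prox_in_space[OF g_conj G \<sigma>]])
    qed
    then show ?case
      using Suc G unfolding hilbert_sum_def mem_Collect_eq v_Suc[OF \<omega>]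
      by (intro allI subspace_add subspace_scale subspace_diff) auto
  qed
  define fixp where "fixp = (zz, \<chi> k. vv k)"
  have fixp: "fixp \<in> feasible" "T fixp = fixp"
  proof -
    have "vv k \<in> G k" for k using vv(1)[of k] by (simp add: subdifferential_def)
    then show feas: "fixp \<in> feasible" by (simp add: fixp_def feasible_def hilbert_sum_def)
    have "- (Ladj (snd fixp) + grad_h (fst fixp)) = a0"
      by (rule minus_unique) (use sum0 in \<open>simp add: fixp_def vv(2) add_ac\<close>)
    then show "T fixp = fixp"
      using a0 subdifferential_conjugate[OF g L_range vv(1)]
      by (intro fixed_pointI[OF feas]) (auto simp: fixp_def)
  qed
  obtain \<tau> where \<tau>: "\<And>n. 0 \<le> \<tau> n" "summable \<tau>"
    and var: "\<And>p. p \<in> primal_solutions f h g L \<Longrightarrow> \<exists>\<zeta> \<in> ell_plus_infty M \<X>.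
             (\<lambda>n \<omega>. l n * \<zeta> n \<omega>) \<in> ell_plus_half M \<X> \<and>
             (\<forall>n. AE \<omega> in M.
                real_cond_exp M (\<X> n) (\<lambda>\<omega>. (norm (u n \<omega> - vec_cond_exp M (\<X> n) (u n) \<omega>))\<^sup>2) \<omega>
                \<le> \<tau> n * (norm (grad_h (x n \<omega>) - grad_h p))\<^sup>2 + \<zeta> n \<omega>)"
    using u_var by blast
  obtain \<alpha> \<beta> where \<alpha>: "\<And>n. 0 \<le> \<alpha> n" "summable (\<lambda>n. sqrt (l n) * \<alpha> n)"
    and \<beta>: "\<And>n. 0 \<le> \<beta> n" "summable (\<lambda>n. l n * \<beta> n)"
    and approx: "\<And>n z. norm (prox UNIV \<rho> (fn n) z - prox UNIV \<rho> f z) \<le> \<alpha> n * norm z + \<beta> n"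
    using prox_approx by blast
  have pair_L2: "integrable M (\<lambda>\<omega>. (norm (z 0 \<omega>))\<^sup>2)"
    using x0 v0 by (simp add: z_def norm_Pair L2_rv_def)
  \<comment> \<open>The index \<open>m = n\<close> of the generated sigma-algebra in (a) already
    contains the preimages under the pair at time \<open>n\<close>.\<close>
  have z_meas: "z n \<in> borel_measurable (\<X> n)" for n
  proof (rule measurableI)
    have sp: "space (\<X> n) = space M" using \<X>[of n] by (simp add: subalgebra_def)
    fix A :: "('h \<times> ('g ^ 'q)) set" assume A: "A \<in> sets borel"
    have "z n -` A \<inter> space M \<in> sets (vimage_algebra (space M) (\<lambda>\<omega>. (x n \<omega>, v n \<omega>)) borel)"
      using in_vimage_algebra[OF A, of "z n" "space M"] by (simp add: z_def[abs_def])
    then have "z n -` A \<inter> space M \<in> sigma_sets (space M)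
        (\<Union>m\<in>{0..n}. sets (vimage_algebra (space M) (\<lambda>\<omega>. (x m \<omega>, v m \<omega>)) borel))"
      by (intro sigma_sets.Basic) auto
    then show "z n -` A \<inter> space (\<X> n) \<in> sets (\<X> n)" using a(1)[of n] sp by auto
  qed simp
  interpret S: stochastic_primal_dual f h grad_h G g L \<mu> \<rho> \<sigma> M \<X> z s u b c l \<alpha> \<beta> \<tau>
  proof unfold_locales
    fix n \<omega> assume \<omega>: "\<omega> \<in> space M"
    let ?a = "fst (z n \<omega>) - \<rho> *\<^sub>R (Ladj (snd (z n \<omega>)) + u n \<omega>)"
    \<comment> \<open>The discrepancy is evaluated at the argument of \<open>prox\<close>, so the
      relative error \<open>\<alpha>\<close> multiplies \<open>arg_norm\<close>. The dual residual
      equals \<open>c\<close> exactly, as \<open>w\<close> is computed from the same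
      \<open>y\<close>.\<close>
    have "fst (s n \<omega>) - primal_step (z n \<omega>) (u n \<omega>)
        = (prox UNIV \<rho> (fn n) ?a - prox UNIV \<rho> f ?a) + b n \<omega>"
      using y_def[OF \<omega>, of n] by (simp add: s_def z_def primal_step_def)
    then have "norm (fst (s n \<omega>) - primal_step (z n \<omega>) (u n \<omega>)) \<le> \<alpha> n * norm ?a + \<beta> n + norm (b n \<omega>)"
      using approx[of n ?a] norm_triangle_ineq[of "prox UNIV \<rho> (fn n) ?a - prox UNIV \<rho> f ?a" "b n \<omega>"] by simp
    then show "perturbed_step (z n \<omega>) (u n \<omega>) (\<alpha> n * norm ?a + \<beta> n + norm (b n \<omega>)) (norm (c n \<omega>)) (s n \<omega>)"
      using v_in[OF \<omega>] w_def[OF \<omega>, of n] Finite_Cartesian_Product.norm_nth_le[of "c n \<omega>"]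
      by (simp add: perturbed_step_def feasible_def z_def s_def)
    show "z (Suc n) \<omega> = z n \<omega> + l n *\<^sub>R (s n \<omega> - z n \<omega>)"
      using x_Suc[OF \<omega>, of n] v_Suc[OF \<omega>, of n] by (simp add: z_def s_def vec_eq_iff)
  next
    show "0 < l n" "l n \<le> 1" for n using l_range[of n] by auto
    show "u n \<in> borel_measurable M" "integrable M (\<lambda>\<omega>. (norm (u n \<omega>))\<^sup>2)"
      "b n \<in> borel_measurable M" "integrable M (\<lambda>\<omega>. (norm (b n \<omega>))\<^sup>2)"
      "c n \<in> borel_measurable M" "integrable M (\<lambda>\<omega>. (norm (c n \<omega>))\<^sup>2)" for n
      using u[of n] b[of n] c[of n] by (auto simp: L2_rv_def)
    show "AE \<omega> in M. summable (\<lambda>n. sqrt (l n) * norm (vec_cond_exp M (\<X> n) (u n) \<omega> - grad_h (fst (z n \<omega>))))"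
      using u_bias by (simp add: z_def)
    show "\<exists>p\<in>feasible. T p = p" using fixp by blast
    show "\<exists>\<zeta>\<in>ell_plus_infty M \<X>. (\<lambda>n \<omega>. l n * \<zeta> n \<omega>) \<in> ell_plus_half M \<X> \<and>
        (\<forall>n. AE \<omega> in M. real_cond_exp M (\<X> n) (\<lambda>\<omega>. (norm (u n \<omega> - vec_cond_exp M (\<X> n) (u n) \<omega>))\<^sup>2) \<omega>
           \<le> \<tau> n * (norm (grad_h (fst (z n \<omega>)) - grad_h p))\<^sup>2 + \<zeta> n \<omega>)"
      if "p \<in> primal_solutions f h g L" for p
      using var[OF that] by (simp add: z_def)
  qed (fact \<X> a(2) l_sum z_meas pair_L2 b_sum c_sum \<tau> \<alpha> \<beta>)+
  obtain Z where Z: "Z \<in> borel_measurable M" "\<And>\<omega>. \<omega> \<in> space M \<Longrightarrow> Z \<omega> \<in> feasible \<and> T (Z \<omega>) = Z \<omega>"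
      "AE \<omega> in M. (\<lambda>n. z n \<omega>) \<longlonglongrightarrow> Z \<omega>"
    using S.converges_to_fixed_point by blast
  show ?thesis
  proof (intro exI[of _ "\<lambda>\<omega>. fst (Z \<omega>)"] exI[of _ "\<lambda>\<omega>. snd (Z \<omega>)"] conjI ballI)
    show "(\<lambda>\<omega>. fst (Z \<omega>)) \<in> borel_measurable M"
      by (rule borel_measurable_continuous_on[OF _ Z(1)]) (intro continuous_intros)
    show "(\<lambda>\<omega>. snd (Z \<omega>)) \<in> borel_measurable M"
      by (rule borel_measurable_continuous_on[OF _ Z(1)]) (intro continuous_intros)
    show "fst (Z \<omega>) \<in> primal_solutions f h g L" "snd (Z \<omega>) \<in> dual_solutions f h G g L" if "\<omega> \<in> space M" for \<omega>
      using Z(2)[OF that] fixed_point_primal fixed_point_dual by auto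
    show "AE \<omega> in M. (\<lambda>n. x n \<omega>) \<longlonglongrightarrow> fst (Z \<omega>)"
      using Z(3) by eventually_elim (drule tendsto_fst, simp add: z_def)
    show "AE \<omega> in M. (\<lambda>n. v n \<omega>) \<longlonglongrightarrow> snd (Z \<omega>)"
      using Z(3) by eventually_elim (drule tendsto_snd, simp add: z_def)
  qed
qed

end
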